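(* For all integers $k\ge1$ and $N_1,N_2,\ldots,N_k\ge2$, with $\mathbf N=(N_1,\ldots,N_k)$, the following assertions hold: (i) The power series $\mathbf q_{\mathbf N}(z)$ can be continued to an analytic function on $\mathbb C\setminus[1/C_{\mathbf N},+\infty)$. (ii) The point $1/C_{\mathbf N}$ is a branch point of $\mathbf q_{\mathbf N}(z)$. (iii) We have $$\lim_{z\to\infty}\mathbf q_{\mathbf N}(z)=-\exp\big(-\pi\cot(\pi/M_{\mathbf N})\big),$$ where $M_{\mathbf N}=\max(N_1,\ldots,N_k)$, and where the limit has to be performed along a path that avoids the cut $[1/C_{\mathbf N},+\infty)$.
   Context: For an integer $N\ge 2$ let $r_1,\ldots,r_{\varphi(N)}$ be the integers in $\{1,\ldots,N\}$ coprime to $N$ ($\varphi$ is Euler's totient), and put $C_N:=N^{\varphi(N)}\prod_{p\mid N}p^{\varphi(N)/(p-1)}$ (product over primes $p$ dividing $N$). With $(\alpha)_m=\alpha(\alpha+1)\cdots(\alpha+m-1)$, $(\alpha)_0=1$, and $H(x,m)=\sum_{n=0}^{m-1}\frac1{x+n}$, define for $m\ge0$ $$\mathbf B_N(m)=C_N^m\prod_{j=1}^{\varphi(N)}\frac{(r_j/N)_m}{m!},\qquad \mathbf H_N(m)=\sum_{j=1}^{\varphi(N)}H(r_j/N,m)-\varphi(N)H(1,m).$$ For $\mathbf N=(N_1,\ldots,N_k)$ put $C_{\mathbf N}=\prod_{j=1}^kC_{N_j}$, $\mathbf B_{\mathbf N}(m)=\prod_{j=1}^k\mathbf B_{N_j}(m)$,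 $\mathbf H_{\mathbf N}(m)=\sum_{j=1}^k\mathbf H_{N_j}(m)$, and $$\mathbf F_{\mathbf N}(z)=\sum_{m\ge0}\mathbf B_{\mathbf N}(m)z^m,\qquad \mathbf G_{\mathbf N}(z)=\sum_{m\ge1}\mathbf H_{\mathbf N}(m)\mathbf B_{\mathbf N}(m)z^m.$$ The canonical coordinate is the power series $\mathbf q_{\mathbf N}(z)=z\exp\big(\mathbf G_{\mathbf N}(z)/\mathbf F_{\mathbf N}(z)\big)$; in (ii) and (iii), $\mathbf q_{\mathbf N}$ denotes the analytic continuation from (i). *)

theory Defs
  imports "HOL-Complex_Analysis.Complex_Analysis" "HOL-Number_Theory.Totient"
begin

text \<open>The truncating division in the exponent is exact; see the next lemma.\<close>
definition C_one :: "nat \<Rightarrow> real" where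
  "C_one N = real N ^ totient N * (\<Prod>p\<in>prime_factors N. real p ^ (totient N div (p - 1)))"

lemma prime_minus_one_dvd_totient:
  assumes "p \<in> prime_factors N"
  shows "(p - 1) dvd totient N"
  using assms totient_dvd[of p N] totient_prime[of p] by (auto simp: in_prime_factors_iff)

definition H_sum :: "real \<Rightarrow> nat \<Rightarrow> real" where
  "H_sum x m = (\<Sum>n<m. 1 / (x + real n))"

definition B_one :: "nat \<Rightarrow> nat \<Rightarrow> real" where
  "B_one N m = C_one N ^ m * (\<Prod>r\<in>totatives N. pochhammer (real r / real N) m / fact m)"

definition H_one :: "nat \<Rightarrow> nat \<Rightarrow> real" where
  "H_one N m = (\<Sum>r\<in>totatives N. H_sum (real r / real N) m) - real (totient N) * H_sum 1 m"

definition C_vec :: "nat list \<Rightarrow> real" where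
  "C_vec Ns = (\<Prod>N\<leftarrow>Ns. C_one N)"

definition B_vec :: "nat list \<Rightarrow> nat \<Rightarrow> real" where
  "B_vec Ns m = (\<Prod>N\<leftarrow>Ns. B_one N m)"

definition H_vec :: "nat list \<Rightarrow> nat \<Rightarrow> real" where
  "H_vec Ns m = (\<Sum>N\<leftarrow>Ns. H_one N m)"

definition F_series :: "nat list \<Rightarrow> complex fps" where
  "F_series Ns = Abs_fps (\<lambda>m. complex_of_real (B_vec Ns m))"

definition G_series :: "nat list \<Rightarrow> complex fps" where
  "G_series Ns = Abs_fps (\<lambda>m. if m \<ge> 1 then complex_of_real (H_vec Ns m * B_vec Ns m) else 0)"

text \<open>The quotient has constant coefficient \<open>0\<close>, since \<open>F_series Ns\<close> has constant coefficient
  \<open>1\<close> and \<open>G_series Ns\<close> has constant coefficient \<open>0\<close>; so the composition is the usual formal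
  exponential of the quotient.\<close>
definition q_series :: "nat list \<Rightarrow> complex fps" where
  "q_series Ns = fps_X * (fps_exp 1 oo (G_series Ns / F_series Ns))"

definition slit_plane :: "nat list \<Rightarrow> complex set" where
  "slit_plane Ns = - complex_of_real ` {1 / C_vec Ns..}"

text \<open>Analytic continuation along the path \<open>\<gamma>\<close>: a function element \<open>h t\<close> at every point \<open>\<gamma> t\<close>
  such that, for \<open>s\<close> close to \<open>t\<close>, \<open>h s\<close> and \<open>h t\<close> have the same germ at \<open>\<gamma> s\<close>.  Only the germ of
  \<open>h t\<close> at \<open>\<gamma> t\<close> matters.\<close>
definition analytic_continuation_along ::
    "(real \<Rightarrow> complex) \<Rightarrow> (real \<Rightarrow> complex \<Rightarrow> complex) \<Rightarrow> bool" where
  "analytic_continuation_along \<gamma> h \<longleftrightarrow>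
     path \<gamma> \<and>
     (\<forall>t\<in>{0..1}. h t analytic_on {\<gamma> t}) \<and>
     (\<forall>t\<in>{0..1}. \<forall>\<^sub>F s in at t within {0..1}. \<forall>\<^sub>F z in nhds (\<gamma> s). h s z = h t z)"

text \<open>The point \<open>a\<close> is a branch point of the function \<open>f\<close>, analytic on \<open>D\<close>: the germ of \<open>f\<close> at every
  point of \<open>D\<close> sufficiently close to \<open>a\<close> can be continued once around the circle centred at \<open>a\<close>
  through that point, and the continuation ends with a different germ.  Unrestricted
  continuation in a punctured disc around \<open>a\<close> is not demanded: a zero of the continued
  denominator may produce further singularities arbitrarily close to \<open>a\<close> after many turns.\<close>
definition branch_point :: "(complex \<Rightarrow> complex) \<Rightarrow> complex set \<Rightarrow> complex \<Rightarrow> bool" where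
  "branch_point f D a \<longleftrightarrow>
     a islimpt D \<and>
     (\<exists>\<epsilon>>0. \<forall>z\<in>D. 0 < dist z a \<and> dist z a < \<epsilon> \<longrightarrow>
        (\<exists>h. analytic_continuation_along
               (\<lambda>t. a + (z - a) * exp (2 * of_real pi * \<i> * of_real t)) h \<and>
             (\<forall>\<^sub>F w in nhds z. h 0 w = f w) \<and>
             \<not> (\<forall>\<^sub>F w in nhds z. h 1 w = f w)))"

end

theory Submission
  imports Defs "HOL-Probability.Probability"
begin

text \<open>Scale the variable to \<open>x = C z\<close>, where \<open>C = C_vec Ns\<close>.  Euler's beta integral says that
\<open>(a)\<^sub>m / m!\<close> is the \<open>m\<close>-th moment of the Beta distribution with parameters \<open>a\<close> and \<open>1 - a\<close>.  So
\<open>B_vec Ns m / C^m\<close> is the \<open>m\<close>-th moment of the law \<open>P\<close> of a product of independent beta variables,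
one for every fraction \<open>r / N\<close>, and \<open>F\<close> is the Stieltjes transform \<open>F(x) = \<integral> dP(t) / (1 - x t)\<close>.
The harmonic sums are logarithmic derivatives of the moments, whence \<open>G = L + ln C * F\<close> with
\<open>L(x) = \<integral> ln t / (1 - x t) dP(t)\<close>; the constant enters through \<open>\<integral> ln t dP = - ln C\<close>, a sum of
digamma values that is computed by induction on the prime factorisation of \<open>N\<close>
(\<open>sum_Digamma_totatives\<close>).  Altogether \<open>q(z) = x exp (L(x) / F(x))\<close>.

The kernel \<open>1 / (1 - x t)\<close> maps the upper half-plane to itself, so \<open>F\<close> has no zero off the cut
\<open>[1, \<infinity>)\<close> and \<open>q\<close> is holomorphic there (\<open>stieltjes_nonzero\<close>, \<open>mirror_map_holomorphic\<close>).

For the other two assertions one writes \<open>q = exp (K / F)\<close> with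
\<open>K = L + Ln x * F = \<integral> log (x t) / (1 - x t) dP(t)\<close>.  As \<open>log y / (1 - y)\<close> is regular at \<open>y = 1\<close>,
the function \<open>K\<close> has no cut along \<open>[1, \<infinity>)\<close>; there only \<open>F\<close> is multivalued.

At \<open>x = 1\<close>: the density of \<open>P\<close> at \<open>t = 1 - v\<close> is a real power of \<open>v\<close> times a function analytic in
the unit disc (\<open>prod_measure_edge_density\<close>).  Comparison with a density whose transform is known
shows that \<open>F = A + B * \<Lambda>(Ln (1 - x))\<close> near \<open>1\<close>, with \<open>A\<close>, \<open>B\<close> holomorphic and \<open>\<Lambda>(w)\<close> equal to \<open>w\<close>
or to \<open>exp (g w)\<close> with \<open>-1 < g < 0\<close> (\<open>stieltjes_near_1\<close>).  A turn around \<open>1\<close> adds \<open>2 \<pi> i\<close> to \<open>w\<close>.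
On every sheet involved, \<open>1 / F\<close> has the same finite limit at \<open>1\<close>, so that the turn changes the
exponent \<open>K / F\<close> by a small amount, and this amount is not \<open>0\<close> because \<open>K(1) < 0\<close>.  Hence the
exponential changes (\<open>mirror_map_branch\<close>).

At infinity: let \<open>\<alpha> = 1 / M\<close>, the smallest of the fractions \<open>r / N\<close>, and split off one beta
variable with this parameter.  Then \<open>F\<close> and \<open>K\<close> are averages of \<open>F\<^sub>1(x t)\<close> and \<open>K\<^sub>1(x t)\<close>, where
\<open>F\<^sub>1(x) = (1 - x)^(-\<alpha>)\<close> and \<open>K\<^sub>1\<close> solves a linear differential equation of the first order.  From
the equation, \<open>K\<^sub>1 / F\<^sub>1\<close> tends to \<open>\<kappa> = i \<pi> - \<pi> cot (\<pi> \<alpha>)\<close> in the upper half-plane, uniformly up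
to the real axis.  The minimality of \<open>\<alpha>\<close> makes the part of the average where \<open>x t\<close> stays bounded
negligible, so \<open>K / F\<close> has the same limit (\<open>log_transform_div_stieltjes_tendsto\<close>), and
\<open>exp \<kappa> = - exp (- \<pi> cot (\<pi> / M))\<close>.\<close>

section \<open>Holomorphic parameter integrals\<close>

text \<open>Cauchy's estimate turns an integrable bound on a disc into an integrable bound for the difference
quotients at its centre, so dominated convergence gives the derivative under the integral.\<close>

lemma holomorphic_on_lebesgue_integral:
  fixes f :: "complex \<Rightarrow> 'a \<Rightarrow> complex"
  assumes S: "open S"
    and meas: "\<And>z. z \<in> S \<Longrightarrow> f z \<in> borel_measurable M"
    and holo: "AE t in M. (\<lambda>z. f z t) holomorphic_on S"
    and dom: "\<And>z. z \<in> S \<Longrightarrow> \<exists>r>0. cball z r \<subseteq> S \<and>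
                (\<exists>g. integrable M g \<and> (AE t in M. \<forall>w\<in>cball z r. norm (f w t) \<le> g t))"
  shows "(\<lambda>z. LINT t|M. f z t) holomorphic_on S"
proof -
  have "(\<lambda>z. LINT t|M. f z t) field_differentiable at z" if z: "z \<in> S" for z
  proof -
    from dom[OF z] obtain r g where r: "r > 0" "cball z r \<subseteq> S" and g: "integrable M g"
      and bd: "AE t in M. \<forall>w\<in>cball z r. norm (f w t) \<le> g t" by blast
    have int: "integrable M (f w)" if "w \<in> cball z r" for w
    proof (rule Bochner_Integration.integrable_bound[OF g])
      show "f w \<in> borel_measurable M" using that r by (intro meas) auto
      show "AE t in M. norm (f w t) \<le> norm (g t)"
        using bd by eventually_elim (use that in fastforce)
    qed
    have quot: "AE t in M. (\<lambda>z. f z t) field_differentiable at z \<and>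
        (\<forall>w\<in>ball z (r/2). norm (f w t - f z t) \<le> (2 * g t / r) * norm (w - z))"
      using holo bd
    proof eventually_elim
      case (elim t)
      have hol: "(\<lambda>z. f z t) holomorphic_on S" by (rule elim(1))
      have fd: "(\<lambda>z. f z t) field_differentiable at w" if "w \<in> S" for w
        using hol S that by (simp add: holomorphic_on_open field_differentiable_def)
      have bdd: "norm (deriv (\<lambda>z. f z t) w) \<le> 2 * g t / r" if w: "w \<in> ball z (r/2)" for w
      proof -
        have sub: "cball w (r/2) \<subseteq> cball z r"
        proof
          fix u assume "u \<in> cball w (r/2)"
          then show "u \<in> cball z r" using w dist_triangle[of z u w] by (auto simp: dist_commute)
        qed
        have "norm ((deriv ^^ 1) (\<lambda>z. f z t) w) \<le> fact 1 * g t / (r/2) ^ 1"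
        proof (rule Cauchy_inequality)
          have h: "(\<lambda>z. f z t) holomorphic_on cball w (r/2)"
            using hol sub r by (meson holomorphic_on_subset subset_trans)
          then show "(\<lambda>z. f z t) holomorphic_on ball w (r/2)"
            using ball_subset_cball holomorphic_on_subset by blast
          show "continuous_on (cball w (r/2)) (\<lambda>z. f z t)"
            using h by (rule holomorphic_on_imp_continuous_on)
          show "0 < r/2" using r by simp
          show "norm (f x t) \<le> g t" if "norm (w - x) = r/2" for x
            using elim(2) sub that by (auto simp: dist_norm)
        qed
        then show ?thesis by (simp add: mult.commute)
      qed
      have "norm (f w t - f z t) \<le> (2 * g t / r) * norm (w - z)" if w: "w \<in> ball z (r/2)" for w
      proof (rule field_differentiable_bound[where S="ball z (r/2)" and f'="deriv (\<lambda>z. f z t)"])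
        show "convex (ball z (r/2))" by simp
        fix u assume u: "u \<in> ball z (r/2)"
        then have "u \<in> S" using r by auto
        then show "((\<lambda>z. f z t) has_field_derivative deriv (\<lambda>z. f z t) u) (at u within ball z (r/2))"
          using fd has_field_derivative_at_within field_differentiable_derivI by blast
        show "norm (deriv (\<lambda>z. f z t) u) \<le> 2 * g t / r" by (rule bdd[OF u])
      qed (use w r in auto)
      then show ?case using fd[OF z] by blast
    qed
    define Y where "Y i = z + of_real (r / (4 * (real i + 1)))" for i :: nat
    have Y: "Y i \<in> ball z (r/2) - {z}" for i
    proof -
      have "r / (4 * (real i + 1)) < r / 2"
        using r by (intro divide_strict_left_mono) auto
      moreover have "r / (4 * (real i + 1)) > 0" using r by simp
      ultimately show ?thesis using r
        by (simp add: Y_def dist_norm norm_divide norm_mult flip: of_real_divide)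
    qed
    have Ylim: "Y \<longlonglongrightarrow> z"
    proof -
      have "(\<lambda>i. r / (4 * (real i + 1))) \<longlonglongrightarrow> 0" by real_asymp
      then have "(\<lambda>i. z + of_real (r / (4 * (real i + 1)))) \<longlonglongrightarrow> z + of_real 0"
        by (intro tendsto_intros)
      then show ?thesis by (simp add: Y_def[abs_def])
    qed
    let ?q = "\<lambda>X i t. (f (X i) t - f z t) / (X i - z)"
    have ptw: "AE t in M. (\<lambda>i. ?q X i t) \<longlonglongrightarrow> deriv (\<lambda>z. f z t) z"
      if X: "\<forall>i. X i \<in> ball z (r/2) - {z}" and lim: "X \<longlonglongrightarrow> z" for X :: "nat \<Rightarrow> complex"
      using quot
    proof eventually_elim
      case (elim t)
      then have "((\<lambda>z. f z t) has_field_derivative deriv (\<lambda>z. f z t) z) (at z)"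
        by (simp add: DERIV_deriv_iff_field_differentiable)
      then have "((\<lambda>w. (f w t - f z t) / (w - z)) \<longlongrightarrow> deriv (\<lambda>z. f z t) z) (at z)"
        by (simp add: has_field_derivative_iff)
      moreover have "filterlim X (at z) sequentially"
        using lim X by (auto simp: filterlim_at)
      ultimately show ?case by (rule filterlim_compose)
    qed
    have sm: "?q X i \<in> borel_measurable M" if X: "\<forall>i. X i \<in> ball z (r/2) - {z}" for X i
    proof -
      have "X i \<in> cball z r" using X[rule_format, of i] r by auto
      then have "X i \<in> S" using r(2) by blast
      then show ?thesis using meas[of "X i"] meas[OF z] by measurable
    qed
    \<comment> \<open>The difference quotients along one fixed sequence give a measurable version of the
      derivative.\<close>
    define D where "D t = lim (\<lambda>i. ?q Y i t)" for t
    have D_meas: "D \<in> borel_measurable M"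
      unfolding D_def[abs_def] using sm[OF allI[OF Y]] by (rule borel_measurable_lim_metric)
    have D_eq: "AE t in M. D t = deriv (\<lambda>z. f z t) z"
      using ptw[OF allI[OF Y] Ylim] by eventually_elim (simp add: D_def limI)
    let ?D = "LINT t|M. D t"
    have "((\<lambda>w. ((LINT t|M. f w t) - (LINT t|M. f z t)) / (w - z)) \<longlongrightarrow> ?D) (at z within ball z (r/2))"
    proof (unfold tendsto_at_iff_sequentially, intro allI impI)
      fix X :: "nat \<Rightarrow> complex"
      assume X: "\<forall>i. X i \<in> ball z (r/2) - {z}" and lim: "X \<longlonglongrightarrow> z"
      have Xc: "X i \<in> cball z r" for i using X[rule_format, of i] r by auto
      have lim_q: "(\<lambda>i. LINT t|M. ?q X i t) \<longlonglongrightarrow> ?D"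
      proof (rule integral_dominated_convergence[where w="\<lambda>t. 2 * g t / r"])
        show "AE t in M. (\<lambda>i. ?q X i t) \<longlonglongrightarrow> D t"
          using ptw[OF X lim] D_eq by eventually_elim simp
        show "AE t in M. norm (?q X i t) \<le> 2 * g t / r" for i
          using quot
        proof eventually_elim
          case (elim t)
          have "X i \<noteq> z" "X i \<in> ball z (r/2)" using X by auto
          then show ?case using elim
            by (auto simp: norm_divide pos_divide_le_eq)
        qed
      qed (use D_meas sm[OF X] g in auto)
      have eq: "(LINT t|M. ?q X i t) = ((LINT t|M. f (X i) t) - (LINT t|M. f z t)) / (X i - z)" for i
        using int[OF Xc] int[of z] r by simp
      show "((\<lambda>w. ((LINT t|M. f w t) - (LINT t|M. f z t)) / (w - z)) \<circ> X) \<longlonglongrightarrow> ?D"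
        using lim_q unfolding o_def eq .
    qed
    then have "((\<lambda>z. LINT t|M. f z t) has_field_derivative ?D) (at z within ball z (r/2))"
      by (simp add: has_field_derivative_iff)
    then show ?thesis using r
      by (metis at_within_open centre_in_ball field_differentiable_def half_gt_zero open_ball)
  qed
  then show ?thesis
    by (simp add: holomorphic_on_def field_differentiable_at_within)
qed

section \<open>Stieltjes transforms of measures on the unit interval\<close>

abbreviation cut_plane :: "complex set" where
  "cut_plane \<equiv> - complex_of_real ` {1..}"

lemma open_cut_plane: "open cut_plane"
proof -
  have "closed (complex_of_real ` {1..})"
    by (intro closed_injective_linear_image) (auto intro: bounded_linear.linear bounded_linear_of_real simp: inj_on_def)
  then show ?thesis by blast
qed

text \<open>The closed disc times \<open>[0, 1]\<close> is compact and \<open>1 - w t\<close> has no zero on it.  This lower bound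
dominates every kernel with denominator \<open>1 - x t\<close>.\<close>

lemma cut_plane_bound:
  assumes "x \<in> cut_plane"
  obtains r c where "r > 0" "c > 0" "cball x r \<subseteq> cut_plane"
    "\<And>w t. w \<in> cball x r \<Longrightarrow> 0 \<le> t \<Longrightarrow> t \<le> 1 \<Longrightarrow> c \<le> norm (1 - w * complex_of_real t)"
proof -
  obtain r where r: "r > 0" "cball x r \<subseteq> cut_plane"
    using open_cut_plane assms open_contains_cball by blast
  let ?f = "\<lambda>(w, t). norm (1 - w * complex_of_real t)"
  let ?A = "cball x r \<times> {0..1::real}"
  have "continuous_on ?A ?f"
    by (auto simp: case_prod_beta intro!: continuous_intros)
  moreover have "compact ?A" by (intro compact_Times) auto
  moreover have "?A \<noteq> {}" using r by auto
  ultimately obtain p where p: "p \<in> ?A" "\<And>q. q \<in> ?A \<Longrightarrow> ?f p \<le> ?f q"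
    using continuous_attains_inf[of ?A ?f] by blast
  obtain w t where wt: "p = (w, t)" "w \<in> cball x r" "0 \<le> t" "t \<le> 1" using p by auto
  have "1 - w * complex_of_real t \<noteq> 0"
  proof
    assume "1 - w * complex_of_real t = 0"
    then have *: "w * complex_of_real t = 1" by simp
    then have "t > 0" using wt by (cases "t = 0") auto
    then have "w = complex_of_real (1 / t)" using * by (simp add: field_simps)
    moreover have "1 / t \<in> {1..}" using \<open>t > 0\<close> wt by simp
    ultimately show False using r wt by blast
  qed
  then have "?f p > 0" by (simp add: wt)
  then show ?thesis using that[of r "?f p"] r p by auto
qed

lemma cut_plane_nonzero:
  assumes "x \<in> cut_plane" "0 \<le> t" "t \<le> 1"
  shows "1 - x * complex_of_real t \<noteq> 0"
  using cut_plane_bound[OF assms(1)] assms by (metis centre_in_cball norm_zero not_less order_less_imp_le)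

text \<open>The value at \<open>1\<close> removes the singularity of \<open>Ln x / (1 - x)\<close>.\<close>

definition log_kernel :: "complex \<Rightarrow> complex" where
  "log_kernel x = (if x = 1 then -1 else Ln x / (1 - x))"

lemma log_kernel_holomorphic: "log_kernel holomorphic_on - \<real>\<^sub>\<le>\<^sub>0"
proof (rule no_isolated_singularity')
  show "log_kernel holomorphic_on - \<real>\<^sub>\<le>\<^sub>0 - {1}"
  proof (rule holomorphic_transform)
    show "(\<lambda>x. Ln x / (1 - x)) holomorphic_on - \<real>\<^sub>\<le>\<^sub>0 - {1}"
      by (intro holomorphic_intros) auto
  qed (auto simp: log_kernel_def)
  show "(log_kernel \<longlongrightarrow> log_kernel z) (at z within - \<real>\<^sub>\<le>\<^sub>0)" if "z \<in> {1}" for z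
  proof -
    have "(Ln has_field_derivative 1) (at 1)"
      by (auto intro!: derivative_eq_intros)
    then have "((\<lambda>x. (Ln x - Ln 1) / (x - 1)) \<longlongrightarrow> 1) (at 1)"
      by (simp add: has_field_derivative_iff)
    then have "((\<lambda>x. - ((Ln x - Ln 1) / (x - 1))) \<longlongrightarrow> - 1) (at 1)"
      by (rule tendsto_minus)
    then have "(log_kernel \<longlongrightarrow> - 1) (at 1)"
    proof (rule Lim_transform_eventually)
      show "\<forall>\<^sub>F x in at 1. - ((Ln x - Ln 1) / (x - 1)) = log_kernel x"
        by (auto simp: eventually_at_filter log_kernel_def minus_divide_right intro!: always_eventually)
    qed
    then show ?thesis using that by (auto simp: log_kernel_def intro: tendsto_within_subset)
  qed
  show "open (- \<real>\<^sub>\<le>\<^sub>0 :: complex set)" by (simp add: open_Compl)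
qed auto

text \<open>Near \<open>1\<close> the kernel is continuous; elsewhere the denominator is bounded away from \<open>0\<close> and the
argument of the logarithm is at most \<open>\<pi>\<close>.  The bound is uniform up to the negative axis.\<close>

lemma log_kernel_bound:
  obtains C where "C > 0" "\<And>x. x \<notin> \<real>\<^sub>\<le>\<^sub>0 \<Longrightarrow> norm (log_kernel x) \<le> C * (1 + \<bar>ln (norm x)\<bar>)"
proof -
  have sub: "cball 1 (1/2) \<subseteq> - (\<real>\<^sub>\<le>\<^sub>0 :: complex set)"
  proof
    fix z :: complex assume "z \<in> cball 1 (1/2)"
    then have "norm (1 - z) \<le> 1/2" by (simp add: dist_norm)
    then have "Re (1 - z) \<le> 1/2" using complex_Re_le_cmod[of "1 - z"] by linarith
    then show "z \<in> - \<real>\<^sub>\<le>\<^sub>0" by (auto simp: complex_nonpos_Reals_iff)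
  qed
  have "compact (log_kernel ` cball 1 (1/2))"
    using log_kernel_holomorphic sub
    by (intro compact_continuous_image) (auto intro: holomorphic_on_imp_continuous_on holomorphic_on_subset)
  then have "bounded (log_kernel ` cball 1 (1/2))" by (rule compact_imp_bounded)
  then obtain B where B: "\<And>x. x \<in> cball 1 (1/2) \<Longrightarrow> norm (log_kernel x) \<le> B"
    by (auto simp: bounded_iff simp del: mem_cball)
  have "norm (log_kernel 1) \<le> B" by (rule B) simp
  then have B0: "B \<ge> 0" by (meson norm_ge_zero order_trans)
  show ?thesis
  proof (rule that[of "B + 2 * (1 + pi)"])
    fix x :: complex assume x: "x \<notin> \<real>\<^sub>\<le>\<^sub>0"
    show "norm (log_kernel x) \<le> (B + 2 * (1 + pi)) * (1 + \<bar>ln (norm x)\<bar>)"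
    proof (cases "x \<in> cball 1 (1/2)")
      case True
      have "norm (log_kernel x) \<le> B * 1" using B[OF True] by simp
      also have "\<dots> \<le> (B + 2 * (1 + pi)) * (1 + \<bar>ln (norm x)\<bar>)"
        using B0 pi_gt_zero by (intro mult_mono) auto
      finally show ?thesis .
    next
      case False
      have x0: "x \<noteq> 0" using x by auto
      have d: "norm (1 - x) \<ge> 1/2" using False by (simp add: dist_norm)
      have "norm (Ln x) \<le> \<bar>Re (Ln x)\<bar> + \<bar>Im (Ln x)\<bar>" by (rule cmod_le)
      also have "\<dots> \<le> \<bar>ln (norm x)\<bar> + pi"
        using x0 mpi_less_Im_Ln[of x] Im_Ln_le_pi[of x] by auto
      finally have n: "norm (Ln x) \<le> \<bar>ln (norm x)\<bar> + pi" .
      have "norm (log_kernel x) = norm (Ln x) / norm (1 - x)"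
        using False by (auto simp: log_kernel_def norm_divide)
      also have "\<dots> \<le> (\<bar>ln (norm x)\<bar> + pi) / (1/2)"
        using n d by (intro frac_le) auto
      also have "\<dots> \<le> 2 * (1 + pi) * (1 + \<bar>ln (norm x)\<bar>)"
        using pi_gt_zero by (simp add: field_simps)
      also have "\<dots> \<le> (B + 2 * (1 + pi)) * (1 + \<bar>ln (norm x)\<bar>)"
        using B0 by (intro mult_right_mono) auto
      finally show ?thesis .
    qed
  qed (use B0 pi_gt_zero in \<open>simp add: add_nonneg_pos add_pos_pos\<close>)
qed

text \<open>The moments of such a measure are the coefficients of \<open>F\<close>, and its logarithmic moments give those
of \<open>G\<close>.  The point \<open>1\<close> belongs to the support because the empty product of random variables has the
unit mass at \<open>1\<close> as its law.\<close>

locale unit_measure = prob_space M for M :: "real measure" +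
  assumes sets_M[measurable_cong]: "sets M = sets borel"
    and supp: "AE t in M. 0 < t \<and> t \<le> 1"
    and int_ln: "integrable M ln"
begin

definition stieltjes :: "complex \<Rightarrow> complex" where
  "stieltjes x = (LINT t|M. 1 / (1 - x * of_real t))"

definition log_stieltjes :: "complex \<Rightarrow> complex" where
  "log_stieltjes x = (LINT t|M. of_real (ln t) / (1 - x * of_real t))"

text \<open>Equal to \<open>log_stieltjes x + Ln x * stieltjes x\<close> off the cuts, but without the cut \<open>[1, \<infinity>)\<close>.\<close>

definition log_transform :: "complex \<Rightarrow> complex" where
  "log_transform x = (LINT t|M. log_kernel (x * of_real t))"

lemma integrable_kernel:
  fixes f :: "real \<Rightarrow> complex"
  assumes x: "x \<in> cut_plane" and f: "integrable M f"
  shows "integrable M (\<lambda>t. f t / (1 - x * of_real t))"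
proof -
  obtain r c where c: "c > 0"
    "\<And>w t. w \<in> cball x r \<Longrightarrow> 0 \<le> t \<Longrightarrow> t \<le> 1 \<Longrightarrow> c \<le> norm (1 - w * complex_of_real t)" "r > 0"
    using cut_plane_bound[OF x] by metis
  have [measurable]: "f \<in> borel_measurable M" using f by simp
  show ?thesis
  proof (rule Bochner_Integration.integrable_bound)
    show "integrable M (\<lambda>t. f t / of_real c)" using f by simp
    show "AE t in M. norm (f t / (1 - x * of_real t)) \<le> norm (f t / of_real c)"
      using supp
    proof eventually_elim
      case (elim t)
      then have "c \<le> norm (1 - x * of_real t)" using c by auto
      then show ?case using c(1) by (auto simp: norm_divide intro!: divide_left_mono mult_pos_pos)
    qed
  qed measurable
qed

lemma kernel_transform_holomorphic:
  fixes f :: "real \<Rightarrow> complex"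
  assumes f: "integrable M f"
  shows "(\<lambda>x. LINT t|M. f t / (1 - x * of_real t)) holomorphic_on cut_plane"
proof (rule holomorphic_on_lebesgue_integral[OF open_cut_plane])
  have [measurable]: "f \<in> borel_measurable M" using f by simp
  show "(\<lambda>t. f t / (1 - x * of_real t)) \<in> borel_measurable M" for x by measurable
  show "AE t in M. (\<lambda>x. f t / (1 - x * of_real t)) holomorphic_on cut_plane"
    using supp
  proof eventually_elim
    case (elim t)
    show ?case by (intro holomorphic_intros) (use elim cut_plane_nonzero in auto)
  qed
  fix x assume x: "x \<in> cut_plane"
  obtain r c where c: "r > 0" "c > 0" "cball x r \<subseteq> cut_plane"
    "\<And>w t. w \<in> cball x r \<Longrightarrow> 0 \<le> t \<Longrightarrow> t \<le> 1 \<Longrightarrow> c \<le> norm (1 - w * complex_of_real t)"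
    using cut_plane_bound[OF x] by metis
  have "AE t in M. \<forall>w\<in>cball x r. norm (f t / (1 - w * of_real t)) \<le> norm (f t) / c"
    using supp
  proof eventually_elim
    case (elim t)
    show ?case
    proof
      fix w assume "w \<in> cball x r"
      then have "c \<le> norm (1 - w * of_real t)" using c elim by auto
      then show "norm (f t / (1 - w * of_real t)) \<le> norm (f t) / c"
        using c by (auto simp: norm_divide intro!: divide_left_mono mult_pos_pos)
    qed
  qed
  moreover have "integrable M (\<lambda>t. norm (f t) / c)" using f by simp
  ultimately show "\<exists>r>0. cball x r \<subseteq> cut_plane \<and> (\<exists>g. integrable M g \<and>
      (AE t in M. \<forall>w\<in>cball x r. norm (f t / (1 - w * of_real t)) \<le> g t))"
    using c(1,3) by blast
qed

lemma int_ln_complex: "integrable M (\<lambda>t. complex_of_real (ln t))"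
  using int_ln by simp

lemma stieltjes_holomorphic: "stieltjes holomorphic_on cut_plane"
  using kernel_transform_holomorphic[of "\<lambda>_. 1"] by (simp add: stieltjes_def[abs_def])

lemma log_stieltjes_holomorphic: "log_stieltjes holomorphic_on cut_plane"
  using kernel_transform_holomorphic[OF int_ln_complex] by (simp add: log_stieltjes_def[abs_def])

text \<open>The geometric series may be integrated term by term.\<close>

lemma kernel_transform_fps:
  fixes f :: "real \<Rightarrow> real"
  assumes f: "integrable M f"
  shows "(\<lambda>x. LINT t|M. of_real (f t) / (1 - x * of_real t)) has_fps_expansion
           Abs_fps (\<lambda>m. complex_of_real (LINT t|M. f t * t ^ m))"
proof (rule has_fps_expansionI)
  have [measurable]: "f \<in> borel_measurable M" using f by simp
  have "\<forall>\<^sub>F x in nhds (0::complex). norm x < 1"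
    using eventually_nhds_in_open[of "ball 0 1" "0::complex"] by auto
  then show "\<forall>\<^sub>F x in nhds 0. (\<lambda>m. fps_nth (Abs_fps (\<lambda>m. complex_of_real (LINT t|M. f t * t ^ m))) m * x ^ m)
      sums (LINT t|M. of_real (f t) / (1 - x * of_real t))"
  proof eventually_elim
    case (elim x)
    have bd: "AE t in M. norm (complex_of_real (f t * t ^ m) * x ^ m) \<le> \<bar>f t\<bar> * norm x ^ m" for m
      using supp
    proof eventually_elim
      case (elim t)
      then have "\<bar>t\<bar> ^ m \<le> 1" by (intro power_le_one) auto
      then have "\<bar>f t\<bar> * \<bar>t\<bar> ^ m * norm x ^ m \<le> \<bar>f t\<bar> * 1 * norm x ^ m"
        by (intro mult_mono) auto
      then show ?case by (simp add: norm_mult norm_power abs_mult power_abs)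
    qed
    have int: "integrable M (\<lambda>t. complex_of_real (f t * t ^ m) * x ^ m)" for m
    proof (rule Bochner_Integration.integrable_bound)
      show "integrable M (\<lambda>t. \<bar>f t\<bar> * norm x ^ m)" using f by simp
      show "AE t in M. norm (complex_of_real (f t * t ^ m) * x ^ m) \<le> norm (\<bar>f t\<bar> * norm x ^ m)"
        using bd[of m] by eventually_elim (simp add: abs_mult)
    qed measurable
    have "(\<lambda>m. LINT t|M. complex_of_real (f t * t ^ m) * x ^ m) sums
          (LINT t|M. (\<Sum>m. complex_of_real (f t * t ^ m) * x ^ m))"
    proof (rule sums_integral)
      show "AE t in M. summable (\<lambda>m. norm (complex_of_real (f t * t ^ m) * x ^ m))"
      proof -
        have "AE t in M. \<forall>m. norm (complex_of_real (f t * t ^ m) * x ^ m) \<le> \<bar>f t\<bar> * norm x ^ m"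
          using bd by (simp add: AE_all_countable)
        then show ?thesis
        proof eventually_elim
          case (elim t)
          have "summable (\<lambda>m. \<bar>f t\<bar> * norm x ^ m)"
            using \<open>norm x < 1\<close> by (intro summable_mult summable_geometric) simp
          then show ?case
            by (rule summable_comparison_test'[where N=0]) (use elim in simp)
        qed
      qed
      show "summable (\<lambda>m. LINT t|M. norm (complex_of_real (f t * t ^ m) * x ^ m))"
      proof (rule summable_comparison_test'[where g="\<lambda>m. (LINT t|M. \<bar>f t\<bar>) * norm x ^ m" and N=0])
        show "summable (\<lambda>m. (LINT t|M. \<bar>f t\<bar>) * norm x ^ m)"
          using elim by (auto intro!: summable_mult summable_geometric)
        fix m :: nat
        have "(LINT t|M. norm (complex_of_real (f t * t ^ m) * x ^ m)) \<le> (LINT t|M. \<bar>f t\<bar> * norm x ^ m)"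
          using f by (intro integral_mono_AE) (use int[of m] bd[of m] in auto)
        then show "norm (LINT t|M. norm (complex_of_real (f t * t ^ m) * x ^ m)) \<le> (LINT t|M. \<bar>f t\<bar>) * norm x ^ m"
          by simp
      qed
    qed (rule int)
    moreover have "(LINT t|M. (\<Sum>m. complex_of_real (f t * t ^ m) * x ^ m)) =
                   (LINT t|M. of_real (f t) / (1 - x * of_real t))"
    proof (rule integral_cong_AE)
      show "AE t in M. (\<Sum>m. complex_of_real (f t * t ^ m) * x ^ m) = of_real (f t) / (1 - x * of_real t)"
        using supp
      proof eventually_elim
        case (elim t)
        have "norm (x * of_real t) \<le> norm x * 1"
          using elim by (simp add: norm_mult mult_left_le)
        then have "norm (x * of_real t) < 1" using \<open>norm x < 1\<close> by linarith
        then have "(\<lambda>m. of_real (f t) * (x * of_real t) ^ m) sums (of_real (f t) * (1 / (1 - x * of_real t)))"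
          by (intro sums_mult geometric_sums)
        then show ?case by (simp add: sums_iff power_mult_distrib mult_ac)
      qed
    qed measurable
    moreover have "(LINT t|M. complex_of_real (f t * t ^ m) * x ^ m) = complex_of_real (LINT t|M. f t * t ^ m) * x ^ m" for m
      by (simp only: integral_mult_left_zero integral_complex_of_real)
    ultimately show ?case by (simp only: fps_nth_Abs_fps)
  qed
qed

lemma stieltjes_fps:
  "stieltjes has_fps_expansion Abs_fps (\<lambda>m. complex_of_real (LINT t|M. t ^ m))"
  using kernel_transform_fps[of "\<lambda>_. 1"] by (simp add: stieltjes_def[abs_def])

lemma log_stieltjes_fps:
  "log_stieltjes has_fps_expansion Abs_fps (\<lambda>m. complex_of_real (LINT t|M. ln t * t ^ m))"
  using kernel_transform_fps[OF int_ln] by (simp add: log_stieltjes_def[abs_def])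

lemma integrable_stieltjes:
  "x \<in> cut_plane \<Longrightarrow> integrable M (\<lambda>t. 1 / (1 - x * of_real t))"
  using integrable_kernel[of x "\<lambda>_. 1"] by simp

lemma space_M_nonzero: "emeasure M (space M) \<noteq> 0"
  using emeasure_space_1 by simp

text \<open>For \<open>Im x > 0\<close> each value \<open>1 / (1 - x t)\<close> lies in the upper half-plane, hence so does the average.\<close>

lemma Im_stieltjes_pos:
  assumes "Im x > 0"
  shows "Im (stieltjes x) > 0"
proof -
  have x: "x \<in> cut_plane" using assms by auto
  have i: "integrable M (\<lambda>t. Im (1 / (1 - x * of_real t)))" using integrable_stieltjes[OF x] by simp
  have "(LINT t|M. 0) < (LINT t|M. Im (1 / (1 - x * of_real t)))"
  proof (rule integral_less_AE_space[OF _ i _ space_M_nonzero])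
    show "AE t in M. 0 < Im (1 / (1 - x * of_real t))"
      using supp
    proof eventually_elim
      case (elim t)
      have "1 - x * of_real t \<noteq> 0" using elim cut_plane_nonzero[OF x, of t] by simp
      then have "(Re (1 - x * of_real t))\<^sup>2 + (Im (1 - x * of_real t))\<^sup>2 > 0"
        by (metis cmod_power2 zero_less_norm_iff zero_less_power)
      then show ?case using assms elim by (simp add: Im_divide)
    qed
  qed simp
  also have "\<dots> = Im (stieltjes x)"
    using integrable_stieltjes[OF x] by (simp add: stieltjes_def)
  finally show ?thesis by simp
qed

lemma stieltjes_cnj: "stieltjes (cnj x) = cnj (stieltjes x)"
  unfolding stieltjes_def Bochner_Integration.integral_cnj[symmetric] by simp

lemma log_stieltjes_cnj: "log_stieltjes (cnj x) = cnj (log_stieltjes x)"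
  unfolding log_stieltjes_def Bochner_Integration.integral_cnj[symmetric] by simp

text \<open>The second bound excludes that the transform tends to \<open>0\<close> at the branch point \<open>1\<close>.\<close>

lemma Re_stieltjes_real:
  assumes "x < 1"
  shows "Re (stieltjes (of_real x)) > 0" and "0 \<le> x \<Longrightarrow> Re (stieltjes (of_real x)) \<ge> 1"
proof -
  have x: "complex_of_real x \<in> cut_plane" using assms by auto
  have pos: "AE t in M. 0 < 1 - x * t"
    using supp
  proof eventually_elim
    case (elim t)
    have "x * t < 1 * t" using elim assms by (intro mult_strict_right_mono) auto
    then have "x * t < 1" using elim by linarith
    then show ?case by simp
  qed
  have eq: "Re (1 / (1 - complex_of_real x * of_real t)) = 1 / (1 - x * t)" for t
    by (metis Re_complex_of_real of_real_1 of_real_diff of_real_divide of_real_mult)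
  have i: "integrable M (\<lambda>t. 1 / (1 - x * t))"
    using integrable_Re[OF integrable_stieltjes[OF x]] by (simp only: eq)
  have R: "Re (stieltjes (of_real x)) = (LINT t|M. 1 / (1 - x * t))"
    using integrable_stieltjes[OF x] by (simp only: stieltjes_def integral_Re[symmetric] eq)
  show "Re (stieltjes (of_real x)) > 0"
    using integral_less_AE_space[OF _ i _ space_M_nonzero, of "\<lambda>_. 0"] pos R by simp
  assume "0 \<le> x"
  have "(LINT t|M. 1) \<le> (LINT t|M. 1 / (1 - x * t))"
  proof (rule integral_mono_AE[OF _ i])
    show "AE t in M. 1 \<le> 1 / (1 - x * t)"
      using pos supp by eventually_elim (use \<open>0 \<le> x\<close> in \<open>auto simp: field_simps\<close>)
  qed simp
  then show "Re (stieltjes (of_real x)) \<ge> 1" using R prob_space by simp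
qed

lemma stieltjes_nonzero:
  assumes "x \<in> cut_plane"
  shows "stieltjes x \<noteq> 0"
proof -
  consider "Im x > 0" | "Im x < 0" | "Im x = 0" by linarith
  then show ?thesis
  proof cases
    case 1
    then show ?thesis using Im_stieltjes_pos[of x] by auto
  next
    case 2
    then show ?thesis using Im_stieltjes_pos[of "cnj x"] by (auto simp: stieltjes_cnj)
  next
    case 3
    then have "x = of_real (Re x)" by (simp add: complex_eq_iff)
    moreover from this have "Re x < 1" using assms by (metis ComplD atLeast_iff imageI not_le)
    ultimately show ?thesis using Re_stieltjes_real(1)[of "Re x"] by (metis less_irrefl zero_complex.sel(1))
  qed
qed

lemma log_kernel_scaled_bound:
  obtains C where "C > 0" "\<And>x t. x \<notin> \<real>\<^sub>\<le>\<^sub>0 \<Longrightarrow> 0 < t \<Longrightarrow>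
     norm (log_kernel (x * of_real t)) \<le> C * (1 + \<bar>ln (norm x)\<bar> + \<bar>ln t\<bar>)"
proof -
  obtain C where C: "C > 0" "\<And>x. x \<notin> \<real>\<^sub>\<le>\<^sub>0 \<Longrightarrow> norm (log_kernel x) \<le> C * (1 + \<bar>ln (norm x)\<bar>)"
    using log_kernel_bound by metis
  show ?thesis
  proof (rule that[OF C(1)])
    fix x :: complex and t :: real
    assume x: "x \<notin> \<real>\<^sub>\<le>\<^sub>0" and t: "0 < t"
    have xt: "x * of_real t \<notin> \<real>\<^sub>\<le>\<^sub>0" using x t
      by (auto simp: complex_nonpos_Reals_iff mult_le_0_iff)
    have "x \<noteq> 0" using x by auto
    then have "ln (norm (x * of_real t)) = ln (norm x) + ln t"
      using t by (simp add: norm_mult ln_mult)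
    then have "\<bar>ln (norm (x * of_real t))\<bar> \<le> \<bar>ln (norm x)\<bar> + \<bar>ln t\<bar>" by linarith
    then have "C * (1 + \<bar>ln (norm (x * of_real t))\<bar>) \<le> C * (1 + \<bar>ln (norm x)\<bar> + \<bar>ln t\<bar>)"
      using C by (intro mult_left_mono) auto
    then show "norm (log_kernel (x * of_real t)) \<le> C * (1 + \<bar>ln (norm x)\<bar> + \<bar>ln t\<bar>)"
      using C(2)[OF xt] by linarith
  qed
qed

lemma log_kernel_measurable [measurable]: "log_kernel \<in> borel_measurable borel"
  unfolding log_kernel_def[abs_def] by measurable

lemma integrable_log_kernel:
  assumes "x \<notin> \<real>\<^sub>\<le>\<^sub>0"
  shows "integrable M (\<lambda>t. log_kernel (x * of_real t))"
proof -
  obtain C where C: "C > 0" "\<And>x t. x \<notin> \<real>\<^sub>\<le>\<^sub>0 \<Longrightarrow> 0 < t \<Longrightarrow>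
     norm (log_kernel (x * of_real t)) \<le> C * (1 + \<bar>ln (norm x)\<bar> + \<bar>ln t\<bar>)"
    using log_kernel_scaled_bound by metis
  show ?thesis
  proof (rule Bochner_Integration.integrable_bound)
    show "integrable M (\<lambda>t. C * (1 + \<bar>ln (norm x)\<bar> + \<bar>ln t\<bar>))" using int_ln by simp
    show "AE t in M. norm (log_kernel (x * of_real t)) \<le> norm (C * (1 + \<bar>ln (norm x)\<bar> + \<bar>ln t\<bar>))"
      using supp by eventually_elim (use C assms in fastforce)
  qed measurable
qed

text \<open>The cut \<open>[1, \<infinity>)\<close> of the Stieltjes transform is absent here, as the kernel is regular at \<open>1\<close>.\<close>

lemma log_transform_holomorphic: "log_transform holomorphic_on - \<real>\<^sub>\<le>\<^sub>0"
  unfolding log_transform_def[abs_def]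
proof (rule holomorphic_on_lebesgue_integral)
  show op: "open (- \<real>\<^sub>\<le>\<^sub>0 :: complex set)" by (simp add: open_Compl)
  show "(\<lambda>t. log_kernel (x * of_real t)) \<in> borel_measurable M" for x by measurable
  show "AE t in M. (\<lambda>x. log_kernel (x * of_real t)) holomorphic_on - \<real>\<^sub>\<le>\<^sub>0"
    using supp
  proof eventually_elim
    case (elim t)
    have "(log_kernel \<circ> (\<lambda>x. x * of_real t)) holomorphic_on - \<real>\<^sub>\<le>\<^sub>0"
      by (rule holomorphic_on_compose_gen[OF _ log_kernel_holomorphic])
         (use elim in \<open>auto intro!: holomorphic_intros simp: complex_nonpos_Reals_iff mult_le_0_iff\<close>)
    then show ?case by (simp add: o_def)
  qed
  fix x :: complex assume x: "x \<in> - \<real>\<^sub>\<le>\<^sub>0"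
  obtain C where C: "C > 0" "\<And>x t. x \<notin> \<real>\<^sub>\<le>\<^sub>0 \<Longrightarrow> 0 < t \<Longrightarrow>
     norm (log_kernel (x * of_real t)) \<le> C * (1 + \<bar>ln (norm x)\<bar> + \<bar>ln t\<bar>)"
    using log_kernel_scaled_bound by metis
  obtain r where r: "r > 0" "cball x r \<subseteq> - \<real>\<^sub>\<le>\<^sub>0" using op x open_contains_cball by blast
  have "compact ((\<lambda>w. ln (norm w)) ` cball x r)"
    using r by (intro compact_continuous_image continuous_intros) auto
  then have "bounded ((\<lambda>w. ln (norm w)) ` cball x r)" by (rule compact_imp_bounded)
  then obtain B where B: "\<And>w. w \<in> cball x r \<Longrightarrow> \<bar>ln (norm w)\<bar> \<le> B"
    by (auto simp: bounded_iff simp del: mem_cball)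
  have "AE t in M. \<forall>w\<in>cball x r. norm (log_kernel (w * of_real t)) \<le> C * (1 + B + \<bar>ln t\<bar>)"
    using supp
  proof eventually_elim
    case (elim t)
    show ?case
    proof
      fix w assume w: "w \<in> cball x r"
      have "norm (log_kernel (w * of_real t)) \<le> C * (1 + \<bar>ln (norm w)\<bar> + \<bar>ln t\<bar>)"
        using C(2) w r elim by blast
      also have "\<dots> \<le> C * (1 + B + \<bar>ln t\<bar>)" using B[OF w] C by (intro mult_left_mono) auto
      finally show "norm (log_kernel (w * of_real t)) \<le> C * (1 + B + \<bar>ln t\<bar>)" .
    qed
  qed
  moreover have "integrable M (\<lambda>t. C * (1 + B + \<bar>ln t\<bar>))" using int_ln by simp
  ultimately show "\<exists>r>0. cball x r \<subseteq> - \<real>\<^sub>\<le>\<^sub>0 \<and> (\<exists>g. integrable M g \<and>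
      (AE t in M. \<forall>w\<in>cball x r. norm (log_kernel (w * of_real t)) \<le> g t))"
    using r by blast
qed

lemma log_transform_eq:
  assumes "x \<in> cut_plane" "x \<notin> \<real>\<^sub>\<le>\<^sub>0"
  shows "log_transform x = log_stieltjes x + Ln x * stieltjes x"
proof -
  have x0: "x \<noteq> 0" using assms by auto
  have "log_transform x = (LINT t|M. of_real (ln t) / (1 - x * of_real t) + Ln x * (1 / (1 - x * of_real t)))"
    unfolding log_transform_def
  proof (rule integral_cong_AE)
    show "AE t in M. log_kernel (x * of_real t) = of_real (ln t) / (1 - x * of_real t) + Ln x * (1 / (1 - x * of_real t))"
      using supp
    proof eventually_elim
      case (elim t)
      have "1 - x * of_real t \<noteq> 0" using elim cut_plane_nonzero[OF assms(1), of t] by simp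
      moreover have "Ln (x * of_real t) = Ln x + of_real (ln t)"
        using elim x0 Ln_times_of_real[of t x] by (simp add: mult.commute add.commute Ln_of_real)
      ultimately show ?case by (simp add: log_kernel_def add_divide_distrib)
    qed
  qed measurable
  also have "\<dots> = log_stieltjes x + Ln x * stieltjes x"
    using integrable_stieltjes[OF assms(1)] integrable_kernel[OF assms(1) int_ln_complex]
    by (simp only: log_stieltjes_def stieltjes_def Bochner_Integration.integral_add
        integrable_mult_right integral_mult_right_zero)
  finally show ?thesis .
qed

text \<open>The integrand \<open>ln t / (1 - t)\<close> is negative.\<close>

lemma log_transform_1_nonzero: "log_transform 1 \<noteq> 0"
proof -
  have i: "integrable M (\<lambda>t. Re (log_kernel (1 * of_real t)))"
    using integrable_log_kernel[of 1] by (intro integrable_Re) simp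
  have "(LINT t|M. Re (log_kernel (1 * of_real t))) < (LINT t|M. 0)"
  proof (rule integral_less_AE_space[OF i _ _ space_M_nonzero])
    show "AE t in M. Re (log_kernel (1 * of_real t)) < 0"
      using supp
    proof eventually_elim
      case (elim t)
      show ?case
      proof (cases "t = 1")
        case False
        then have "ln t < 0" "1 - t > 0" using elim by auto
        then have "ln t / (1 - t) < 0" by (simp add: divide_neg_pos)
        moreover have "log_kernel (of_real t) = of_real (ln t / (1 - t))"
          using False elim by (simp add: log_kernel_def Ln_of_real)
        ultimately show ?thesis by simp
      qed (simp add: log_kernel_def)
    qed
  qed simp
  then have "Re (log_transform 1) < 0"
    using integrable_log_kernel[of 1] by (simp add: log_transform_def)
  then show ?thesis by auto
qed

definition mirror_map :: "complex \<Rightarrow> complex" where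
  "mirror_map x = x * exp (log_stieltjes x / stieltjes x)"

lemma mirror_map_holomorphic: "mirror_map holomorphic_on cut_plane"
  unfolding mirror_map_def[abs_def]
  using stieltjes_holomorphic log_stieltjes_holomorphic stieltjes_nonzero
  by (intro holomorphic_intros) auto

lemma mirror_map_eq_exp:
  assumes "x \<in> cut_plane" "x \<notin> \<real>\<^sub>\<le>\<^sub>0"
  shows "mirror_map x = exp (log_transform x / stieltjes x)"
proof -
  have "x \<noteq> 0" using assms by auto
  then have "mirror_map x = exp (Ln x + log_stieltjes x / stieltjes x)"
    by (simp add: mirror_map_def exp_add)
  also have "Ln x + log_stieltjes x / stieltjes x = log_transform x / stieltjes x"
    using stieltjes_nonzero[OF assms(1)] log_transform_eq[OF assms] by (simp add: field_simps)
  finally show ?thesis .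
qed

lemma mirror_map_cnj: "mirror_map (cnj x) = cnj (mirror_map x)"
  by (simp add: mirror_map_def stieltjes_cnj log_stieltjes_cnj exp_cnj)

end

section \<open>Products of independent beta variables\<close>

lemma has_bochner_integral_Beta:
  fixes p q :: real
  assumes "p > 0" "q > 0"
  shows "has_bochner_integral lborel (\<lambda>s. indicator {0<..<1} s * (s powr (p - 1) * (1 - s) powr (q - 1))) (Beta p q)"
proof -
  have eq: "indicator {0<..<1} s * (s powr (p - 1) * (1 - s) powr (q - 1)) =
            indicator {0..1} s *\<^sub>R (s powr (p - 1) * (1 - s) powr (q - 1))" for s :: real
    by (auto simp: indicator_def)
  have "set_integrable lborel {0..1} (\<lambda>s. s powr (p - 1) * (1 - s) powr (q - 1))"
    by (rule integrable_Beta[OF assms])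
  moreover from this have "(LINT s:{0..1}|lborel. s powr (p - 1) * (1 - s) powr (q - 1)) = Beta p q"
    using has_integral_Beta_real[OF assms] set_borel_integral_eq_integral(2) by (metis integral_unique)
  ultimately show ?thesis
    unfolding eq by (simp add: set_integrable_def set_lebesgue_integral_def has_bochner_integral_iff)
qed

lemma Beta_pos: "p > 0 \<Longrightarrow> q > 0 \<Longrightarrow> Beta p (q::real) > 0"
  unfolding Beta_def by (intro divide_pos_pos mult_pos_pos Gamma_real_pos) auto

definition beta_density :: "real \<Rightarrow> real \<Rightarrow> real" where
  "beta_density a s = indicator {0<..<1} s * (s powr (a - 1) * (1 - s) powr (- a)) / Beta a (1 - a)"

definition beta_measure :: "real \<Rightarrow> real measure" where
  "beta_measure a = density lborel (\<lambda>s. ennreal (beta_density a s))"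

lemma beta_density_measurable [measurable]: "beta_density a \<in> borel_measurable borel"
  unfolding beta_density_def[abs_def] by measurable

lemma sets_beta_measure [measurable_cong, simp]: "sets (beta_measure a) = sets borel"
  by (simp add: beta_measure_def)

lemma space_beta_measure [simp]: "space (beta_measure a) = UNIV"
  by (simp add: beta_measure_def)

lemma beta_density_nonneg: "0 < a \<Longrightarrow> a < 1 \<Longrightarrow> 0 \<le> beta_density a s"
  unfolding beta_density_def using Beta_pos[of a "1 - a"] by (intro divide_nonneg_pos mult_nonneg_nonneg) auto

lemma AE_beta_measure:
  assumes "\<And>s. 0 < s \<Longrightarrow> s < 1 \<Longrightarrow> P s"
  shows "AE s in beta_measure a. P s"
  unfolding beta_measure_def
  by (subst AE_density) (auto simp: beta_density_def indicator_def intro!: always_eventually assms)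

lemma has_bochner_integral_beta_powr:
  assumes a: "0 < a" "a < 1" and p: "p > - a"
  shows "has_bochner_integral (beta_measure a) (\<lambda>s. s powr p) (Beta (a + p) (1 - a) / Beta a (1 - a))"
  unfolding beta_measure_def
proof (rule has_bochner_integral_density)
  have "has_bochner_integral lborel (\<lambda>s. indicator {0<..<1} s * (s powr (a + p - 1) * (1 - s) powr (1 - a - 1))
          / Beta a (1 - a)) (Beta (a + p) (1 - a) / Beta a (1 - a))"
    using a p by (intro has_bochner_integral_divide_zero has_bochner_integral_Beta) auto
  moreover have "indicator {0<..<1} s * (s powr (a + p - 1) * (1 - s) powr (1 - a - 1)) / Beta a (1 - a)
       = beta_density a s *\<^sub>R s powr p" for s :: real
  proof -
    have "s powr (a + p - 1) = s powr (a - 1) * s powr p"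
      by (simp flip: powr_add add: algebra_simps)
    then show ?thesis by (simp add: beta_density_def)
  qed
  ultimately show "has_bochner_integral lborel (\<lambda>s. beta_density a s *\<^sub>R s powr p) (Beta (a + p) (1 - a) / Beta a (1 - a))"
    by simp
qed (use a beta_density_nonneg in auto)

lemmas integrable_beta_powr = integrable.intros[OF has_bochner_integral_beta_powr]
lemmas integral_beta_powr = has_bochner_integral_integral_eq[OF has_bochner_integral_beta_powr]

lemma prob_space_beta_measure:
  assumes "0 < a" "a < 1"
  shows "prob_space (beta_measure a)"
proof
  have "has_bochner_integral (beta_measure a) (\<lambda>s. s powr 0) 1"
    using has_bochner_integral_beta_powr[of a 0] assms Beta_pos[of a "1 - a"] by simp
  then have "(\<integral>\<^sup>+s. ennreal (s powr 0) \<partial>beta_measure a) = ennreal 1"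
    by (subst nn_integral_eq_integral) (auto simp: has_bochner_integral_iff)
  moreover have "(\<integral>\<^sup>+s. ennreal (s powr 0) \<partial>beta_measure a) = (\<integral>\<^sup>+s. 1 \<partial>beta_measure a)"
    by (intro nn_integral_cong_AE AE_beta_measure) auto
  ultimately have "(\<integral>\<^sup>+s. 1 \<partial>beta_measure a) = 1" by simp
  then show "emeasure (beta_measure a) (space (beta_measure a)) = 1" by simp
qed

lemma abs_ln_le_powr:
  assumes "0 < (s::real)" "s < 1" "d > 0"
  shows "\<bar>ln s\<bar> \<le> s powr (- d) / d"
proof -
  have "d * (- ln s) = ln (s powr (- d))" using assms by (simp add: ln_powr)
  also have "\<dots> \<le> s powr (- d) - 1" using assms by (intro ln_le_minus_one) auto
  finally have "d * (- ln s) \<le> s powr (- d)" by simp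
  then show ?thesis using assms by (simp add: field_simps)
qed

lemma integrable_beta_ln_powr:
  assumes a: "0 < a" "a < 1" and p: "p \<ge> 0"
  shows "integrable (beta_measure a) (\<lambda>s. ln s * s powr p)"
proof (rule Bochner_Integration.integrable_bound)
  show "integrable (beta_measure a) (\<lambda>s. s powr (p - a / 2) / (a / 2))"
    using a p by (intro integrable_divide integrable_beta_powr) auto
  show "AE s in beta_measure a. norm (ln s * s powr p) \<le> norm (s powr (p - a / 2) / (a / 2))"
  proof (rule AE_beta_measure)
    fix s :: real assume s: "0 < s" "s < 1"
    have "\<bar>ln s\<bar> * s powr p \<le> (s powr (- (a / 2)) / (a / 2)) * s powr p"
      using s a by (intro mult_right_mono abs_ln_le_powr) auto
    also have "\<dots> = s powr (p - a / 2) / (a / 2)"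
      by (simp flip: powr_add)
    finally show "norm (ln s * s powr p) \<le> norm (s powr (p - a / 2) / (a / 2))"
      using a by (simp add: abs_mult)
  qed
qed measurable

text \<open>This is the derivative of the Beta function with respect to its first argument, taken under the
integral sign.\<close>

lemma integral_beta_ln_powr:
  assumes a: "0 < a" "a < 1" and p: "p \<ge> 0"
  shows "(LINT s|beta_measure a. ln s * s powr p) =
         Beta (a + p) (1 - a) / Beta a (1 - a) * (Digamma (a + p) - Digamma (1 + p))"
proof -
  let ?M = "beta_measure a"
  \<comment> \<open>For an increment \<open>e > 0\<close> the quotient \<open>(s^e - 1) / e\<close> is bounded by \<open>|ln s|\<close>.\<close>
  define e where "e k = 1 / real (Suc k)" for k
  have e0: "e k > 0" for k by (simp add: e_def)
  have elim: "e \<longlonglongrightarrow> 0" unfolding e_def[abs_def] by (rule LIMSEQ_Suc[OF lim_inverse_n'])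
  have fl: "filterlim e (at 0) sequentially"
    using elim e0 by (auto simp: filterlim_at less_imp_neq[THEN not_sym])
  let ?s = "\<lambda>k s. (s powr (p + e k) - s powr p) / e k"
  have 1: "(\<lambda>k. LINT s|?M. ?s k s) \<longlonglongrightarrow> (LINT s|?M. ln s * s powr p)"
  proof (rule integral_dominated_convergence[where w="\<lambda>s. norm (ln s * s powr p)"])
    show "integrable ?M (\<lambda>s. norm (ln s * s powr p))"
      using integrable_beta_ln_powr[OF a p] by (rule integrable_norm)
    show "AE s in ?M. (\<lambda>k. ?s k s) \<longlonglongrightarrow> ln s * s powr p"
    proof (rule AE_beta_measure)
      fix s :: real assume s: "0 < s" "s < 1"
      have "((\<lambda>x. s powr (p + x)) has_field_derivative s powr p * ln s) (at 0)"
        using s by (auto intro!: derivative_eq_intros)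
      then have "((\<lambda>h. (s powr (p + h) - s powr p) / h) \<longlongrightarrow> s powr p * ln s) (at 0)"
        by (simp add: DERIV_def)
      from filterlim_compose[OF this fl] show "(\<lambda>k. ?s k s) \<longlonglongrightarrow> ln s * s powr p"
        by (simp add: mult.commute)
    qed
    show "AE s in ?M. norm (?s k s) \<le> norm (ln s * s powr p)" for k
    proof (rule AE_beta_measure)
      fix s :: real assume s: "0 < s" "s < 1"
      have "1 + e k * ln s \<le> s powr (e k)"
        using exp_ge_add_one_self[of "e k * ln s"] s by (simp add: powr_def)
      then have le: "1 - s powr e k \<le> e k * (- ln s)" by simp
      have "s powr e k \<le> 1" using s e0[of k] by (intro powr_le1) auto
      then have "\<bar>1 - s powr e k\<bar> \<le> e k * \<bar>ln s\<bar>" using le s by simp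
      then have "\<bar>(1 - s powr e k) / e k\<bar> \<le> \<bar>ln s\<bar>"
        using e0[of k] by (simp add: abs_divide pos_divide_le_eq mult.commute)
      then have "\<bar>(1 - s powr e k) / e k\<bar> * s powr p \<le> \<bar>ln s\<bar> * s powr p"
        by (intro mult_right_mono) auto
      moreover have "?s k s = - ((1 - s powr e k) / e k) * s powr p"
        by (simp add: powr_add diff_divide_distrib algebra_simps)
      ultimately show "norm (?s k s) \<le> norm (ln s * s powr p)"
        by (simp add: abs_mult)
    qed
  qed measurable
  have 2: "(LINT s|?M. ?s k s) = (Beta (a + p + e k) (1 - a) - Beta (a + p) (1 - a)) / e k / Beta a (1 - a)" for k
    using integrable_beta_powr[of a "p + e k"] integrable_beta_powr[of a p]
      integral_beta_powr[of a "p + e k"] integral_beta_powr[of a p] a p e0[of k]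
    by (simp add: diff_divide_distrib add.assoc mult.commute)
  have "((\<lambda>x. Beta (a + p + x) (1 - a)) has_field_derivative
          Beta (a + p) (1 - a) * (Digamma (a + p) - Digamma (1 + p))) (at 0)"
  proof -
    have ni: "a + p \<notin> \<int>\<^sub>\<le>\<^sub>0" "a + p + (1 - a) \<notin> \<int>\<^sub>\<le>\<^sub>0" using a p by (auto elim!: nonpos_Ints_cases)
    have "((\<lambda>x. Beta x (1 - a)) has_field_derivative Beta (a + p) (1 - a) * (Digamma (a + p) - Digamma (a + p + (1 - a)))) (at (a + p))"
      by (rule has_field_derivative_Beta1[OF ni])
    then show ?thesis
      using DERIV_shift[of "\<lambda>x. Beta x (1 - a)" "Beta (a + p) (1 - a) * (Digamma (a + p) - Digamma (1 + p))" 0 "a + p"]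
      by (simp add: add_ac)
  qed
  then have "((\<lambda>h. (Beta (a + p + h) (1 - a) - Beta (a + p) (1 - a)) / h) \<longlongrightarrow>
      Beta (a + p) (1 - a) * (Digamma (a + p) - Digamma (1 + p))) (at 0)"
    by (simp add: DERIV_def)
  from filterlim_compose[OF this fl]
  have "(\<lambda>k. (Beta (a + p + e k) (1 - a) - Beta (a + p) (1 - a)) / e k / Beta a (1 - a)) \<longlonglongrightarrow>
      Beta (a + p) (1 - a) * (Digamma (a + p) - Digamma (1 + p)) / Beta a (1 - a)"
    by (intro tendsto_divide tendsto_const) (use Beta_pos[of a "1 - a"] a in auto)
  with 1 2 show ?thesis by (simp add: LIMSEQ_unique)
qed

lemma Digamma_plus_of_nat_H_sum:
  assumes "(z::real) > 0"
  shows "Digamma (z + real m) = Digamma z + H_sum z m"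
proof (induction m)
  case (Suc m)
  have "Digamma (z + real m + 1) = Digamma (z + real m) + 1 / (z + real m)"
    using assms by (intro Digamma_plus1) auto
  then show ?case using Suc by (simp add: H_sum_def add_ac)
qed (simp add: H_sum_def)

lemma Beta_ratio_pochhammer:
  assumes "0 < a" "a < (1::real)"
  shows "Beta (a + real m) (1 - a) / Beta a (1 - a) = pochhammer a m / fact m"
proof -
  have "a \<notin> \<int>\<^sub>\<le>\<^sub>0" using assms by (auto elim!: nonpos_Ints_cases)
  then have "pochhammer a m = Gamma (a + real m) / Gamma a" by (rule pochhammer_Gamma)
  moreover have "Gamma (a + real m + (1 - a)) = fact m"
    by (simp add: Gamma_fact[symmetric] add_ac)
  moreover have "Gamma (1 - a) > 0" "Gamma a > 0"
    using assms by (auto intro!: Gamma_real_pos)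
  ultimately show ?thesis by (simp add: Beta_def field_simps)
qed

lemma unit_measure_beta:
  assumes "0 < a" "a < 1"
  shows "unit_measure (beta_measure a)"
proof -
  interpret prob_space "beta_measure a" by (rule prob_space_beta_measure[OF assms])
  have "integrable (beta_measure a) (\<lambda>s. ln s * s powr 0)"
    using assms by (intro integrable_beta_ln_powr) auto
  then have "integrable (beta_measure a) ln"
    by (rule integrable_cong_AE[THEN iffD1, rotated 3]) (auto intro: AE_beta_measure)
  then show ?thesis by unfold_locales (auto intro: AE_beta_measure)
qed

lemma beta_moment:
  assumes "0 < a" "a < 1"
  shows "(LINT s|beta_measure a. s ^ m) = pochhammer a m / fact m"
proof -
  have "(LINT s|beta_measure a. s ^ m) = (LINT s|beta_measure a. s powr real m)"
    by (rule integral_cong_AE) (auto intro!: AE_beta_measure simp: powr_realpow)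
  then show ?thesis using integral_beta_powr[of a "real m"] Beta_ratio_pochhammer[of a m] assms by simp
qed

lemma beta_log_moment:
  assumes "0 < a" "a < 1"
  shows "(LINT s|beta_measure a. ln s * s ^ m) =
    pochhammer a m / fact m * (Digamma a - Digamma 1 + H_sum a m - H_sum 1 m)"
proof -
  have "(LINT s|beta_measure a. ln s * s ^ m) = (LINT s|beta_measure a. ln s * s powr real m)"
    by (rule integral_cong_AE) (auto intro!: AE_beta_measure simp: powr_realpow)
  then show ?thesis
    using integral_beta_ln_powr[of a "real m"] Beta_ratio_pochhammer[of a m] assms
      Digamma_plus_of_nat_H_sum[of a m] Digamma_plus_of_nat_H_sum[of 1 m] by simp
qed

text \<open>The law of the product of two independent random variables.\<close>

definition mult_conv :: "real measure \<Rightarrow> real measure \<Rightarrow> real measure" where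
  "mult_conv A B = distr (A \<Otimes>\<^sub>M B) borel (\<lambda>(s, t). s * t)"

locale unit_measure_pair = A: unit_measure A + B: unit_measure B for A B
begin

sublocale P: pair_prob_space A B ..

lemma mult_measurable [measurable]: "(\<lambda>(s, t). s * t) \<in> borel_measurable (A \<Otimes>\<^sub>M B)"
  by measurable

lemma AE_pair_supp: "AE p in A \<Otimes>\<^sub>M B. 0 < fst p \<and> fst p \<le> 1 \<and> 0 < snd p \<and> snd p \<le> 1"
proof (rule P.AE_pair_measure)
  show "{p \<in> space (A \<Otimes>\<^sub>M B). 0 < fst p \<and> fst p \<le> 1 \<and> 0 < snd p \<and> snd p \<le> 1} \<in> sets (A \<Otimes>\<^sub>M B)"
    by measurable
  show "AE s in A. AE t in B. 0 < fst (s, t) \<and> fst (s, t) \<le> 1 \<and> 0 < snd (s, t) \<and> snd (s, t) \<le> 1"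
    using A.supp by eventually_elim (use B.supp in \<open>auto elim: eventually_mono\<close>)
qed

lemma has_bochner_integral_product:
  fixes f g :: "real \<Rightarrow> real"
  assumes f: "integrable A f" and g: "integrable B g"
  shows "has_bochner_integral (A \<Otimes>\<^sub>M B) (\<lambda>p. f (fst p) * g (snd p)) ((LINT s|A. f s) * (LINT t|B. g t))"
proof -
  have [measurable]: "f \<in> borel_measurable A" "g \<in> borel_measurable B" using f g by auto
  have "integrable (A \<Otimes>\<^sub>M B) (\<lambda>p. f (fst p) * g (snd p))"
    by (rule P.Fubini_integrable) (use f g in \<open>auto simp: abs_mult\<close>)
  moreover from P.integral_fst'[OF this] have "(LINT p|(A \<Otimes>\<^sub>M B). f (fst p) * g (snd p)) = (LINT s|A. f s) * (LINT t|B. g t)"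
    by simp
  ultimately show ?thesis by (simp add: has_bochner_integral_iff)
qed

lemma unit_measure_mult_conv: "unit_measure (mult_conv A B)"
proof -
  interpret M: prob_space "mult_conv A B"
    unfolding mult_conv_def by (rule P.prob_space_distr) measurable
  have 1: "integrable (A \<Otimes>\<^sub>M B) (\<lambda>p. ln (fst p) + ln (snd p))"
    using has_bochner_integral_product[of ln "\<lambda>_. 1"] has_bochner_integral_product[of "\<lambda>_. 1" ln] A.int_ln B.int_ln
    by (intro Bochner_Integration.integrable_add) (auto simp: has_bochner_integral_iff)
  have "AE p in A \<Otimes>\<^sub>M B. ln (fst p) + ln (snd p) = ln (case p of (s, t) \<Rightarrow> s * t)"
    using AE_pair_supp by eventually_elim (auto simp: ln_mult split: prod.splits)
  then have "integrable (A \<Otimes>\<^sub>M B) (\<lambda>p. ln (case p of (s, t) \<Rightarrow> s * t))"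
    using 1 by (subst (asm) integrable_cong_AE) auto
  then have "integrable (mult_conv A B) ln"
    unfolding mult_conv_def by (subst integrable_distr_eq) auto
  moreover have "AE t in mult_conv A B. 0 < t \<and> t \<le> 1"
    unfolding mult_conv_def
  proof (subst AE_distr_iff)
    show "AE p in A \<Otimes>\<^sub>M B. 0 < (case p of (s, t) \<Rightarrow> s * t) \<and> (case p of (s, t) \<Rightarrow> s * t) \<le> 1"
      using AE_pair_supp by eventually_elim (auto split: prod.splits intro: mult_le_one)
  qed auto
  ultimately show ?thesis by unfold_locales (auto simp: mult_conv_def)
qed

lemma integral_mult_conv:
  fixes f :: "real \<Rightarrow> 'b::{banach, second_countable_topology}"
  assumes f: "integrable (mult_conv A B) f"
  shows "(LINT u|mult_conv A B. f u) = (LINT t|B. LINT s|A. f (s * t))"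
    and "AE t in B. integrable A (\<lambda>s. f (s * t))"
    and "integrable B (\<lambda>t. LINT s|A. f (s * t))"
proof -
  have fm: "f \<in> borel_measurable borel" using borel_measurable_integrable[OF f] by (simp add: mult_conv_def)
  have "integrable (A \<Otimes>\<^sub>M B) (\<lambda>p. f (case p of (s, t) \<Rightarrow> s * t))"
    using f fm unfolding mult_conv_def by (subst (asm) integrable_distr_eq) auto
  then have i: "integrable (A \<Otimes>\<^sub>M B) (\<lambda>(s, t). f (s * t))"
    by (simp add: case_prod_unfold)
  have "(LINT u|mult_conv A B. f u) = (LINT p|(A \<Otimes>\<^sub>M B). f (case p of (s, t) \<Rightarrow> s * t))"
    unfolding mult_conv_def using fm by (subst integral_distr) auto
  also have "\<dots> = (LINT p|(A \<Otimes>\<^sub>M B). (\<lambda>(s, t). f (s * t)) p)"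
    by (simp add: case_prod_unfold)
  also have "\<dots> = (LINT t|B. LINT s|A. f (s * t))"
    using P.integral_snd[OF i] by simp
  finally show "(LINT u|mult_conv A B. f u) = (LINT t|B. LINT s|A. f (s * t))" .
  show "AE t in B. integrable A (\<lambda>s. f (s * t))" using P.AE_integrable_snd[OF i] .
  show "integrable B (\<lambda>t. LINT s|A. f (s * t))" using P.integrable_snd[OF i] .
qed

lemma nn_integral_mult_conv:
  assumes [measurable]: "f \<in> borel_measurable borel"
  shows "(\<integral>\<^sup>+u. f u \<partial>mult_conv A B) = (\<integral>\<^sup>+s. \<integral>\<^sup>+t. f (s * t) \<partial>B \<partial>A)"
  unfolding mult_conv_def
  by (subst nn_integral_distr) (auto simp: B.nn_integral_fst[symmetric] case_prod_unfold)

lemma moment_mult_conv: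
  "(LINT u|mult_conv A B. u ^ m) = (LINT s|A. s ^ m) * (LINT t|B. t ^ m)"
  "(LINT u|mult_conv A B. ln u * u ^ m) =
     (LINT s|A. ln s * s ^ m) * (LINT t|B. t ^ m) + (LINT s|A. s ^ m) * (LINT t|B. ln t * t ^ m)"
proof -
  have pw: "integrable M (\<lambda>s. s ^ m)" "integrable M (\<lambda>s. ln s * s ^ m)" if "unit_measure M" for M
  proof -
    interpret unit_measure M by fact
    have le: "AE s in M. \<bar>s\<bar> ^ m \<le> 1" using supp by eventually_elim (auto intro: power_le_one)
    show "integrable M (\<lambda>s. s ^ m)"
      by (rule integrable_const_bound[of _ 1]) (use le in \<open>auto simp: power_abs\<close>)
    show "integrable M (\<lambda>s. ln s * s ^ m)"
    proof (rule Bochner_Integration.integrable_bound[OF int_ln])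
      show "AE s in M. norm (ln s * s ^ m) \<le> norm (ln s)"
        using le by eventually_elim (auto simp: abs_mult power_abs intro: mult_left_le)
    qed measurable
  qed
  note pA = pw[OF A.unit_measure_axioms] and pB = pw[OF B.unit_measure_axioms]
  show "(LINT u|mult_conv A B. u ^ m) = (LINT s|A. s ^ m) * (LINT t|B. t ^ m)"
    unfolding mult_conv_def using has_bochner_integral_product[OF pA(1) pB(1)]
    by (subst integral_distr) (auto simp: has_bochner_integral_iff power_mult_distrib case_prod_unfold)
  have "(LINT u|mult_conv A B. ln u * u ^ m) =
     (LINT p|(A \<Otimes>\<^sub>M B). ln (fst p) * fst p ^ m * snd p ^ m + fst p ^ m * (ln (snd p) * snd p ^ m))"
    unfolding mult_conv_def
  proof (subst integral_distr)
    show "(LINT p|(A \<Otimes>\<^sub>M B). ln (case p of (s, t) \<Rightarrow> s * t) * (case p of (s, t) \<Rightarrow> s * t) ^ m) =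
      (LINT p|(A \<Otimes>\<^sub>M B). ln (fst p) * fst p ^ m * snd p ^ m + fst p ^ m * (ln (snd p) * snd p ^ m))"
    proof (rule integral_cong_AE)
      show "AE p in A \<Otimes>\<^sub>M B. ln (case p of (s, t) \<Rightarrow> s * t) * (case p of (s, t) \<Rightarrow> s * t) ^ m =
          ln (fst p) * fst p ^ m * snd p ^ m + fst p ^ m * (ln (snd p) * snd p ^ m)"
        using AE_pair_supp
        by eventually_elim (auto simp: ln_mult power_mult_distrib algebra_simps split: prod.splits)
    qed measurable
  qed auto
  then show "(LINT u|mult_conv A B. ln u * u ^ m) =
     (LINT s|A. ln s * s ^ m) * (LINT t|B. t ^ m) + (LINT s|A. s ^ m) * (LINT t|B. ln t * t ^ m)"
    using has_bochner_integral_product[OF pA(2) pB(1)] has_bochner_integral_product[OF pA(1) pB(2)]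
    by (simp add: has_bochner_integral_iff)
qed

end

primrec prod_measure :: "real list \<Rightarrow> real measure" where
  "prod_measure [] = return borel 1"
| "prod_measure (a # as) = mult_conv (beta_measure a) (prod_measure as)"

lemma unit_measure_prod_measure:
  "(\<And>a. a \<in> set as \<Longrightarrow> 0 < a \<and> a < 1) \<Longrightarrow> unit_measure (prod_measure as)"
proof (induction as)
  case Nil
  interpret prob_space "return borel (1::real)" by (rule prob_space_return) simp
  have "integrable (return borel 1) (ln :: real \<Rightarrow> real)"
    unfolding integrable_iff_bounded by (auto simp: nn_integral_return)
  then have "unit_measure (return borel 1)"
    by unfold_locales (auto simp: AE_return)
  then show ?case by simp
next
  case (Cons a as)
  interpret A: unit_measure "beta_measure a" using Cons by (intro unit_measure_beta) auto
  interpret B: unit_measure "prod_measure as" using Cons by simp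
  interpret unit_measure_pair "beta_measure a" "prod_measure as" ..
  show ?case using unit_measure_mult_conv by simp
qed

lemma prod_measure_moment:
  assumes "\<And>a. a \<in> set as \<Longrightarrow> 0 < a \<and> a < 1"
  shows "(LINT t|prod_measure as. t ^ m) = (\<Prod>a\<leftarrow>as. pochhammer a m / fact m)"
  using assms
proof (induction as)
  case Nil
  show ?case by (simp add: integral_return)
next
  case (Cons a as)
  have a: "0 < a" "a < 1" using Cons.prems[of a] by auto
  interpret A: unit_measure "beta_measure a" using a by (rule unit_measure_beta)
  interpret B: unit_measure "prod_measure as" using Cons.prems by (intro unit_measure_prod_measure) auto
  interpret unit_measure_pair "beta_measure a" "prod_measure as" ..
  show ?case using Cons moment_mult_conv(1)[of m] beta_moment[OF a, of m] by simp
qed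

text \<open>The logarithm of a product is the sum of the logarithms, and by independence each summand
contributes its own logarithmic moment times the moments of the other factors.\<close>

lemma prod_measure_log_moment:
  assumes "\<And>a. a \<in> set as \<Longrightarrow> 0 < a \<and> a < 1"
  shows "(LINT t|prod_measure as. ln t * t ^ m) = (\<Prod>a\<leftarrow>as. pochhammer a m / fact m) *
           (\<Sum>a\<leftarrow>as. Digamma a - Digamma 1 + H_sum a m - H_sum 1 m)"
  using assms
proof (induction as)
  case Nil
  show ?case by (simp add: integral_return)
next
  case (Cons a as)
  have a: "0 < a" "a < 1" using Cons.prems[of a] by auto
  interpret A: unit_measure "beta_measure a" using a by (rule unit_measure_beta)
  interpret B: unit_measure "prod_measure as" using Cons.prems by (intro unit_measure_prod_measure) auto
  interpret unit_measure_pair "beta_measure a" "prod_measure as" ..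
  show ?case using Cons moment_mult_conv(2)[of m] beta_moment[OF a, of m] beta_log_moment[OF a, of m]
      prod_measure_moment[of as m]
    by (simp add: algebra_simps)
qed

section \<open>The logarithm of the normalising constant\<close>

text \<open>Unlike the sums over totatives, these sums change in a simple way when \<open>N\<close> is multiplied by a
prime: dividing the numbers \<open>k \<le> N m\<close> coprime to \<open>N\<close> by \<open>N\<close> gives exactly the fractions \<open>r / N + n\<close> with a
totative \<open>r\<close> and \<open>n < m\<close>.\<close>

definition coprime_sum :: "nat \<Rightarrow> nat \<Rightarrow> real" where
  "coprime_sum N X = (\<Sum>k | k \<in> {1..X} \<and> coprime k N. 1 / real k)"

lemma totatives_H_sum:
  assumes "N > 0"
  shows "(\<Sum>r\<in>totatives N. H_sum (real r / real N) m) = real N * coprime_sum N (N * m)"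
proof (induction m)
  case 0
  have "{k. k \<in> {1..(0::nat)} \<and> coprime k N} = {}" by auto
  then show ?case by (simp add: H_sum_def coprime_sum_def)
next
  case (Suc m)
  have cop: "coprime (N * m + r) N \<longleftrightarrow> coprime r N" for r
    by (simp add: coprime_iff_gcd_eq_1 gcd_red_nat[of "N * m + r" N] gcd_red_nat[of r N])
  have split: "{k. k \<in> {1..N * Suc m} \<and> coprime k N} =
      {k. k \<in> {1..N * m} \<and> coprime k N} \<union> (\<lambda>r. N * m + r) ` totatives N"
  proof (intro equalityI subsetI)
    fix k assume k: "k \<in> {k. k \<in> {1..N * Suc m} \<and> coprime k N}"
    show "k \<in> {k. k \<in> {1..N * m} \<and> coprime k N} \<union> (\<lambda>r. N * m + r) ` totatives N"
    proof (cases "k \<le> N * m")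
      case False
      define r where "r = k - N * m"
      have "k = N * m + r" "r > 0" "r \<le> N" using False k by (auto simp: r_def)
      moreover from this k have "coprime r N" using cop by simp
      ultimately show ?thesis by (auto simp: totatives_def)
    qed (use k in auto)
  next
    fix k assume k: "k \<in> {k. k \<in> {1..N * m} \<and> coprime k N} \<union> (\<lambda>r. N * m + r) ` totatives N"
    then show "k \<in> {k. k \<in> {1..N * Suc m} \<and> coprime k N}"
      by (auto simp: totatives_def cop)
  qed
  have disj: "{k. k \<in> {1..N * m} \<and> coprime k N} \<inter> (\<lambda>r. N * m + r) ` totatives N = {}"
    by (auto simp: totatives_def)
  have "coprime_sum N (N * Suc m) = coprime_sum N (N * m) + (\<Sum>k\<in>(\<lambda>r. N * m + r) ` totatives N. 1 / real k)"
    unfolding coprime_sum_def split by (rule sum.union_disjoint) (use disj in auto)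
  also have "(\<Sum>k\<in>(\<lambda>r. N * m + r) ` totatives N. 1 / real k) = (\<Sum>r\<in>totatives N. 1 / (real N * real m + real r))"
    by (subst sum.reindex) (auto simp: inj_on_def)
  finally have S: "real N * coprime_sum N (N * Suc m) = real N * coprime_sum N (N * m) +
      (\<Sum>r\<in>totatives N. real N / (real N * real m + real r))"
    by (simp add: distrib_left sum_distrib_left)
  have "real N / (real N * real m + real r) = 1 / (real r / real N + real m)" for r
    using assms by (simp add: field_simps)
  then show ?case using S Suc by (simp add: H_sum_def sum.distrib)
qed

lemma H_one_coprime_sum:
  "N > 0 \<Longrightarrow> H_one N m = real N * coprime_sum N (N * m) - real (totient N) * H_sum 1 m"
  by (simp add: H_one_def totatives_H_sum)

lemma coprime_sum_mult_prime_dvd: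
  assumes "prime p" "p dvd N"
  shows "coprime_sum (p * N) X = coprime_sum N X"
proof -
  have "coprime k (p * N) \<longleftrightarrow> coprime k N" for k
    using assms by (auto intro: coprime_divisors[of k k p N])
  then show ?thesis by (simp add: coprime_sum_def)
qed

lemma coprime_sum_mult_prime_not_dvd:
  assumes p: "prime p" "\<not> p dvd N"
  shows "coprime_sum (p * N) (p * Y) = coprime_sum N (p * Y) - coprime_sum N Y / real p"
proof -
  let ?A = "{k. k \<in> {1..p * Y} \<and> coprime k (p * N)}" and ?B = "(\<lambda>k. p * k) ` {k. k \<in> {1..Y} \<and> coprime k N}"
  have pN: "coprime p N" using p by (simp add: prime_imp_coprime)
  have p0: "p > 0" using p by (simp add: prime_gt_0_nat)
  have split: "{k. k \<in> {1..p * Y} \<and> coprime k N} = ?A \<union> ?B"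
  proof (intro equalityI subsetI)
    fix k assume k: "k \<in> {k. k \<in> {1..p * Y} \<and> coprime k N}"
    show "k \<in> ?A \<union> ?B"
    proof (cases "p dvd k")
      case True
      then obtain j where j: "k = p * j" by auto
      then have "j \<in> {k. k \<in> {1..Y} \<and> coprime k N}" using k p0 by (auto simp: Suc_le_eq)
      then show ?thesis using j by blast
    next
      case False
      then have "coprime p k" using p by (simp add: prime_imp_coprime)
      then show ?thesis using k by (auto simp: coprime_commute)
    qed
  next
    fix k assume "k \<in> ?A \<union> ?B"
    then show "k \<in> {k. k \<in> {1..p * Y} \<and> coprime k N}"
      using pN p0 by (auto simp: Suc_le_eq)
  qed
  have disj: "?A \<inter> ?B = {}" using p by (auto simp: prime_nat_iff)
  have "coprime_sum N (p * Y) = coprime_sum (p * N) (p * Y) + (\<Sum>k\<in>?B. 1 / real k)"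
    unfolding coprime_sum_def split by (rule sum.union_disjoint) (use disj in auto)
  also have "(\<Sum>k\<in>?B. 1 / real k) = (\<Sum>k | k \<in> {1..Y} \<and> coprime k N. 1 / real (p * k))"
    using p0 by (subst sum.reindex) (auto simp: inj_on_def)
  also have "\<dots> = coprime_sum N Y / real p"
    by (simp add: coprime_sum_def sum_divide_distrib mult.commute)
  finally show ?thesis by simp
qed

lemma ln_C_one:
  assumes "N > 0"
  shows "ln (C_one N) = real (totient N) * (ln (real N) + (\<Sum>p\<in>prime_factors N. ln (real p) / (real p - 1)))"
    and "C_one N > 0"
proof -
  have p: "real p > 1" if "p \<in> prime_factors N" for p
    using that prime_gt_1_nat[of p] by auto
  have pos: "(\<Prod>p\<in>prime_factors N. real p ^ (totient N div (p - 1))) > 0"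
    by (intro prod_pos) (auto dest: p)
  show "C_one N > 0" unfolding C_one_def using assms pos by simp
  have "ln (\<Prod>p\<in>prime_factors N. real p ^ (totient N div (p - 1))) =
      (\<Sum>p\<in>prime_factors N. ln (real p ^ (totient N div (p - 1))))"
    by (rule ln_prod) (auto dest: p)
  also have "\<dots> = (\<Sum>p\<in>prime_factors N. real (totient N div (p - 1)) * ln (real p))"
    by (rule sum.cong) (auto dest: p simp: ln_realpow)
  finally have "ln (C_one N) = real (totient N) * ln (real N) + (\<Sum>p\<in>prime_factors N. real (totient N div (p - 1)) * ln (real p))"
    unfolding C_one_def using assms pos by (subst ln_mult) (auto simp: ln_realpow)
  also have "(\<Sum>p\<in>prime_factors N. real (totient N div (p - 1)) * ln (real p)) =
      (\<Sum>p\<in>prime_factors N. real (totient N) * (ln (real p) / (real p - 1)))"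
  proof (rule sum.cong[OF refl])
    fix q assume q: "q \<in> prime_factors N"
    have "real (totient N div (q - 1)) = real (totient N) / real (q - 1)"
      by (rule real_of_nat_div[OF prime_minus_one_dvd_totient[OF q]])
    then show "real (totient N div (q - 1)) * ln (real q) = real (totient N) * (ln (real q) / (real q - 1))"
      using p[OF q] by simp
  qed
  finally show "ln (C_one N) = real (totient N) * (ln (real N) + (\<Sum>p\<in>prime_factors N. ln (real p) / (real p - 1)))"
    by (simp add: sum_distrib_left distrib_left)
qed

lemma H_sum_1_mult_tendsto:
  assumes "p > 0"
  shows "(\<lambda>m. H_sum 1 (p * m) - H_sum 1 m) \<longlonglongrightarrow> ln (real p)"
proof -
  have L: "(\<lambda>m. ln (real m) - H_sum 1 m) \<longlonglongrightarrow> Digamma (1::real)"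
    using Digamma_LIMSEQ[of "1::real"] by (simp add: H_sum_def inverse_eq_divide)
  have "filterlim (\<lambda>m. p * m) at_top sequentially"
    using assms by (intro mult_nat_left_at_top)
  from filterlim_compose[OF L this]
  have L2: "(\<lambda>m. ln (real (p * m)) - H_sum 1 (p * m)) \<longlonglongrightarrow> Digamma (1::real)" .
  have "(\<lambda>m. (ln (real m) - H_sum 1 m) - (ln (real (p * m)) - H_sum 1 (p * m)) + ln (real p)) \<longlonglongrightarrow>
      Digamma 1 - Digamma 1 + ln (real p)"
    by (intro tendsto_intros L L2)
  moreover have "\<forall>\<^sub>F m in sequentially. (ln (real m) - H_sum 1 m) - (ln (real (p * m)) - H_sum 1 (p * m)) + ln (real p)
      = H_sum 1 (p * m) - H_sum 1 m"
    using eventually_gt_at_top[of 0] by eventually_elim (use assms in \<open>simp add: ln_mult\<close>)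
  ultimately show ?thesis by (simp only: Lim_transform_eventually diff_self add_0_left)
qed

text \<open>Induction on the prime factorisation.  A prime \<open>p\<close> that divides \<open>N\<close> gives
\<open>H_one (p N) m = p H_one N (p m) + p \<phi>(N) (H_sum 1 (p m) - H_sum 1 m)\<close>, and for any other \<open>p\<close> one
has to subtract \<open>H_one N m\<close>.  The bracket tends to \<open>ln p\<close>, and \<open>ln C_one\<close> obeys the recursion that
results in the limit.\<close>

lemma H_one_tendsto: "N > 0 \<Longrightarrow> H_one N \<longlonglongrightarrow> ln (C_one N)"
proof (induction N rule: prime_divisors_induct)
  case (unit N)
  then have N: "N = 1" by simp
  have "{k. k \<in> {1..m} \<and> coprime k (1::nat)} = Suc ` {..<m}" for m
    by (auto simp: image_Suc_lessThan)
  then have "coprime_sum 1 m = H_sum 1 m" for m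
    by (simp add: coprime_sum_def H_sum_def sum.reindex)
  then have "H_one N m = 0" for m using H_one_coprime_sum[of N m] N by simp
  moreover have "ln (C_one N) = 0" using N by (simp add: C_one_def)
  ultimately show ?case by simp
next
  case (factor p N)
  have p0: "p > 0" "p > 1" and N0: "N > 0" using factor prime_gt_1_nat[of p] by auto
  have flt: "filterlim (\<lambda>m. p * m) at_top sequentially"
    using p0 by (intro mult_nat_left_at_top) auto
  note IH = factor.IH[OF N0]
  note H = H_sum_1_mult_tendsto[OF p0(1)]
  show ?case
  proof (cases "p dvd N")
    case True
    have "gcd p N = p" using True by (simp add: gcd_nat.absorb1)
    then have t: "totient (p * N) = p * totient N"
      using totient_gcd[of p N] p0 by (simp add: mult_ac)
    have eq: "H_one (p * N) m = real p * H_one N (p * m) + real p * real (totient N) * (H_sum 1 (p * m) - H_sum 1 m)" for m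
    proof -
      have "H_one (p * N) m = real (p * N) * coprime_sum N (p * N * m) - real (p * totient N) * H_sum 1 m"
        using N0 p0 coprime_sum_mult_prime_dvd[OF factor.hyps True] by (simp add: H_one_coprime_sum t)
      then show ?thesis using N0 by (simp add: H_one_coprime_sum algebra_simps)
    qed
    have pf: "prime_factors (p * N) = prime_factors N"
      using N0 p0 True factor.hyps by (subst prime_factors_product) (auto simp: in_prime_factors_iff prime_factorization_prime)
    have "(\<lambda>m. real p * H_one N (p * m) + real p * real (totient N) * (H_sum 1 (p * m) - H_sum 1 m)) \<longlonglongrightarrow>
       real p * ln (C_one N) + real p * real (totient N) * ln (real p)"
      by (intro tendsto_intros H filterlim_compose[OF IH flt])
    moreover have "real p * ln (C_one N) + real p * real (totient N) * ln (real p) = ln (C_one (p * N))"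
    proof -
      define L where "L = (\<Sum>p\<in>prime_factors N. ln (real p) / (real p - 1))"
      have "ln (C_one (p * N)) = real p * real (totient N) * (ln (real p) + ln (real N) + L)"
        using N0 p0 by (subst ln_C_one) (auto simp: pf t ln_mult L_def)
      moreover have "ln (C_one N) = real (totient N) * (ln (real N) + L)" using N0 by (simp add: ln_C_one L_def)
      ultimately show ?thesis by (simp add: algebra_simps)
    qed
    ultimately show ?thesis by (simp add: eq[abs_def])
  next
    case False
    have cop: "coprime p N" using False factor.hyps by (simp add: prime_imp_coprime)
    have t: "totient (p * N) = (p - 1) * totient N"
      using totient_mult_coprime[OF cop] totient_prime[OF factor.hyps] by simp
    have eq: "H_one (p * N) m = real p * H_one N (p * m) - H_one N m + real p * real (totient N) * (H_sum 1 (p * m) - H_sum 1 m)" for m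
    proof -
      have "H_one (p * N) m = real (p * N) * coprime_sum (p * N) (p * (N * m)) - real ((p - 1) * totient N) * H_sum 1 m"
        using N0 p0 by (simp add: H_one_coprime_sum t mult.assoc)
      also have "coprime_sum (p * N) (p * (N * m)) = coprime_sum N (N * (p * m)) - coprime_sum N (N * m) / real p"
        using coprime_sum_mult_prime_not_dvd[OF factor.hyps False, of "N * m"] by (simp add: mult_ac)
      finally show ?thesis using N0 p0 by (simp add: H_one_coprime_sum of_nat_diff algebra_simps)
    qed
    have pf: "prime_factors (p * N) = insert p (prime_factors N)"
      using N0 p0 factor.hyps by (subst prime_factors_product) (auto simp: prime_factorization_prime)
    have notin: "p \<notin> prime_factors N" using False by auto
    have "(\<lambda>m. real p * H_one N (p * m) - H_one N m + real p * real (totient N) * (H_sum 1 (p * m) - H_sum 1 m)) \<longlonglongrightarrow>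
       real p * ln (C_one N) - ln (C_one N) + real p * real (totient N) * ln (real p)"
      by (intro tendsto_intros H IH filterlim_compose[OF IH flt])
    moreover have "real p * ln (C_one N) - ln (C_one N) + real p * real (totient N) * ln (real p) = ln (C_one (p * N))"
    proof -
      define L where "L = ln (real N) + (\<Sum>p\<in>prime_factors N. ln (real p) / (real p - 1))"
      have "ln (C_one (p * N)) = (real p - 1) * real (totient N) * (ln (real p) + L + ln (real p) / (real p - 1))"
        using N0 p0 notin by (subst ln_C_one) (auto simp: pf t ln_mult of_nat_diff L_def)
      also have "\<dots> = real (totient N) * ((real p - 1) * (ln (real p) + L) + (real p - 1) * (ln (real p) / (real p - 1)))"
        by (simp only: distrib_left mult_ac)
      also have "(real p - 1) * (ln (real p) / (real p - 1)) = ln (real p)" using p0 by simp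
      finally have "ln (C_one (p * N)) = real (totient N) * ((real p - 1) * (ln (real p) + L) + ln (real p))" .
      moreover have "ln (C_one N) = real (totient N) * L" using N0 by (simp add: ln_C_one L_def)
      ultimately show ?thesis by (simp add: algebra_simps)
    qed
    ultimately show ?thesis by (simp add: eq[abs_def])
  qed
qed auto

text \<open>Both sides are the limit of \<open>H_one N\<close>, the left one by the series of the digamma function.\<close>

lemma sum_Digamma_totatives:
  assumes "N > 0"
  shows "(\<Sum>r\<in>totatives N. Digamma 1 - Digamma (real r / real N)) = ln (C_one N)"
proof -
  have "(\<lambda>m. \<Sum>r\<in>totatives N. H_sum (real r / real N) m - H_sum 1 m) \<longlonglongrightarrow>
        (\<Sum>r\<in>totatives N. Digamma 1 - Digamma (real r / real N))"
  proof (rule tendsto_sum)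
    fix r assume r: "r \<in> totatives N"
    then have "real r / real N \<noteq> 0" using assms by (auto simp: totatives_def)
    from tendsto_diff[OF Digamma_LIMSEQ[of "1::real"] Digamma_LIMSEQ[OF this]]
    show "(\<lambda>m. H_sum (real r / real N) m - H_sum 1 m) \<longlonglongrightarrow> Digamma 1 - Digamma (real r / real N)"
      by (simp add: H_sum_def inverse_eq_divide)
  qed
  moreover have "(\<Sum>r\<in>totatives N. H_sum (real r / real N) m - H_sum 1 m) = H_one N m" for m
    by (simp add: H_one_def sum_subtractf totient_def)
  ultimately show ?thesis using H_one_tendsto[OF assms] LIMSEQ_unique by simp
qed

section \<open>The transforms of one beta distribution\<close>

lemma connected_cut_plane: "connected cut_plane"
  by (rule starlike_imp_connected[OF starlike_slotted_complex_plane_right])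

lemma connected_minus_nonpos_Reals: "connected (- \<real>\<^sub>\<le>\<^sub>0 :: complex set)"
proof -
  have "complex_of_real ` {..0} = \<real>\<^sub>\<le>\<^sub>0" by (auto simp: nonpos_Reals_def)
  then show ?thesis using starlike_imp_connected[OF starlike_slotted_complex_plane_left[of 0]] by simp
qed

lemma holomorphic_eq_on_connected_nhds:
  fixes f g :: "complex \<Rightarrow> complex"
  assumes "open S" "connected S" "a \<in> S" "f holomorphic_on S" "g holomorphic_on S"
    and ev: "\<forall>\<^sub>F x in nhds a. f x = g x" and "z \<in> S"
  shows "f z = g z"
proof -
  obtain T where T: "open T" "a \<in> T" "\<And>x. x \<in> T \<Longrightarrow> f x = g x"
    using ev by (auto simp: eventually_nhds)
  show ?thesis
    by (rule analytic_continuation_open[of "T \<inter> S" S f g]) (use T assms in auto)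
qed

lemma has_fps_expansion_imp_eventually_eq:
  fixes f g :: "complex \<Rightarrow> complex"
  assumes "f has_fps_expansion F" "g has_fps_expansion F"
  shows "\<forall>\<^sub>F x in nhds 0. f x = g x"
proof -
  have "\<forall>\<^sub>F x in nhds 0. eval_fps F x = f x" "\<forall>\<^sub>F x in nhds 0. eval_fps F x = g x"
    using assms by (auto simp: has_fps_expansion_def)
  then show ?thesis by eventually_elim simp
qed

text \<open>The binomial series with exponent \<open>-a\<close>.\<close>

lemma has_fps_expansion_binomial:
  fixes a :: real
  shows "(\<lambda>x. (1 - x) powr (- of_real a)) has_fps_expansion Abs_fps (\<lambda>m. complex_of_real (pochhammer a m / fact m))"
proof (rule has_fps_expansionI)
  have "\<forall>\<^sub>F x in nhds (0::complex). norm x < 1"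
    using eventually_nhds_in_open[of "ball 0 1" "0::complex"] by auto
  then show "\<forall>\<^sub>F x in nhds (0::complex). (\<lambda>m. fps_nth (Abs_fps (\<lambda>m. complex_of_real (pochhammer a m / fact m))) m * x ^ m)
      sums ((1 - x) powr (- of_real a))"
  proof eventually_elim
    case (elim x)
    have "(\<lambda>n. ((- complex_of_real a) gchoose n) * (- x) ^ n) sums (1 + (- x)) powr (- complex_of_real a)"
      by (rule gen_binomial_complex) (use elim in simp)
    moreover have "((- complex_of_real a) gchoose n) * (- x) ^ n = complex_of_real (pochhammer a n / fact n) * x ^ n" for n
    proof -
      have "((- complex_of_real a) gchoose n) * (- x) ^ n = ((- 1) ^ n * (- 1) ^ n) * (pochhammer (complex_of_real a) n / fact n) * x ^ n"
        by (simp add: gbinomial_pochhammer power_minus[of x])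
      also have "(- 1) ^ n * (- 1) ^ n = (1::complex)" by (simp flip: power_mult_distrib)
      finally show ?thesis by (simp add: pochhammer_of_real)
    qed
    ultimately show ?case by simp
  qed
qed

locale beta_parameter =
  fixes a :: real
  assumes a: "0 < a" "a < 1"
begin

sublocale unit_measure "beta_measure a"
  using a by (rule unit_measure_beta)

lemma stieltjes_fps_beta:
  "stieltjes has_fps_expansion Abs_fps (\<lambda>m. complex_of_real (pochhammer a m / fact m))"
  using stieltjes_fps beta_moment[OF a] by simp

lemma stieltjes_beta:
  assumes "x \<in> cut_plane"
  shows "stieltjes x = (1 - x) powr (- of_real a)"
proof (rule holomorphic_eq_on_connected_nhds[OF open_cut_plane connected_cut_plane,
      where f=stieltjes and g="\<lambda>x. (1 - x) powr (- of_real a)" and a=0])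
  show "(0::complex) \<in> cut_plane" by auto
  show "(\<lambda>x. (1 - x) powr (- of_real a)) holomorphic_on cut_plane"
  proof (intro holomorphic_intros)
    fix x :: complex assume "x \<in> cut_plane"
    show "1 - x \<notin> \<real>\<^sub>\<le>\<^sub>0"
    proof
      assume "1 - x \<in> \<real>\<^sub>\<le>\<^sub>0"
      then have "x = complex_of_real (Re x)" "Re x \<ge> 1" by (auto simp: complex_nonpos_Reals_iff complex_eq_iff)
      then show False using \<open>x \<in> cut_plane\<close> by (metis ComplD atLeast_iff imageI)
    qed
  qed
  show "\<forall>\<^sub>F x in nhds 0. stieltjes x = (1 - x) powr (- of_real a)"
    by (rule has_fps_expansion_imp_eventually_eq[OF stieltjes_fps_beta has_fps_expansion_binomial])
qed (use assms stieltjes_holomorphic in auto)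

lemma stieltjes_beta_ode:
  "\<forall>\<^sub>F x in nhds 0. (1 - x) * deriv stieltjes x = of_real a * stieltjes x"
proof -
  let ?F = "Abs_fps (\<lambda>m. complex_of_real (pochhammer a m / fact m))"
  have "(\<lambda>x. (1 - x) * deriv stieltjes x) has_fps_expansion (1 - fps_X) * fps_deriv ?F"
    by (intro fps_expansion_intros stieltjes_fps_beta)
  moreover have "(1 - fps_X) * fps_deriv ?F = fps_const (of_real a) * ?F"
  proof (rule fps_ext)
    fix m
    have "of_nat (Suc m) * complex_of_real (pochhammer a (Suc m) / fact (Suc m)) =
          of_real (a + real m) * complex_of_real (pochhammer a m / fact m)"
      by (simp add: pochhammer_Suc field_simps del: of_nat_Suc)
    then show "fps_nth ((1 - fps_X) * fps_deriv ?F) m = fps_nth (fps_const (of_real a) * ?F) m"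
      by (cases m) (simp_all add: left_diff_distrib fps_X_mult_nth algebra_simps del: of_real_mult of_real_divide)
  qed
  moreover have "(\<lambda>x. of_real a * stieltjes x) has_fps_expansion fps_const (of_real a) * ?F"
    by (intro fps_expansion_intros stieltjes_fps_beta)
  ultimately show ?thesis using has_fps_expansion_imp_eventually_eq by metis
qed

text \<open>The differential equation is the recurrence of the logarithmic moments, \<open>M m\<close> being the moments and
  \<open>h m\<close> the quotients.\<close>

lemma log_stieltjes_beta_ode:
  "\<forall>\<^sub>F x in nhds 0. (1 - x) * (x * deriv log_stieltjes x) + (1 - x) * stieltjes x = 1 + of_real a * (x * log_stieltjes x)"
proof -
  define M where "M m = pochhammer a m / fact m" for m
  define h where "h m = Digamma a - Digamma 1 + H_sum a m - H_sum 1 m" for m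
  let ?F = "Abs_fps (\<lambda>m. complex_of_real (M m))"
  let ?L = "Abs_fps (\<lambda>m. complex_of_real (M m * h m))"
  have F: "stieltjes has_fps_expansion ?F" using stieltjes_fps_beta by (simp add: M_def)
  have L: "log_stieltjes has_fps_expansion ?L"
    using log_stieltjes_fps beta_log_moment[OF a] by (simp add: M_def h_def)
  have "(\<lambda>x. (1 - x) * (x * deriv log_stieltjes x) + (1 - x) * stieltjes x) has_fps_expansion
      (1 - fps_X) * (fps_X * fps_deriv ?L) + (1 - fps_X) * ?F"
    by (intro fps_expansion_intros F L)
  moreover have "(1 - fps_X) * (fps_X * fps_deriv ?L) + (1 - fps_X) * ?F = 1 + fps_const (of_real a) * (fps_X * ?L)"
  proof (rule fps_ext)
    fix m
    have XL: "fps_nth (fps_X * fps_deriv ?L) k = of_real (real k * (M k * h k))" for k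
      by (cases k) simp_all
    show "fps_nth ((1 - fps_X) * (fps_X * fps_deriv ?L) + (1 - fps_X) * ?F) m =
          fps_nth (1 + fps_const (of_real a) * (fps_X * ?L)) m"
    proof (cases m)
      case 0
      then show ?thesis by (simp add: left_diff_distrib XL M_def)
    next
      case (Suc k)
      have M: "real (Suc k) * M (Suc k) = (a + real k) * M k"
        by (simp add: M_def pochhammer_Suc field_simps del: of_nat_Suc)
      have hS: "h (Suc k) = h k + 1 / (a + real k) - 1 / real (Suc k)"
        by (simp add: h_def H_sum_def)
      have "real (Suc k) * (M (Suc k) * h (Suc k)) = real (Suc k) * M (Suc k) * (h k + 1 / (a + real k)) - M (Suc k)"
        by (simp add: hS field_simps del: of_nat_Suc)
      also have "\<dots> = (a + real k) * M k * h k + M k - M (Suc k)"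
        unfolding M using a by (simp add: field_simps)
      finally have "real (Suc k) * (M (Suc k) * h (Suc k)) - real k * (M k * h k) + (M (Suc k) - M k) = a * (M k * h k)"
        by (simp add: algebra_simps)
      then have "complex_of_real (real (Suc k) * (M (Suc k) * h (Suc k)) - real k * (M k * h k) + (M (Suc k) - M k))
          = complex_of_real (a * (M k * h k))" by (rule arg_cong)
      moreover have "fps_nth ((1 - fps_X) * (fps_X * fps_deriv ?L) + (1 - fps_X) * ?F) m =
         complex_of_real (real (Suc k) * (M (Suc k) * h (Suc k)) - real k * (M k * h k) + (M (Suc k) - M k))"
        unfolding left_diff_distrib mult_1_left fps_add_nth fps_sub_nth fps_X_mult_nth[of "fps_X * fps_deriv ?L"] fps_X_mult_nth[of ?F] XL Suc
        by simp
      moreover have "fps_nth (1 + fps_const (of_real a) * (fps_X * ?L)) m = complex_of_real (a * (M k * h k))"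
        unfolding Suc by simp
      ultimately show ?thesis by (simp only:)
    qed
  qed
  moreover have "(\<lambda>x. 1 + of_real a * (x * log_stieltjes x)) has_fps_expansion 1 + fps_const (of_real a) * (fps_X * ?L)"
    by (intro fps_expansion_intros L)
  ultimately show ?thesis using has_fps_expansion_imp_eventually_eq by metis
qed

text \<open>The coefficient of \<open>Ln x\<close> cancels, because \<open>stieltjes\<close> solves the homogeneous equation; the identity
  theorem then carries the equation across \<open>[1, \<infinity>)\<close>.\<close>

lemma log_transform_beta_ode:
  assumes "x \<notin> \<real>\<^sub>\<le>\<^sub>0"
  shows "(x - 1) * deriv log_transform x + of_real a * log_transform x = - 1 / x"
proof -
  let ?S = "- \<real>\<^sub>\<le>\<^sub>0 :: complex set"
  have opS: "open ?S" by (simp add: open_Compl)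
  from eventually_conj[OF stieltjes_beta_ode log_stieltjes_beta_ode]
  obtain U where U: "open U" "0 \<in> U" and odes: "\<And>x. x \<in> U \<Longrightarrow> (1 - x) * deriv stieltjes x = of_real a * stieltjes x"
     "\<And>x. x \<in> U \<Longrightarrow> (1 - x) * (x * deriv log_stieltjes x) + (1 - x) * stieltjes x = 1 + of_real a * (x * log_stieltjes x)"
    by (auto simp: eventually_nhds)
  obtain r where r: "r > 0" "ball 0 r \<subseteq> U" using U open_contains_ball by blast
  \<comment> \<open>A base point near \<open>0\<close> that avoids both cuts.\<close>
  define b where "b = complex_of_real (min r 1 / 2)"
  have b: "b \<in> U" "b \<in> cut_plane" "b \<in> ?S"
  proof -
    have "norm b < r" using r by (simp add: b_def)
    then show "b \<in> U" using r by (auto simp: subset_iff)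
    show "b \<in> cut_plane" "b \<in> ?S" using r
      by (auto simp: b_def complex_nonpos_Reals_iff simp del: of_real_divide)
  qed
  show ?thesis
  proof (rule holomorphic_eq_on_connected_nhds[OF opS connected_minus_nonpos_Reals b(3),
      where g="\<lambda>x. - 1 / x"])
    show "(\<lambda>x. (x - 1) * deriv log_transform x + of_real a * log_transform x) holomorphic_on ?S"
      by (intro holomorphic_intros log_transform_holomorphic opS)
    show "(\<lambda>x. - 1 / x) holomorphic_on ?S" by (intro holomorphic_intros) auto
    let ?T = "U \<inter> cut_plane \<inter> ?S"
    have opT: "open ?T" using U opS open_cut_plane by (intro open_Int) auto
    have "\<forall>\<^sub>F x in nhds b. x \<in> ?T" using opT b by (intro eventually_nhds_in_open) auto
    then show "\<forall>\<^sub>F x in nhds b. (x - 1) * deriv log_transform x + of_real a * log_transform x = - 1 / x"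
    proof eventually_elim
      case (elim x)
      then have xU: "x \<in> U" and xc: "x \<in> cut_plane" and xS: "x \<notin> \<real>\<^sub>\<le>\<^sub>0" by auto
      have x0: "x \<noteq> 0" using xS by auto
      have dF: "(stieltjes has_field_derivative deriv stieltjes x) (at x)"
        by (rule holomorphic_derivI[OF stieltjes_holomorphic open_cut_plane xc])
      have dL: "(log_stieltjes has_field_derivative deriv log_stieltjes x) (at x)"
        by (rule holomorphic_derivI[OF log_stieltjes_holomorphic open_cut_plane xc])
      have "((\<lambda>x. log_stieltjes x + Ln x * stieltjes x) has_field_derivative
          (deriv log_stieltjes x + (1 / x * stieltjes x + deriv stieltjes x * Ln x))) (at x)"
        using xS by (auto intro!: derivative_eq_intros dF dL simp: field_simps)
      then have "(log_transform has_field_derivative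
          (deriv log_stieltjes x + (1 / x * stieltjes x + deriv stieltjes x * Ln x))) (at x)"
      proof (rule has_field_derivative_transform_within_open[OF _ opT elim])
        show "log_stieltjes x + Ln x * stieltjes x = log_transform x" if "x \<in> ?T" for x
          using log_transform_eq[of x] that by auto
      qed
      then have d: "deriv log_transform x = deriv log_stieltjes x + (1 / x * stieltjes x + deriv stieltjes x * Ln x)"
        by (rule DERIV_imp_deriv)
      have K: "log_transform x = log_stieltjes x + Ln x * stieltjes x" by (rule log_transform_eq[OF xc xS])
      have "x * ((1 - x) * deriv log_transform x - of_real a * log_transform x) =
        ((1 - x) * (x * deriv log_stieltjes x) + (1 - x) * stieltjes x - of_real a * (x * log_stieltjes x))
         + x * Ln x * ((1 - x) * deriv stieltjes x - of_real a * stieltjes x)"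
        unfolding d K using x0 by (simp add: field_simps)
      also have "\<dots> = 1" using odes[OF xU] by simp
      finally show ?case using x0 by (simp add: field_simps)
    qed
  qed (use assms in auto)
qed

text \<open>The factor \<open>(x - 1)^a\<close> integrates the differential equation above.\<close>

definition transfer_factor :: "complex \<Rightarrow> complex" where
  "transfer_factor x = (x - 1) powr of_real a * log_transform x"

lemma transfer_factor_deriv:
  assumes "x - 1 \<notin> \<real>\<^sub>\<le>\<^sub>0"
  shows "(transfer_factor has_field_derivative - ((x - 1) powr (of_real a - 1) / x)) (at x)"
proof -
  have x1: "x - 1 \<noteq> 0" using assms by auto
  have xn: "x \<notin> \<real>\<^sub>\<le>\<^sub>0" using assms by (auto simp: complex_nonpos_Reals_iff)
  have dK: "(log_transform has_field_derivative deriv log_transform x) (at x)"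
    by (rule holomorphic_derivI[OF log_transform_holomorphic]) (use xn in \<open>auto simp: open_Compl\<close>)
  have "((\<lambda>x. (x - 1) powr of_real a) has_field_derivative of_real a * (x - 1) powr (of_real a - 1)) (at x)"
    using assms by (auto intro!: derivative_eq_intros)
  from DERIV_mult[OF this dK]
  have "(transfer_factor has_field_derivative of_real a * (x - 1) powr (of_real a - 1) * log_transform x
      + deriv log_transform x * (x - 1) powr of_real a) (at x)"
    by (simp add: transfer_factor_def[abs_def])
  also have "(x - 1) powr of_real a = (x - 1) powr (of_real a - 1) * (x - 1)"
    using x1 by (simp add: powr_diff)
  also have "of_real a * (x - 1) powr (of_real a - 1) * log_transform x
      + deriv log_transform x * ((x - 1) powr (of_real a - 1) * (x - 1)) =
      (x - 1) powr (of_real a - 1) * ((x - 1) * deriv log_transform x + of_real a * log_transform x)"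
    by (simp add: algebra_simps)
  also have "\<dots> = - ((x - 1) powr (of_real a - 1) / x)"
    by (simp add: log_transform_beta_ode[OF xn])
  finally show ?thesis .
qed

lemma Beta_reflection: "Beta (1 - a) a = pi / sin (pi * a)"
proof -
  have "Gamma (1 - complex_of_real a) = of_real (Gamma (1 - a))"
    by (metis Gamma_complex_of_real of_real_1 of_real_diff)
  then have "complex_of_real (Beta (1 - a) a) = Gamma (of_real a) * Gamma (1 - of_real a)"
    by (simp add: Beta_def Gamma_complex_of_real)
  also have "\<dots> = complex_of_real (pi / sin (pi * a))"
    by (simp add: Gamma_reflection_complex flip: sin_of_real)
  finally show ?thesis by (simp only: of_real_eq_iff)
qed

lemma transfer_factor_real_tendsto:
  "((\<lambda>r. transfer_factor (1 + of_real r)) \<longlongrightarrow> - of_real (pi / sin (pi * a))) at_top"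
proof -
  define f where "f u = u powr (1 - a - 1) * (1 - u) powr (a - 1)" for u
  define I where "I s = integral {0..s} f" for s
  have hasB: "(f has_integral Beta (1 - a) a) {0..1}"
    unfolding f_def[abs_def] by (rule has_integral_Beta_real) (use a in auto)
  then have int: "f integrable_on {0..1}" by blast
  have contI: "continuous_on {0..1} I"
    unfolding I_def[abs_def] by (rule indefinite_integral_continuous_1[OF int])
  have I1: "I 1 = Beta (1 - a) a" using hasB by (simp add: I_def integral_unique)
  have I0: "I 0 = 0" by (simp add: I_def)
  have dI: "(I has_vector_derivative f s) (at s)" if s: "s \<in> {0<..<1}" for s
  proof -
    have "continuous (at s within {0..1} - {}) f"
      unfolding f_def[abs_def] using s by (intro continuous_intros) auto
    then have "(I has_vector_derivative f s) (at s within {0..1} - {})"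
      unfolding I_def[abs_def]
      by (intro integral_has_vector_derivative_continuous_at int) (use s in auto)
    moreover have "{0<..<1} \<subseteq> {0..1} - ({} :: real set)" by auto
    ultimately have "(I has_vector_derivative f s) (at s within {0<..<1})"
      by (rule has_vector_derivative_within_subset)
    moreover have "at s within {0<..<1} = at s" by (rule at_within_open[OF s]) simp
    ultimately show ?thesis by (simp only:)
  qed
  \<comment> \<open>In the variable \<open>s = 1 / x\<close> the derivative of the transfer factor is the integrand \<open>f\<close>.  The constant
    difference is found at \<open>s = 1\<close>, where the transfer factor vanishes.\<close>
  let ?g = "\<lambda>s. transfer_factor (of_real (1 / s)) - of_real (I s)"
  have dg: "(?g has_vector_derivative 0) (at s within {0<..<1})" if s: "s \<in> {0<..<1}" for s
  proof -
    have "1 / s > 1" using s by simp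
    then have "complex_of_real (1 / s) - 1 \<notin> \<real>\<^sub>\<le>\<^sub>0"
      by (auto simp: complex_nonpos_Reals_iff simp del: of_real_divide)
    from transfer_factor_deriv[OF this]
    have D: "(transfer_factor has_field_derivative - ((of_real (1 / s) - 1) powr (of_real a - 1) / of_real (1 / s))) (at (of_real (1 / s)))" .
    have "((\<lambda>s. 1 / s) has_real_derivative - 1 / s ^ 2) (at s)"
      using s by (auto intro!: derivative_eq_intros simp: power2_eq_square)
    then have "((\<lambda>s. complex_of_real (1 / s)) has_vector_derivative of_real (- 1 / s ^ 2)) (at s)"
      by (intro has_vector_derivative_of_real) (simp add: has_real_derivative_iff_has_vector_derivative)
    from field_vector_diff_chain_at[OF this D]
    have "((\<lambda>s. transfer_factor (of_real (1 / s))) has_vector_derivative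
        of_real (- 1 / s ^ 2) * (- ((of_real (1 / s) - 1) powr (of_real a - 1) / of_real (1 / s)))) (at s)"
      by (simp add: o_def)
    also have "complex_of_real (1 / s) - 1 = of_real (1 / s - 1)" by simp
    also have "complex_of_real (1 / s - 1) powr (of_real a - 1) = of_real ((1 / s - 1) powr (a - 1))"
      using \<open>1 / s > 1\<close> by (subst powr_of_real[symmetric]) auto
    also have "of_real (- 1 / s ^ 2) * (- (complex_of_real ((1 / s - 1) powr (a - 1)) / of_real (1 / s)))
        = complex_of_real ((1 / s - 1) powr (a - 1) / s)"
      using s by (simp add: power2_eq_square field_simps)
    also have "(1 / s - 1) powr (a - 1) / s = f s"
    proof -
      have "(1 / s - 1) powr (a - 1) = ((1 - s) / s) powr (a - 1)" using s by (simp add: diff_divide_distrib)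
      also have "\<dots> = (1 - s) powr (a - 1) / s powr (a - 1)" using s by (simp add: powr_divide)
      also have "\<dots> / s = (1 - s) powr (a - 1) * s powr (- a)"
        using s by (simp add: powr_diff powr_minus field_simps)
      finally show ?thesis by (simp add: f_def mult.commute)
    qed
    finally have "((\<lambda>s. transfer_factor (of_real (1 / s))) has_vector_derivative of_real (f s)) (at s)" .
    moreover have "((\<lambda>s. complex_of_real (I s)) has_vector_derivative of_real (f s)) (at s)"
      using dI[OF s] by (intro has_vector_derivative_of_real) (simp add: has_real_derivative_iff_has_vector_derivative)
    ultimately have "(?g has_vector_derivative of_real (f s) - of_real (f s)) (at s)"
      by (rule has_vector_derivative_diff)
    then show ?thesis by (simp add: has_vector_derivative_at_within)
  qed
  obtain c where c: "\<And>s. s \<in> {0<..<1} \<Longrightarrow> ?g s = c"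
    using has_vector_derivative_zero_constant[of "{0<..<1::real}" ?g] dg by auto
  have ev1: "\<forall>\<^sub>F s in at_left (1::real). s \<in> {0<..<1}"
    using eventually_at_left_real[of 0 1] by simp
  have ev0: "\<forall>\<^sub>F s in at_right (0::real). s \<in> {0<..<1}"
    using eventually_at_right_real[of 0 1] by simp
  have Il: "(I \<longlongrightarrow> I 1) (at_left 1)"
    using contI by (auto simp: continuous_on_Icc_at_leftD)
  have Ir: "(I \<longlongrightarrow> I 0) (at_right 0)"
    using contI by (auto simp: continuous_on_Icc_at_rightD)
  have tl: "((\<lambda>s. transfer_factor (of_real (1 / s))) \<longlongrightarrow> 0) (at_left 1)"
  proof -
    have s1: "((\<lambda>s::real. complex_of_real (1 / s)) \<longlongrightarrow> of_real (1 / 1)) (at_left 1)"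
      by (intro tendsto_intros) auto
    have "isCont log_transform 1"
      using holomorphic_on_imp_continuous_on[OF log_transform_holomorphic]
      by (rule continuous_on_interior) (simp add: interior_open open_Compl)
    from isCont_tendsto_compose[OF this] s1
    have "((\<lambda>s. log_transform (of_real (1 / s))) \<longlongrightarrow> log_transform 1) (at_left 1)" by simp
    moreover have "((\<lambda>s. (complex_of_real (1 / s) - 1) powr of_real a) \<longlongrightarrow> 0) (at_left 1)"
    proof (rule tendsto_norm_zero_cancel)
      have "((\<lambda>s. norm (complex_of_real (1 / s) - 1) powr a) \<longlongrightarrow> norm (complex_of_real (1 / 1) - 1) powr a) (at_left 1)"
        by (rule tendsto_powr2[OF tendsto_norm[OF tendsto_diff[OF s1 tendsto_const]] tendsto_const]) (use a in auto)
      then show "((\<lambda>s. norm ((complex_of_real (1 / s) - 1) powr of_real a)) \<longlongrightarrow> 0) (at_left 1)"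
        by (simp add: norm_powr_real_powr')
    qed
    ultimately have "((\<lambda>s. (complex_of_real (1 / s) - 1) powr of_real a * log_transform (of_real (1 / s))) \<longlongrightarrow> 0 * log_transform 1) (at_left 1)"
      by (intro tendsto_mult)
    then show ?thesis by (simp add: transfer_factor_def)
  qed
  have "(?g \<longlongrightarrow> 0 - of_real (I 1)) (at_left 1)"
    by (intro tendsto_diff tl tendsto_of_real Il)
  moreover have "(?g \<longlongrightarrow> c) (at_left 1)"
    by (rule tendsto_eventually) (use ev1 c in \<open>auto elim!: eventually_mono\<close>)
  ultimately have c_eq: "c = - of_real (I 1)"
    using tendsto_unique[of "at_left (1::real)"] by fastforce
  have "((\<lambda>s. c + of_real (I s)) \<longlongrightarrow> c + of_real (I 0)) (at_right 0)"
    by (intro tendsto_intros Ir)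
  moreover have "\<forall>\<^sub>F s in at_right 0. c + of_real (I s) = transfer_factor (of_real (1 / s))"
    using ev0
  proof eventually_elim
    case (elim s)
    show ?case using c[OF elim] by (metis add.commute diff_add_cancel)
  qed
  ultimately have R: "((\<lambda>s. transfer_factor (of_real (1 / s))) \<longlongrightarrow> c) (at_right 0)"
    using I0 by (simp add: tendsto_cong)
  have "filterlim (\<lambda>r::real. 1 / (1 + r)) (at_right 0) at_top" by real_asymp
  from filterlim_compose[OF R this] show ?thesis
    by (simp add: c_eq I1 Beta_reflection)
qed

lemma transfer_factor_arc:
  assumes "Im x > 0" "norm (x - 1) = r" "r > 1"
  shows "norm (transfer_factor x - transfer_factor (1 + of_real r)) \<le> pi * (r powr a / (r - 1))"
proof -
  \<comment> \<open>Mean value inequality along the arc about \<open>1\<close> from the real axis to \<open>x\<close>.\<close>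
  define th where "th = Arg (x - 1)"
  have x1: "x - 1 \<noteq> 0" "x - 1 = of_real r * exp (\<i> * of_real th)"
  proof -
    show "x - 1 \<noteq> 0" using assms by auto
    then show "x - 1 = of_real r * exp (\<i> * of_real th)"
      using Arg_eq[of "x - 1"] assms by (simp add: th_def)
  qed
  have th: "0 < th" "th < pi"
    using assms Arg_lt_pi[of "x - 1"] by (auto simp: th_def)
  let ?g = "\<lambda>t. transfer_factor (1 + of_real r * exp (\<i> * t))"
  have nn: "of_real r * exp (\<i> * of_real t) \<notin> \<real>\<^sub>\<le>\<^sub>0" if "0 \<le> t" "t < pi" for t
  proof (cases "t = 0")
    case True
    then show ?thesis using assms by (auto simp: complex_nonpos_Reals_iff)
  next
    case False
    then have "sin t > 0" using that by (intro sin_gt_zero) auto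
    then show ?thesis using assms by (auto simp: complex_nonpos_Reals_iff Im_exp)
  qed
  have d: "(?g has_field_derivative - ((of_real r * exp (\<i> * t)) powr (of_real a - 1) / (1 + of_real r * exp (\<i> * t)))
       * (of_real r * (\<i> * exp (\<i> * t)))) (at t)" if t: "t \<in> closed_segment 0 (of_real th)" for t
  proof -
    obtain u where u: "t = of_real u" "0 \<le> u" "u \<le> th"
    proof -
      obtain v where v: "0 \<le> v" "v \<le> 1" "t = of_real (v * th)"
        using t by (auto simp: closed_segment_def scaleR_conv_of_real)
      then show ?thesis using th by (intro that[of "v * th"]) (auto simp: mult_left_le_one_le)
    qed
    have "1 + of_real r * exp (\<i> * t) - 1 \<notin> \<real>\<^sub>\<le>\<^sub>0" using nn[of u] u th by simp
    from transfer_factor_deriv[OF this]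
    have D: "(transfer_factor has_field_derivative - ((of_real r * exp (\<i> * t)) powr (of_real a - 1) / (1 + of_real r * exp (\<i> * t))))
        (at (1 + of_real r * exp (\<i> * t)))" by simp
    have "((\<lambda>t. 1 + of_real r * exp (\<i> * t)) has_field_derivative (of_real r * (\<i> * exp (\<i> * t)))) (at t)"
      by (auto intro!: derivative_eq_intros)
    from DERIV_chain2[OF D this] show ?thesis .
  qed
  have "norm (?g (of_real th) - ?g 0) \<le> (r powr a / (r - 1)) * norm (complex_of_real th - 0)"
  proof (rule field_differentiable_bound[where S="closed_segment 0 (complex_of_real th)"])
    fix t assume t: "t \<in> closed_segment 0 (complex_of_real th)"
    then obtain v where "t = of_real (v * th)"
      by (auto simp: closed_segment_def scaleR_conv_of_real)
    then obtain u where u: "t = of_real u" by blast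
    have n1: "norm (exp (\<i> * t)) = 1" using u by simp
    show "(?g has_field_derivative - ((of_real r * exp (\<i> * t)) powr (of_real a - 1) / (1 + of_real r * exp (\<i> * t)))
       * (of_real r * (\<i> * exp (\<i> * t)))) (at t within closed_segment 0 (complex_of_real th))"
      by (rule has_field_derivative_at_within[OF d[OF t]])
    have "r - 1 \<le> norm (1 + of_real r * exp (\<i> * t))"
      using norm_triangle_ineq2[of "of_real r * exp (\<i> * t)" "- 1"] n1 assms by (simp add: norm_mult add.commute)
    moreover have "norm ((of_real r * exp (\<i> * t)) powr (of_real a - 1)) = r powr (a - 1)"
      using n1 assms by (subst norm_powr_real_powr') (auto simp: norm_mult)
    ultimately have "norm (((of_real r * exp (\<i> * t)) powr (of_real a - 1)) / (1 + of_real r * exp (\<i> * t))) \<le> r powr (a - 1) / (r - 1)"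
      using assms by (auto simp: norm_divide intro!: divide_left_mono mult_pos_pos)
    then have "norm (((of_real r * exp (\<i> * t)) powr (of_real a - 1)) / (1 + of_real r * exp (\<i> * t))) * r \<le> r powr (a - 1) / (r - 1) * r"
      using assms by (intro mult_right_mono) auto
    also have "\<dots> = r powr a / (r - 1)" using assms by (simp add: powr_diff)
    finally have le: "norm (((of_real r * exp (\<i> * t)) powr (of_real a - 1)) / (1 + of_real r * exp (\<i> * t))) * r \<le> r powr a / (r - 1)" .
    have "norm (of_real r * (\<i> * exp (\<i> * t))) = r" using n1 assms by (simp add: norm_mult)
    then show "norm (- ((of_real r * exp (\<i> * t)) powr (of_real a - 1) / (1 + of_real r * exp (\<i> * t)))
       * (of_real r * (\<i> * exp (\<i> * t)))) \<le> r powr a / (r - 1)"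
      using le by (subst norm_mult) (simp only: norm_minus_cancel)
  qed auto
  also have "\<dots> \<le> (r powr a / (r - 1)) * pi" using th assms by (intro mult_left_mono) auto
  also have "?g (of_real th) = transfer_factor x"
    using x1(2) by (simp add: algebra_simps)
  finally show ?thesis by (simp add: mult.commute)
qed

text \<open>The arc estimate does not depend on the direction, so the limit along the real axis holds uniformly in
  the upper half-plane.\<close>

lemma transfer_factor_tendsto:
  assumes "e > 0"
  obtains R where "R > 2" "\<And>x. Im x > 0 \<Longrightarrow> norm (x - 1) \<ge> R \<Longrightarrow>
    norm (transfer_factor x + of_real (pi / sin (pi * a))) \<le> e"
proof -
  have "((\<lambda>r. pi * (r powr (a - 1) * (r / (r - 1)))) \<longlongrightarrow> pi * (0 * 1)) at_top"
  proof (intro tendsto_mult tendsto_const tendsto_neg_powr filterlim_ident)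
    show "((\<lambda>r::real. r / (r - 1)) \<longlongrightarrow> 1) at_top" by real_asymp
  qed (use a in auto)
  moreover have "\<forall>\<^sub>F r in at_top. pi * (r powr (a - 1) * (r / (r - 1))) = pi * (r powr a / (r - 1))"
    using eventually_gt_at_top[of 1] by eventually_elim (simp add: powr_diff)
  ultimately have "((\<lambda>r. pi * (r powr a / (r - 1))) \<longlongrightarrow> pi * (0 * 1)) at_top"
    by (rule Lim_transform_eventually)
  then have "((\<lambda>r. pi * (r powr a / (r - 1))) \<longlongrightarrow> 0) at_top" by simp
  then have "\<forall>\<^sub>F r in at_top. pi * (r powr a / (r - 1)) < e / 2"
    using assms by (intro order_tendstoD(2)) auto
  moreover have "\<forall>\<^sub>F r in at_top. dist (transfer_factor (1 + of_real r)) (- of_real (pi / sin (pi * a))) < e / 2"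
    using assms by (intro tendstoD transfer_factor_real_tendsto) auto
  ultimately have "\<forall>\<^sub>F r in at_top. pi * (r powr a / (r - 1)) < e / 2 \<and>
      norm (transfer_factor (1 + of_real r) + of_real (pi / sin (pi * a))) < e / 2"
    by eventually_elim (auto simp: dist_norm)
  then obtain R where R: "\<And>r. r \<ge> R \<Longrightarrow> pi * (r powr a / (r - 1)) < e / 2 \<and>
      norm (transfer_factor (1 + of_real r) + of_real (pi / sin (pi * a))) < e / 2"
    by (auto simp: eventually_at_top_linorder)
  show ?thesis
  proof (rule that[of "max R 3"])
    fix x assume x: "Im x > 0" "norm (x - 1) \<ge> max R 3"
    let ?r = "norm (x - 1)"
    have "norm (transfer_factor x - transfer_factor (1 + of_real ?r)) \<le> pi * (?r powr a / (?r - 1))"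
      by (rule transfer_factor_arc[OF x(1) refl]) (use x in simp)
    also have "\<dots> < e / 2" using R[of ?r] x by auto
    finally have "norm (transfer_factor x - transfer_factor (1 + of_real ?r)) < e / 2" .
    moreover have "norm (transfer_factor (1 + of_real ?r) + of_real (pi / sin (pi * a))) < e / 2"
      using R[of ?r] x by auto
    ultimately show "norm (transfer_factor x + of_real (pi / sin (pi * a))) \<le> e"
      using norm_triangle_ineq[of "transfer_factor x - transfer_factor (1 + of_real ?r)"
         "transfer_factor (1 + of_real ?r) + of_real (pi / sin (pi * a))"] by simp
  qed auto
qed

text \<open>In the upper half-plane \<open>(1 - x)^(-a)\<close> and \<open>(x - 1)^(-a)\<close> differ by the constant factor
\<open>exp (i \<pi> a)\<close>, so the deviation of \<open>K\<^sub>1\<close> from \<open>\<kappa> F\<^sub>1\<close> is exactly a power times the deviation of the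
transfer factor from its limit.\<close>

lemma log_transform_minus_stieltjes:
  assumes "Im x > 0"
  shows "log_transform x + of_real (pi / sin (pi * a)) * exp (- \<i> * pi * a) * stieltjes x =
    (x - 1) powr (- of_real a) * (transfer_factor x + of_real (pi / sin (pi * a)))"
proof -
  have x: "x \<in> cut_plane" "x - 1 \<noteq> 0" using assms by auto
  have "Ln (1 - x) = Ln (x - 1) - \<i> * pi"
    using Ln_minus[OF x(2)] assms by simp
  moreover have "1 - x \<noteq> 0" using x(2) by auto
  ultimately have "(1 - x) powr (- of_real a) = exp (- of_real a * (Ln (x - 1) - \<i> * pi))"
    by (simp only: powr_def if_False)
  then have "(1 - x) powr (- of_real a) = (x - 1) powr (- of_real a) * exp (\<i> * pi * a)"
    using x(2) by (simp add: powr_def exp_add[symmetric] algebra_simps)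
  then have F: "exp (- \<i> * pi * a) * stieltjes x = (x - 1) powr (- of_real a)"
    using stieltjes_beta[OF x(1)] by (simp add: exp_minus)
  have "log_transform x = (x - 1) powr (- of_real a) * transfer_factor x"
    using x(2) by (simp add: transfer_factor_def powr_minus)
  then show ?thesis using F by (simp add: algebra_simps)
qed

end

section \<open>Behaviour at infinity\<close>

text \<open>A class of weights that contains logarithms at \<open>0\<close> and integrable poles, and is closed under
averaging over a beta variable.  A weight in it, averaged at scale \<open>r\<close>, contributes only
\<open>O(r^(-a))\<close> from the region where the argument stays bounded.\<close>

definition Mellin_finite :: "(real \<Rightarrow> ennreal) \<Rightarrow> bool" where
  "Mellin_finite w \<longleftrightarrow> w \<in> borel_measurable borel \<and>
     (\<forall>b R. b > 0 \<longrightarrow> (\<integral>\<^sup>+v. w v * ennreal (v powr (b - 1)) * indicator {0<..<R} v \<partial>lborel) < \<infinity>)"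

text \<open>The substitution \<open>v = r s\<close>.\<close>

lemma Mellin_scale:
  assumes [measurable]: "f \<in> borel_measurable borel" "A \<in> sets borel"
    and A: "A \<subseteq> {0<..}" and r: "(r::real) > 0"
  shows "(\<integral>\<^sup>+s. f (r * s) * ennreal (s powr (b - 1)) * indicator A (r * s) \<partial>lborel) =
         ennreal (r powr (- b)) * (\<integral>\<^sup>+v. f v * ennreal (v powr (b - 1)) * indicator A v \<partial>lborel)"
proof -
  let ?I = "\<integral>\<^sup>+s. f (r * s) * ennreal (s powr (b - 1)) * indicator A (r * s) \<partial>lborel"
  have eq: "f (r * s) * ennreal ((r * s) powr (b - 1)) * indicator A (r * s) =
        ennreal (r powr (b - 1)) * (f (r * s) * ennreal (s powr (b - 1)) * indicator A (r * s))" for s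
  proof (cases "r * s \<in> A")
    case True
    then have "s > 0" using A r by (auto simp: zero_less_mult_iff)
    then have "(r * s) powr (b - 1) = r powr (b - 1) * s powr (b - 1)" using r by (simp add: powr_mult)
    then show ?thesis by (simp add: ennreal_mult mult_ac)
  qed simp
  have "(\<integral>\<^sup>+v. f v * ennreal (v powr (b - 1)) * indicator A v \<partial>lborel) =
        ennreal \<bar>r\<bar> * (\<integral>\<^sup>+s. f (0 + r * s) * ennreal ((0 + r * s) powr (b - 1)) * indicator A (0 + r * s) \<partial>lborel)"
    using r by (intro nn_integral_real_affine) auto
  also have "\<dots> = ennreal r * (ennreal (r powr (b - 1)) * ?I)"
    using r by (simp add: eq nn_integral_cmult)
  also have "\<dots> = ennreal (r powr b) * ?I"
    using r by (simp add: mult.assoc[symmetric] ennreal_mult[symmetric] powr_diff)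
  finally have "ennreal (r powr (- b)) * (\<integral>\<^sup>+v. f v * ennreal (v powr (b - 1)) * indicator A v \<partial>lborel)
      = ennreal (r powr (- b) * r powr b) * ?I"
    by (simp add: ennreal_mult mult.assoc)
  also have "r powr (- b) * r powr b = 1" using r by (simp flip: powr_add)
  finally show ?thesis by simp
qed

lemma nn_integral_beta:
  assumes [measurable]: "f \<in> borel_measurable borel"
  shows "(\<integral>\<^sup>+s. f s \<partial>beta_measure a) = (\<integral>\<^sup>+s. ennreal (beta_density a s) * f s \<partial>lborel)"
  unfolding beta_measure_def by (subst nn_integral_density) auto

lemma nn_integral_beta_lower:
  assumes a: "0 < a" "a < 1" and [measurable]: "f \<in> borel_measurable borel"
  shows "ennreal (1 / Beta a (1 - a)) * (\<integral>\<^sup>+s. f s * ennreal (s powr (a - 1)) * indicator {0<..<1} s \<partial>lborel)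
         \<le> (\<integral>\<^sup>+s. f s \<partial>beta_measure a)"
proof -
  have B: "Beta a (1 - a) > 0" using a by (intro Beta_pos) auto
  have "ennreal (1 / Beta a (1 - a)) * (\<integral>\<^sup>+s. f s * ennreal (s powr (a - 1)) * indicator {0<..<1} s \<partial>lborel)
     = (\<integral>\<^sup>+s. ennreal (1 / Beta a (1 - a)) * (f s * ennreal (s powr (a - 1)) * indicator {0<..<1} s) \<partial>lborel)"
    by (rule nn_integral_cmult[symmetric]) auto
  also have "\<dots> \<le> (\<integral>\<^sup>+s. ennreal (beta_density a s) * f s \<partial>lborel)"
  proof (rule nn_integral_mono)
    fix s :: real
    show "ennreal (1 / Beta a (1 - a)) * (f s * ennreal (s powr (a - 1)) * indicator {0<..<1} s) \<le> ennreal (beta_density a s) * f s"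
    proof (cases "s \<in> {0<..<1}")
      case True
      then have "1 powr (- a) \<le> (1 - s) powr (- a)" using a by (intro powr_mono2') auto
      then have "1 \<le> (1 - s) powr (- a)" by simp
      then have "s powr (a - 1) * 1 \<le> s powr (a - 1) * (1 - s) powr (- a)" by (intro mult_left_mono) auto
      then have "1 / Beta a (1 - a) * s powr (a - 1) \<le> beta_density a s"
        using B True by (simp add: beta_density_def divide_right_mono)
      then have "ennreal (1 / Beta a (1 - a) * s powr (a - 1)) * f s \<le> ennreal (beta_density a s) * f s"
        by (intro mult_right_mono ennreal_leI) auto
      then show ?thesis using True B by (simp add: ennreal_mult[symmetric] mult_ac flip: mult.assoc)
    qed simp
  qed
  also have "\<dots> = (\<integral>\<^sup>+s. f s \<partial>beta_measure a)" by (simp add: nn_integral_beta)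
  finally show ?thesis .
qed

lemma nn_integral_beta_upper:
  assumes a: "0 < a" "a < 1" and [measurable]: "f \<in> borel_measurable borel" "A \<in> sets borel" and A: "A \<subseteq> {..1/2}"
  shows "(\<integral>\<^sup>+s. f s * indicator A s \<partial>beta_measure a) \<le>
     ennreal (2 / Beta a (1 - a)) * (\<integral>\<^sup>+s. f s * ennreal (s powr (a - 1)) * indicator (A \<inter> {0<..}) s \<partial>lborel)"
proof -
  have B: "Beta a (1 - a) > 0" using a by (intro Beta_pos) auto
  have "(\<integral>\<^sup>+s. f s * indicator A s \<partial>beta_measure a) = (\<integral>\<^sup>+s. ennreal (beta_density a s) * (f s * indicator A s) \<partial>lborel)"
    by (rule nn_integral_beta) auto
  also have "\<dots> \<le> (\<integral>\<^sup>+s. ennreal (2 / Beta a (1 - a)) * (f s * ennreal (s powr (a - 1)) * indicator (A \<inter> {0<..}) s) \<partial>lborel)"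
  proof (rule nn_integral_mono)
    fix s :: real
    show "ennreal (beta_density a s) * (f s * indicator A s) \<le>
       ennreal (2 / Beta a (1 - a)) * (f s * ennreal (s powr (a - 1)) * indicator (A \<inter> {0<..}) s)"
    proof (cases "s \<in> A \<inter> {0<..}")
      case True
      then have s: "0 < s" "s \<le> 1/2" using A by auto
      have "(1 - s) powr (- a) \<le> (1 - s) powr (- 1)" using s a by (intro powr_mono') auto
      also have "\<dots> \<le> 2" using s by (simp add: powr_minus_divide field_simps)
      finally have "s powr (a - 1) * (1 - s) powr (- a) \<le> s powr (a - 1) * 2"
        by (intro mult_left_mono) auto
      then have "beta_density a s \<le> 2 / Beta a (1 - a) * s powr (a - 1)"
        using B s by (simp add: beta_density_def divide_right_mono mult.commute)
      then have "ennreal (beta_density a s) * f s \<le> ennreal (2 / Beta a (1 - a) * s powr (a - 1)) * f s"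
        by (intro mult_right_mono ennreal_leI) auto
      also have "\<dots> = ennreal (2 / Beta a (1 - a)) * (f s * ennreal (s powr (a - 1)))"
        using B by (subst ennreal_mult) (auto simp: mult_ac)
      finally show ?thesis using True by simp
    next
      case False
      then show ?thesis by (auto simp: beta_density_def indicator_def)
    qed
  qed
  also have "\<dots> = ennreal (2 / Beta a (1 - a)) * (\<integral>\<^sup>+s. f s * ennreal (s powr (a - 1)) * indicator (A \<inter> {0<..}) s \<partial>lborel)"
    by (rule nn_integral_cmult) auto
  finally show ?thesis .
qed

lemma beta_average_measurable [measurable]:
  assumes a: "0 < a" "a < 1" and [measurable]: "f \<in> borel_measurable borel"
  shows "(\<lambda>r. \<integral>\<^sup>+s. f (r * s) \<partial>beta_measure a) \<in> borel_measurable borel"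
proof -
  interpret prob_space "beta_measure a" by (rule prob_space_beta_measure[OF a])
  show ?thesis by measurable
qed

lemma Mellin_finite_beta_average:
  assumes a: "0 < a" "a < 1" and N: "Mellin_finite N"
  shows "Mellin_finite (\<lambda>r. \<integral>\<^sup>+s. N (r * s) \<partial>beta_measure a)"
  unfolding Mellin_finite_def
proof (intro conjI allI impI)
  have [measurable]: "N \<in> borel_measurable borel" using N by (simp add: Mellin_finite_def)
  show "(\<lambda>r. \<integral>\<^sup>+s. N (r * s) \<partial>beta_measure a) \<in> borel_measurable borel"
    using a by measurable
  interpret prob_space "beta_measure a" by (rule prob_space_beta_measure[OF a])
  fix b R :: real assume b: "b > 0"
  \<comment> \<open>An exponent below \<open>b\<close> for the weight and below \<open>a\<close> for the beta moment of order \<open>-d\<close>.\<close>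
  define d where "d = min b a / 2"
  have d: "0 < d" "d < a" "d < b" using a b by (auto simp: d_def min_def)
  let ?W = "\<integral>\<^sup>+v. N v * ennreal (v powr (d - 1)) * indicator {0<..<R} v \<partial>lborel"
  have W: "?W < \<infinity>" using N d by (simp add: Mellin_finite_def)
  interpret P: pair_sigma_finite lborel "beta_measure a" ..
  have "(\<integral>\<^sup>+v. (\<integral>\<^sup>+s. N (v * s) \<partial>beta_measure a) * ennreal (v powr (b - 1)) * indicator {0<..<R} v \<partial>lborel)
      \<le> (\<integral>\<^sup>+v. (\<integral>\<^sup>+s. ennreal (R powr (b - d)) * (N (v * s) * ennreal (v powr (d - 1)) * indicator {0<..<R} v) \<partial>beta_measure a) \<partial>lborel)"
  proof (rule nn_integral_mono)
    fix v :: real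
    have le: "ennreal (v powr (b - 1)) * indicator {0<..<R} v \<le> ennreal (R powr (b - d)) * (ennreal (v powr (d - 1)) * indicator {0<..<R} v)"
    proof (cases "v \<in> {0<..<R}")
      case True
      then have "v powr (b - d) * v powr (d - 1) \<le> R powr (b - d) * v powr (d - 1)"
        using d by (intro mult_right_mono powr_mono2) auto
      then show ?thesis using True by (simp add: ennreal_mult[symmetric] flip: powr_add)
    qed simp
    have "(\<integral>\<^sup>+s. N (v * s) \<partial>beta_measure a) * ennreal (v powr (b - 1)) * indicator {0<..<R} v
      \<le> (\<integral>\<^sup>+s. N (v * s) \<partial>beta_measure a) * (ennreal (R powr (b - d)) * (ennreal (v powr (d - 1)) * indicator {0<..<R} v))"
      unfolding mult.assoc by (intro mult_left_mono le) auto
    also have "\<dots> = (\<integral>\<^sup>+s. N (v * s) * (ennreal (R powr (b - d)) * (ennreal (v powr (d - 1)) * indicator {0<..<R} v)) \<partial>beta_measure a)"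
      by (rule nn_integral_multc[symmetric]) measurable
    finally show "(\<integral>\<^sup>+s. N (v * s) \<partial>beta_measure a) * ennreal (v powr (b - 1)) * indicator {0<..<R} v
      \<le> (\<integral>\<^sup>+s. ennreal (R powr (b - d)) * (N (v * s) * ennreal (v powr (d - 1)) * indicator {0<..<R} v) \<partial>beta_measure a)"
      by (simp add: mult_ac)
  qed
  also have "\<dots> = (\<integral>\<^sup>+s. (\<integral>\<^sup>+v. ennreal (R powr (b - d)) * (N (v * s) * ennreal (v powr (d - 1)) * indicator {0<..<R} v) \<partial>lborel) \<partial>beta_measure a)"
    by (rule P.Fubini'[symmetric]) measurable
  also have "\<dots> \<le> (\<integral>\<^sup>+s. ennreal (R powr (b - d)) * (ennreal (s powr (- d)) * ?W) \<partial>beta_measure a)"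
  proof (intro nn_integral_mono_AE AE_beta_measure)
    fix s :: real assume s: "0 < s" "s < 1"
    have "(\<integral>\<^sup>+v. N (v * s) * ennreal (v powr (d - 1)) * indicator {0<..<R} v \<partial>lborel)
        = (\<integral>\<^sup>+v. N (s * v) * ennreal (v powr (d - 1)) * indicator {0<..<s * R} (s * v) \<partial>lborel)"
      using s by (intro nn_integral_cong) (auto simp: indicator_def mult.commute zero_less_mult_iff)
    also have "\<dots> = ennreal (s powr (- d)) * (\<integral>\<^sup>+v. N v * ennreal (v powr (d - 1)) * indicator {0<..<s * R} v \<partial>lborel)"
      using s by (intro Mellin_scale) auto
    also have "\<dots> \<le> ennreal (s powr (- d)) * ?W"
    proof (cases "R > 0")
      case True
      then have "s * R \<le> R" using s by simp
      then show ?thesis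
        by (intro mult_left_mono nn_integral_mono) (auto simp: indicator_def)
    next
      case False
      then have "{0<..<s * R} = {}" using s by (auto simp: mult_le_0_iff not_less dest: order.strict_trans)
      then show ?thesis by simp
    qed
    finally have "(\<integral>\<^sup>+v. N (v * s) * ennreal (v powr (d - 1)) * indicator {0<..<R} v \<partial>lborel) \<le> ennreal (s powr (- d)) * ?W" .
    then show "(\<integral>\<^sup>+v. ennreal (R powr (b - d)) * (N (v * s) * ennreal (v powr (d - 1)) * indicator {0<..<R} v) \<partial>lborel)
        \<le> ennreal (R powr (b - d)) * (ennreal (s powr (- d)) * ?W)"
      by (subst nn_integral_cmult) (auto intro: mult_left_mono)
  qed
  also have "\<dots> = ennreal (R powr (b - d)) * ((\<integral>\<^sup>+s. ennreal (s powr (- d)) \<partial>beta_measure a) * ?W)"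
    by (simp add: nn_integral_cmult nn_integral_multc)
  also have "\<dots> < \<infinity>"
  proof -
    have "integrable (beta_measure a) (\<lambda>s. s powr (- d))"
      using a d by (intro integrable_beta_powr) auto
    then have "(\<integral>\<^sup>+s. ennreal (s powr (- d)) \<partial>beta_measure a) < \<infinity>"
      by (simp add: nn_integral_eq_integral)
    then show ?thesis using W by (auto simp: ennreal_mult_less_top)
  qed
  finally show "(\<integral>\<^sup>+v. (\<integral>\<^sup>+s. N (v * s) \<partial>beta_measure a) * ennreal (v powr (b - 1)) * indicator {0<..<R} v \<partial>lborel) < \<infinity>" .
qed

text \<open>Where \<open>r s \<ge> R\<close> the hypothesis applies.  The part with \<open>r s < R\<close> is of order \<open>r^(-a)\<close>, while the
average of \<open>Phi\<close> is at least a constant times \<open>r^(-a) ln r\<close>: by \<open>al \<le> a\<close> the integrand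
\<open>v^(-al) v^(a-1)\<close> dominates \<open>1 / v\<close> on \<open>[1, r]\<close>.  The logarithm makes the comparison strict even for
\<open>a = al\<close>, that is for a repeated smallest parameter.\<close>

lemma beta_average_negligible:
  assumes a: "0 < a" "a < 1" and al: "0 < al" "al \<le> a"
    and N: "Mellin_finite N" and [measurable]: "Phi \<in> borel_measurable borel"
    and low: "\<And>r. r \<ge> 0 \<Longrightarrow> ennreal ((1 + r) powr (- al)) \<le> Phi r"
    and neg: "\<And>e. e > 0 \<Longrightarrow> \<exists>R>0. \<forall>r\<ge>R. N r \<le> ennreal e * Phi r"
    and e: "e > 0"
  shows "\<exists>R>0. \<forall>r\<ge>R. (\<integral>\<^sup>+s. N (r * s) \<partial>beta_measure a) \<le> ennreal e * (\<integral>\<^sup>+s. Phi (r * s) \<partial>beta_measure a)"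
proof -
  have [measurable]: "N \<in> borel_measurable borel" using N by (simp add: Mellin_finite_def)
  define c where "c = 1 / Beta a (1 - a)"
  have c: "c > 0" using a by (auto simp: c_def intro!: Beta_pos)
  obtain R where R: "R > 0" "\<And>r. r \<ge> R \<Longrightarrow> N r \<le> ennreal (e / 2) * Phi r"
    using neg[of "e / 2"] e by auto
  define T where "T = enn2real (\<integral>\<^sup>+v. N v * ennreal (v powr (a - 1)) * indicator {0<..<R} v \<partial>lborel)"
  have T: "(\<integral>\<^sup>+v. N v * ennreal (v powr (a - 1)) * indicator {0<..<R} v \<partial>lborel) = ennreal T"
    using N a by (simp add: T_def Mellin_finite_def)
  \<comment> \<open>\<open>r \<ge> 2 R\<close> keeps \<open>s < R / r\<close> below \<open>1/2\<close>; the exponential makes \<open>(e / 4) ln r\<close> at least \<open>2 T\<close>.\<close>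
  define R' where "R' = max 1 (max (2 * R) (exp (8 * T / e)))"
  have "(\<integral>\<^sup>+s. N (r * s) \<partial>beta_measure a) \<le> ennreal e * (\<integral>\<^sup>+s. Phi (r * s) \<partial>beta_measure a)" if r: "r \<ge> R'" for r
  proof -
    have r1: "r \<ge> 1" "r \<ge> 2 * R" "r > 0" using r by (auto simp: R'_def)
    have "8 * T / e \<le> ln r" using r r1 by (simp add: R'_def ln_ge_iff)
    then have lnr: "2 * T \<le> (e / 4) * ln r" using e by (simp add: field_simps)
    let ?Q = "\<integral>\<^sup>+s. Phi (r * s) \<partial>beta_measure a"
    have "(\<integral>\<^sup>+s. N (r * s) \<partial>beta_measure a) \<le>
       (\<integral>\<^sup>+s. ennreal (e / 2) * Phi (r * s) + N (r * s) * indicator {..<R / r} s \<partial>beta_measure a)"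
    proof (intro nn_integral_mono)
      fix s :: real
      show "N (r * s) \<le> ennreal (e / 2) * Phi (r * s) + N (r * s) * indicator {..<R / r} s"
      proof (cases "s < R / r")
        case False
        then have "r * s \<ge> R" using r1 by (simp add: not_less pos_divide_le_eq mult.commute)
        then show ?thesis using R(2)[of "r * s"] False by simp
      qed (simp add: add_increasing)
    qed
    also have "\<dots> = ennreal (e / 2) * ?Q + (\<integral>\<^sup>+s. N (r * s) * indicator {..<R / r} s \<partial>beta_measure a)"
      by (subst nn_integral_add) (auto simp: nn_integral_cmult)
    also have "(\<integral>\<^sup>+s. N (r * s) * indicator {..<R / r} s \<partial>beta_measure a) \<le>
        ennreal (2 / Beta a (1 - a)) * (\<integral>\<^sup>+s. N (r * s) * ennreal (s powr (a - 1)) * indicator ({..<R / r} \<inter> {0<..}) s \<partial>lborel)"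
    proof (rule nn_integral_beta_upper[OF a])
      have le: "R / r \<le> 1 / 2" using r1 by (simp add: pos_divide_le_eq)
      show "{..<R / r} \<subseteq> {..1/2}"
      proof
        fix s assume "s \<in> {..<R / r}"
        then show "s \<in> {..1/2}" using le unfolding atMost_iff lessThan_iff by linarith
      qed
    qed measurable
    also have "(\<integral>\<^sup>+s. N (r * s) * ennreal (s powr (a - 1)) * indicator ({..<R / r} \<inter> {0<..}) s \<partial>lborel) =
        (\<integral>\<^sup>+s. N (r * s) * ennreal (s powr (a - 1)) * indicator {0<..<R} (r * s) \<partial>lborel)"
      using r1 by (intro nn_integral_cong) (auto simp: indicator_def pos_less_divide_eq mult.commute zero_less_mult_iff)
    also have "\<dots> = ennreal (r powr (- a)) * ennreal T"
      using r1 T by (subst Mellin_scale) auto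
    also have "ennreal (2 / Beta a (1 - a)) * (ennreal (r powr (- a)) * ennreal T) = ennreal (c * r powr (- a) * (2 * T))"
      using c by (simp add: ennreal_mult[symmetric] c_def T_def mult_ac)
    also have "\<dots> \<le> ennreal (c * r powr (- a) * ((e / 4) * ln r))"
      using c lnr by (intro ennreal_leI mult_left_mono) auto
    also have "\<dots> = ennreal (e / 2) * (ennreal c * (ennreal (r powr (- a)) * ennreal (ln r / 2)))"
      using c e r1 by (simp add: ennreal_mult[symmetric] field_simps)
    also have "\<dots> \<le> ennreal (e / 2) * ?Q"
    proof (rule mult_left_mono)
      have "(\<integral>\<^sup>+v. ennreal (1 / v) * indicator {1..r} v \<partial>lborel) = ennreal (ln r - ln 1)"
        by (rule nn_integral_FTC_Icc) (use r1 in \<open>auto intro!: derivative_eq_intros\<close>)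
      moreover have "ennreal (1 / 2 * (ln r - ln 1)) = ennreal (1 / 2) * ennreal (ln r - ln 1)"
        using r1 by (intro ennreal_mult) auto
      ultimately have "ennreal (ln r / 2) = ennreal (1 / 2) * (\<integral>\<^sup>+v. ennreal (1 / v) * indicator {1..r} v \<partial>lborel)"
        by simp
      also have "\<dots> = (\<integral>\<^sup>+v. ennreal (1 / 2) * (ennreal (1 / v) * indicator {1..r} v) \<partial>lborel)"
        by (rule nn_integral_cmult[symmetric]) measurable
      also have "\<dots> \<le> (\<integral>\<^sup>+v. Phi v * ennreal (v powr (a - 1)) * indicator {1..r} v \<partial>lborel)"
      proof (intro nn_integral_mono)
        fix v :: real
        show "ennreal (1 / 2) * (ennreal (1 / v) * indicator {1..r} v) \<le> Phi v * ennreal (v powr (a - 1)) * indicator {1..r} v"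
        proof (cases "v \<in> {1..r}")
          case True
          then have v: "v \<ge> 1" by simp
          have up: "(2 * v) powr (- al) \<le> (1 + v) powr (- al)" using v al by (intro powr_mono2') auto
          have "2 powr (- 1) \<le> (2 :: real) powr (- al)" using al a by (intro powr_mono) auto
          then have "2 powr (- 1) * v powr (- al) \<le> 2 powr (- al) * v powr (- al)"
            by (intro mult_right_mono) auto
          moreover have "2 powr (- 1) = (1 / 2 :: real)" by (simp add: powr_minus_divide)
          moreover have "(2 * v) powr (- al) = 2 powr (- al) * v powr (- al)" using v by (intro powr_mult)
          ultimately have "(1 / 2) * v powr (- al) \<le> (2 * v) powr (- al)" by (simp only:)
          then have 1: "(1 / 2) * v powr (- al) \<le> (1 + v) powr (- al)" using up by linarith
          have "1 / v = v powr (- 1)" using v by (simp add: powr_minus_divide)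
          also have "\<dots> \<le> v powr (a - al - 1)" using v al by (intro powr_mono) auto
          also have "\<dots> = v powr (- al) * v powr (a - 1)" by (simp flip: powr_add add: algebra_simps)
          finally have "(1 / 2) * (1 / v) \<le> (1 / 2) * v powr (- al) * v powr (a - 1)" by simp
          also have "\<dots> \<le> (1 + v) powr (- al) * v powr (a - 1)" using 1 by (intro mult_right_mono) auto
          finally have "ennreal ((1 / 2) * (1 / v)) \<le> ennreal ((1 + v) powr (- al)) * ennreal (v powr (a - 1))"
            by (simp add: ennreal_mult[symmetric] ennreal_leI)
          also have "\<dots> \<le> Phi v * ennreal (v powr (a - 1))"
            using low[of v] v by (intro mult_right_mono) auto
          finally have "ennreal ((1 / 2) * (1 / v)) \<le> Phi v * ennreal (v powr (a - 1))" .
          moreover have "ennreal ((1 / 2) * (1 / v)) = ennreal (1 / 2) * ennreal (1 / v)"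
            using v by (intro ennreal_mult) auto
          ultimately have "ennreal (1 / 2) * ennreal (1 / v) \<le> Phi v * ennreal (v powr (a - 1))"
            by (simp only:)
          then show ?thesis using True by simp
        qed simp
      qed
      finally have L: "ennreal (ln r / 2) \<le> (\<integral>\<^sup>+v. Phi v * ennreal (v powr (a - 1)) * indicator {1..r} v \<partial>lborel)" .
      have "ennreal c * (ennreal (r powr (- a)) * ennreal (ln r / 2)) \<le>
        ennreal c * (ennreal (r powr (- a)) * (\<integral>\<^sup>+v. Phi v * ennreal (v powr (a - 1)) * indicator {1..r} v \<partial>lborel))"
        by (intro mult_left_mono L) auto
      also have "\<dots> = ennreal c * (\<integral>\<^sup>+s. Phi (r * s) * ennreal (s powr (a - 1)) * indicator {1..r} (r * s) \<partial>lborel)"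
        using r1 by (subst Mellin_scale) auto
      also have "\<dots> \<le> ennreal c * (\<integral>\<^sup>+s. Phi (r * s) * ennreal (s powr (a - 1)) * indicator {0<..1} s \<partial>lborel)"
      proof (rule mult_left_mono, rule nn_integral_mono)
        fix s :: real
        have "s > 0" if "1 \<le> r * s"
        proof (rule ccontr)
          assume "\<not> s > 0"
          then have "r * s \<le> 0" using r1 by (intro mult_nonneg_nonpos) auto
          then show False using that by simp
        qed
        then show "Phi (r * s) * ennreal (s powr (a - 1)) * indicator {1..r} (r * s) \<le>
            Phi (r * s) * ennreal (s powr (a - 1)) * indicator {0<..1} s"
          using r1 by (auto simp: indicator_def)
      qed auto
      also have "(\<integral>\<^sup>+s. Phi (r * s) * ennreal (s powr (a - 1)) * indicator {0<..1} s \<partial>lborel) =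
          (\<integral>\<^sup>+s. Phi (r * s) * ennreal (s powr (a - 1)) * indicator {0<..<1} s \<partial>lborel)"
        by (intro nn_integral_cong_AE AE_I[where N="{1}"]) (auto simp: indicator_def)
      also have "ennreal c * \<dots> \<le> ?Q"
        unfolding c_def by (rule nn_integral_beta_lower[OF a]) measurable
      finally show "ennreal c * (ennreal (r powr (- a)) * ennreal (ln r / 2)) \<le> ?Q" .
    qed simp
    finally have "(\<integral>\<^sup>+s. N (r * s) \<partial>beta_measure a) \<le> ennreal (e / 2) * ?Q + ennreal (e / 2) * ?Q"
      by (auto simp: add_left_mono)
    also have "\<dots> = ennreal e * ?Q"
      using e by (simp add: distrib_right[symmetric] ennreal_plus[symmetric] del: ennreal_plus)
    finally show ?thesis .
  qed
  moreover have "R' > 0" by (simp add: R'_def)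
  ultimately show ?thesis by blast
qed

text \<open>Induction over the factors; the measurability and the lower bound for \<open>Phi\<close> are what the next step
of the induction consumes.\<close>

lemma prod_measure_negligible:
  assumes "\<And>a. a \<in> set as \<Longrightarrow> al \<le> a \<and> a < 1" "0 < al"
    and w: "Mellin_finite w" and supp: "\<And>v. v \<ge> R0 \<Longrightarrow> w v = 0"
  defines "N \<equiv> \<lambda>r. \<integral>\<^sup>+s. w (r * s) \<partial>prod_measure as"
    and "Phi \<equiv> \<lambda>r. \<integral>\<^sup>+s. ennreal ((1 + r * s) powr (- al)) \<partial>prod_measure as"
  shows "Mellin_finite N \<and> Phi \<in> borel_measurable borel \<and> (\<forall>r\<ge>0. ennreal ((1 + r) powr (- al)) \<le> Phi r) \<and>
    (\<forall>e>0. \<exists>R>0. \<forall>r\<ge>R. N r \<le> ennreal e * Phi r)"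
  using assms(1) unfolding N_def Phi_def
proof (induction as)
  case Nil
  have wm: "w \<in> borel_measurable borel" using w by (simp add: Mellin_finite_def)
  have "(\<integral>\<^sup>+s. w (r * s) \<partial>prod_measure []) = w r" for r
    using wm by (simp add: nn_integral_return)
  moreover have "(\<integral>\<^sup>+s. ennreal ((1 + r * s) powr (- al)) \<partial>prod_measure []) = ennreal ((1 + r) powr (- al))" for r
    by (simp add: nn_integral_return)
  ultimately show ?case using w supp by (auto intro!: exI[of _ "max R0 1"])
next
  case (Cons a as)
  have a: "0 < a" "a < 1" "al \<le> a" using Cons.prems[of a] assms(2) by auto
  interpret A: unit_measure "beta_measure a" using a by (intro unit_measure_beta) auto
  interpret B: unit_measure "prod_measure as"
    using Cons.prems assms(2) by (intro unit_measure_prod_measure) fastforce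
  interpret unit_measure_pair "beta_measure a" "prod_measure as" ..
  let ?N = "\<lambda>r. \<integral>\<^sup>+s. w (r * s) \<partial>prod_measure as"
  let ?P = "\<lambda>r. \<integral>\<^sup>+s. ennreal ((1 + r * s) powr (- al)) \<partial>prod_measure as"
  have IH: "Mellin_finite ?N" "?P \<in> borel_measurable borel" "\<And>r. r \<ge> 0 \<Longrightarrow> ennreal ((1 + r) powr (- al)) \<le> ?P r"
    "\<And>e. e > 0 \<Longrightarrow> \<exists>R>0. \<forall>r\<ge>R. ?N r \<le> ennreal e * ?P r"
    using Cons by auto
  have [measurable]: "w \<in> borel_measurable borel" using w by (simp add: Mellin_finite_def)
  have N: "(\<integral>\<^sup>+s. w (r * s) \<partial>prod_measure (a # as)) = (\<integral>\<^sup>+s. ?N (r * s) \<partial>beta_measure a)" for r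
    by (simp add: nn_integral_mult_conv mult.assoc)
  have P: "(\<integral>\<^sup>+s. ennreal ((1 + r * s) powr (- al)) \<partial>prod_measure (a # as)) = (\<integral>\<^sup>+s. ?P (r * s) \<partial>beta_measure a)" for r
    by (simp add: nn_integral_mult_conv mult.assoc)
  have low: "ennreal ((1 + r) powr (- al)) \<le> (\<integral>\<^sup>+s. ?P (r * s) \<partial>beta_measure a)" if "r \<ge> 0" for r
  proof -
    have "ennreal ((1 + r) powr (- al)) = (\<integral>\<^sup>+s. ennreal ((1 + r) powr (- al)) \<partial>beta_measure a)"
      using A.emeasure_space_1 by simp
    also have "\<dots> \<le> (\<integral>\<^sup>+s. ?P (r * s) \<partial>beta_measure a)"
    proof (intro nn_integral_mono_AE AE_beta_measure)
      fix s :: real assume s: "0 < s" "s < 1"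
      have "(1 + r) powr (- al) \<le> (1 + r * s) powr (- al)"
        using s that assms(2) by (intro powr_mono2') (auto simp: mult_left_le add_pos_nonneg)
      then show "ennreal ((1 + r) powr (- al)) \<le> ?P (r * s)"
        using IH(3)[of "r * s"] s that by (meson ennreal_leI order_trans mult_nonneg_nonneg less_imp_le)
    qed
    finally show ?thesis .
  qed
  show ?case
    unfolding N P
    using Mellin_finite_beta_average[OF a(1,2) IH(1)] beta_average_measurable[OF a(1,2) IH(2)] low
      beta_average_negligible[OF a(1,2) assms(2) a(3) IH]
    by blast
qed

lemma nn_integral_powr_finite:
  assumes "p > 0"
  shows "(\<integral>\<^sup>+v. ennreal (v powr (p - 1)) * indicator {0<..<R} v \<partial>lborel) < \<infinity>"
proof -
  have "((\<lambda>v. v powr (p - 1)) has_integral (max R 0 powr (p - 1 + 1) / (p - 1 + 1))) {0..max R 0}"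
    by (rule has_integral_powr_from_0) (use assms in auto)
  from nn_integral_has_integral_lebesgue[OF _ this]
  have fin: "(\<integral>\<^sup>+v. ennreal (indicator {0..max R 0} v * v powr (p - 1)) \<partial>lborel) < \<infinity>"
    by simp
  have "(\<integral>\<^sup>+v. ennreal (v powr (p - 1)) * indicator {0<..<R} v \<partial>lborel) \<le>
        (\<integral>\<^sup>+v. ennreal (indicator {0..max R 0} v * v powr (p - 1)) \<partial>lborel)"
    by (intro nn_integral_mono) (auto simp: indicator_def)
  then show ?thesis using fin by (rule le_less_trans)
qed

lemma nn_integral_powr_dist_1_finite:
  assumes "p > 0"
  shows "(\<integral>\<^sup>+v. ennreal (\<bar>1 - v\<bar> powr (p - 1)) * indicator {0<..<R} v \<partial>lborel) < \<infinity>"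
proof -
  define R' where "R' = max R 2"
  let ?g = "\<lambda>v. ennreal (v powr (p - 1)) * indicator {0<..<R'} v"
  have "(\<integral>\<^sup>+v. ennreal (\<bar>1 - v\<bar> powr (p - 1)) * indicator {0<..<R} v \<partial>lborel) =
    ennreal \<bar>1\<bar> * (\<integral>\<^sup>+v. ennreal (\<bar>1 - (1 + 1 * v)\<bar> powr (p - 1)) * indicator {0<..<R} (1 + 1 * v) \<partial>lborel)"
    by (rule nn_integral_real_affine) auto
  also have "\<dots> \<le> ennreal \<bar>1\<bar> * (\<integral>\<^sup>+v. ?g v + ?g (0 + (-1) * v) \<partial>lborel)"
    by (intro mult_left_mono nn_integral_mono) (auto simp: indicator_def R'_def)
  also have "\<dots> = (\<integral>\<^sup>+v. ?g v \<partial>lborel) + (\<integral>\<^sup>+v. ?g (0 + (-1) * v) \<partial>lborel)"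
    by (simp only: abs_one ennreal_1 mult_1_left) (rule nn_integral_add; measurable)
  also have "(\<integral>\<^sup>+v. ?g (0 + (-1) * v) \<partial>lborel) = (\<integral>\<^sup>+v. ?g v \<partial>lborel)"
    by (subst (2) nn_integral_real_affine[where c="-1" and t=0]) auto
  also have "(\<integral>\<^sup>+v. ?g v \<partial>lborel) + (\<integral>\<^sup>+v. ?g v \<partial>lborel) < \<infinity>"
    using nn_integral_powr_finite[OF assms, of R'] by simp
  finally show ?thesis .
qed

lemma Mellin_finite_weight:
  assumes "C \<ge> 0" "D \<ge> 0" "0 < al" "al < 1"
  shows "Mellin_finite (\<lambda>v. ennreal (C * (1 + \<bar>ln v\<bar>) + D * \<bar>1 - v\<bar> powr (- al)) * indicator {0<..<R0} v)"
  unfolding Mellin_finite_def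
proof (intro conjI allI impI)
  fix b R :: real assume b: "b > 0"
  define d where "d = b / 2"
  have d: "d > 0" using b by (simp add: d_def)
  define E where "E = (1 / 2) powr (b - 1) + R powr (b - 1)"
  have E0: "E \<ge> 0" by (simp add: E_def)
  define A1 where "A1 = C * (1 + \<bar>R\<bar>) + 2 * D"
  define A2 where "A2 = C / d"
  define A3 where "A3 = D * E"
  have A0: "A1 \<ge> 0" "A2 \<ge> 0" "A3 \<ge> 0" using assms d E0 by (auto simp: A1_def A2_def A3_def)
  let ?I = "indicator {0<..<R} :: real \<Rightarrow> ennreal"
  have "(\<integral>\<^sup>+v. ennreal (C * (1 + \<bar>ln v\<bar>) + D * \<bar>1 - v\<bar> powr (- al)) * indicator {0<..<R0} v * ennreal (v powr (b - 1)) * ?I v \<partial>lborel)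
    \<le> (\<integral>\<^sup>+v. ennreal A1 * (ennreal (v powr (b - 1)) * ?I v)
           + ennreal A2 * (ennreal (v powr (d - 1)) * ?I v)
           + ennreal A3 * (ennreal (\<bar>1 - v\<bar> powr (1 - al - 1)) * ?I v) \<partial>lborel)"
  proof (rule nn_integral_mono)
    fix v :: real
    show "ennreal (C * (1 + \<bar>ln v\<bar>) + D * \<bar>1 - v\<bar> powr (- al)) * indicator {0<..<R0} v * ennreal (v powr (b - 1)) * ?I v
      \<le> ennreal A1 * (ennreal (v powr (b - 1)) * ?I v)
           + ennreal A2 * (ennreal (v powr (d - 1)) * ?I v)
           + ennreal A3 * (ennreal (\<bar>1 - v\<bar> powr (1 - al - 1)) * ?I v)"
    proof (cases "v \<in> {0<..<R}")
      case True
      then have v: "0 < v" "v < R" by auto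
      have "1 + \<bar>ln v\<bar> \<le> (1 + \<bar>R\<bar>) + v powr (- d) / d"
      proof (cases "v < 1")
        case True
        then show ?thesis using abs_ln_le_powr[OF v(1) True d] by simp
      next
        case False
        then have "\<bar>ln v\<bar> \<le> v" using ln_le_minus_one[of v] v by simp
        moreover have "v powr (- d) / d \<ge> 0" using d by simp
        ultimately show ?thesis using v by linarith
      qed
      then have "C * (1 + \<bar>ln v\<bar>) * v powr (b - 1) \<le> C * ((1 + \<bar>R\<bar>) + v powr (- d) / d) * v powr (b - 1)"
        using assms by (intro mult_right_mono mult_left_mono) auto
      also have "\<dots> = C * (1 + \<bar>R\<bar>) * v powr (b - 1) + C / d * v powr (d - 1)"
      proof -
        have "v powr (- d) * v powr (b - 1) = v powr (d - 1)" by (simp add: d_def flip: powr_add)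
        then show ?thesis by (simp add: distrib_left distrib_right)
      qed
      finally have 1: "C * (1 + \<bar>ln v\<bar>) * v powr (b - 1) \<le> C * (1 + \<bar>R\<bar>) * v powr (b - 1) + C / d * v powr (d - 1)" .
      have "\<bar>1 - v\<bar> powr (- al) * v powr (b - 1) \<le> 2 * v powr (b - 1) + E * \<bar>1 - v\<bar> powr (- al)"
      proof (cases "v < 1 / 2")
        case True
        have "\<bar>1 - v\<bar> powr (- al) \<le> (1 / 2) powr (- al)" using True assms by (intro powr_mono2') auto
        also have "\<dots> \<le> (1 / 2) powr (- 1)" using assms by (intro powr_mono') auto
        finally have "\<bar>1 - v\<bar> powr (- al) \<le> 2" by (simp add: powr_minus_divide)
        then have "\<bar>1 - v\<bar> powr (- al) * v powr (b - 1) \<le> 2 * v powr (b - 1)" by (intro mult_right_mono) auto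
        then show ?thesis by (simp add: E_def add_increasing2)
      next
        case False
        have "v powr (b - 1) \<le> E"
        proof (cases "b \<ge> 1")
          case True
          then have "v powr (b - 1) \<le> R powr (b - 1)" using v by (intro powr_mono2) auto
          then show ?thesis by (simp add: E_def add_increasing)
        next
          case False
          then have "v powr (b - 1) \<le> (1 / 2) powr (b - 1)" using \<open>\<not> v < 1 / 2\<close> by (intro powr_mono2') auto
          then show ?thesis by (simp add: E_def add_increasing2)
        qed
        then have "\<bar>1 - v\<bar> powr (- al) * v powr (b - 1) \<le> \<bar>1 - v\<bar> powr (- al) * E" by (intro mult_left_mono) auto
        then show ?thesis by (simp add: mult.commute add_increasing)
      qed
      then have 2: "D * (\<bar>1 - v\<bar> powr (- al) * v powr (b - 1)) \<le> D * (2 * v powr (b - 1) + E * \<bar>1 - v\<bar> powr (- al))"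
        using assms by (intro mult_left_mono) auto
      have "(C * (1 + \<bar>ln v\<bar>) + D * \<bar>1 - v\<bar> powr (- al)) * v powr (b - 1) \<le>
         A1 * v powr (b - 1) + A2 * v powr (d - 1) + A3 * \<bar>1 - v\<bar> powr (1 - al - 1)"
        using 1 2 by (simp add: algebra_simps A1_def A2_def A3_def)
      then have "ennreal ((C * (1 + \<bar>ln v\<bar>) + D * \<bar>1 - v\<bar> powr (- al)) * v powr (b - 1)) \<le>
         ennreal (A1 * v powr (b - 1) + A2 * v powr (d - 1) + A3 * \<bar>1 - v\<bar> powr (1 - al - 1))"
        by (rule ennreal_leI)
      also have "\<dots> = ennreal A1 * ennreal (v powr (b - 1)) + ennreal A2 * ennreal (v powr (d - 1))
          + ennreal A3 * ennreal (\<bar>1 - v\<bar> powr (1 - al - 1))"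
        using A0 by (simp add: ennreal_plus ennreal_mult)
      finally have "ennreal (C * (1 + \<bar>ln v\<bar>) + D * \<bar>1 - v\<bar> powr (- al)) * ennreal (v powr (b - 1)) \<le> \<dots>"
        using assms by (simp add: ennreal_mult)
      then show ?thesis using True by (auto simp: indicator_def)
    qed simp
  qed
  also have "\<dots> = ennreal A1 * (\<integral>\<^sup>+v. ennreal (v powr (b - 1)) * ?I v \<partial>lborel)
      + ennreal A2 * (\<integral>\<^sup>+v. ennreal (v powr (d - 1)) * ?I v \<partial>lborel)
      + ennreal A3 * (\<integral>\<^sup>+v. ennreal (\<bar>1 - v\<bar> powr (1 - al - 1)) * ?I v \<partial>lborel)"
    by (simp add: nn_integral_add nn_integral_cmult)
  also have "\<dots> < \<infinity>"
    using nn_integral_powr_finite[OF b, of R] nn_integral_powr_finite[OF d, of R]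
      nn_integral_powr_dist_1_finite[of "1 - al" R] assms
    by (auto simp: ennreal_mult_less_top simp del: ennreal_plus)
  finally show "(\<integral>\<^sup>+v. ennreal (C * (1 + \<bar>ln v\<bar>) + D * \<bar>1 - v\<bar> powr (- al)) * indicator {0<..<R0} v * ennreal (v powr (b - 1)) * ?I v \<partial>lborel) < \<infinity>" .
qed measurable

text \<open>The value \<open>\<infinity>\<close> at one point allows a weight to dominate a function that is unbounded there.\<close>

lemma Mellin_finite_update:
  assumes "Mellin_finite w"
  shows "Mellin_finite (\<lambda>v. if v = c then \<top> else w v)"
proof -
  have [measurable]: "w \<in> borel_measurable borel" using assms by (simp add: Mellin_finite_def)
  have "(\<integral>\<^sup>+v. (if v = c then \<top> else w v) * ennreal (v powr (b - 1)) * indicator {0<..<R} v \<partial>lborel) =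
        (\<integral>\<^sup>+v. w v * ennreal (v powr (b - 1)) * indicator {0<..<R} v \<partial>lborel)" for b R
    by (intro nn_integral_cong_AE AE_I[where N="{c}"]) auto
  then show ?thesis using assms by (simp add: Mellin_finite_def)
qed

lemma (in unit_measure) log_transform_bound:
  obtains C where "C > 0" "\<And>x. x \<notin> \<real>\<^sub>\<le>\<^sub>0 \<Longrightarrow> norm (log_transform x) \<le> C * (1 + \<bar>ln (norm x)\<bar>)"
proof -
  obtain C where C: "C > 0" "\<And>x t. x \<notin> \<real>\<^sub>\<le>\<^sub>0 \<Longrightarrow> 0 < t \<Longrightarrow>
     norm (log_kernel (x * of_real t)) \<le> C * (1 + \<bar>ln (norm x)\<bar> + \<bar>ln t\<bar>)"
    using log_kernel_scaled_bound by metis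
  define E where "E = (LINT t|M. \<bar>ln t\<bar>)"
  have E: "E \<ge> 0" unfolding E_def by (rule integral_nonneg_AE) simp
  show ?thesis
  proof (rule that[of "C * (1 + E)"])
    fix x :: complex assume x: "x \<notin> \<real>\<^sub>\<le>\<^sub>0"
    have "norm (log_transform x) \<le> (LINT t|M. norm (log_kernel (x * of_real t)))"
      unfolding log_transform_def by (rule integral_norm_bound)
    also have "\<dots> \<le> (LINT t|M. C * (1 + \<bar>ln (norm x)\<bar> + \<bar>ln t\<bar>))"
    proof (rule integral_mono_AE)
      show "AE t in M. norm (log_kernel (x * of_real t)) \<le> C * (1 + \<bar>ln (norm x)\<bar> + \<bar>ln t\<bar>)"
        using supp
      proof eventually_elim
        case (elim t)
        show ?case by (rule C(2)[OF x]) (use elim in simp)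
      qed
    qed (use integrable_log_kernel[OF x] int_ln in auto)
    also have "\<dots> = C * (1 + \<bar>ln (norm x)\<bar> + E)"
      using int_ln prob_space by (simp add: E_def)
    also have "\<dots> \<le> C * (1 + E) * (1 + \<bar>ln (norm x)\<bar>)"
      using C E by (simp add: algebra_simps)
    finally show "norm (log_transform x) \<le> C * (1 + E) * (1 + \<bar>ln (norm x)\<bar>)" .
  qed (use C E in auto)
qed

text \<open>Both transforms average those of the first factor.  The deviation \<open>K\<^sub>1 - \<kappa> F\<^sub>1\<close> is a small multiple of
\<open>(1 + |x|)^(-al)\<close> for large \<open>|x|\<close> and is bounded by a weight of the class above otherwise, hence its
average is small compared with \<open>P = \<integral> (1 + |x| t)^(-al)\<close>.  On the other hand \<open>|F| \<ge> P / 2\<close>: since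
\<open>al \<le> 1/2\<close>, all values of \<open>F\<^sub>1\<close> lie in the first quadrant and cannot cancel.\<close>

lemma log_transform_div_stieltjes_tendsto:
  assumes al: "0 < al" "al \<le> 1/2" and as: "\<And>a. a \<in> set as \<Longrightarrow> al \<le> a \<and> a < 1" and e: "e > 0"
  obtains R where "\<And>x. Im x > 0 \<Longrightarrow> norm x \<ge> R \<Longrightarrow>
    norm (unit_measure.log_transform (prod_measure (al # as)) x / unit_measure.stieltjes (prod_measure (al # as)) x
      + of_real (pi / sin (pi * al)) * exp (- \<i> * pi * al)) \<le> e"
proof -
  interpret A: beta_parameter al using al by unfold_locales auto
  interpret B: unit_measure "prod_measure as"
    using al as by (intro unit_measure_prod_measure) fastforce
  interpret unit_measure_pair "beta_measure al" "prod_measure as" ..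
  interpret M: unit_measure "prod_measure (al # as)" using unit_measure_mult_conv by simp
  define k where "k = complex_of_real (pi / sin (pi * al)) * exp (- \<i> * pi * al)"
  define dev where "dev x = A.log_transform x + k * A.stieltjes x" for x
  \<comment> \<open>The factor \<open>3^al\<close> comes from \<open>|x - 1| \<ge> (1 + |x|) / 3\<close>, and a quarter of \<open>e\<close> is used for each of the
    two parts of the average because of the factor \<open>2\<close> lost in the lower bound for \<open>|F|\<close>.\<close>
  define e' where "e' = e / (4 * 3 powr al)"
  have e': "e' > 0" using e by (simp add: e'_def)
  obtain R1 where R1: "R1 > 2" "\<And>x. Im x > 0 \<Longrightarrow> norm (x - 1) \<ge> R1 \<Longrightarrow>
      norm (A.transfer_factor x + of_real (pi / sin (pi * al))) \<le> e'"
    using A.transfer_factor_tendsto[OF e'] by blast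
  obtain C where C: "C > 0" "\<And>x. x \<notin> \<real>\<^sub>\<le>\<^sub>0 \<Longrightarrow> norm (A.log_transform x) \<le> C * (1 + \<bar>ln (norm x)\<bar>)"
    using A.log_transform_bound by blast
  define R0 where "R0 = R1 + 1"
  define w where "w v = (if v = 1 then \<top> else ennreal (C * (1 + \<bar>ln v\<bar>) + norm k * \<bar>1 - v\<bar> powr (- al)) * indicator {0<..<R0} v)" for v
  have wM: "Mellin_finite w"
    unfolding w_def using C al by (intro Mellin_finite_update Mellin_finite_weight) auto
  have norm_F1: "norm (A.stieltjes x) = norm (1 - x) powr (- al)" if "x \<in> cut_plane" for x
    using A.stieltjes_beta[OF that] by (simp add: norm_powr_real_powr')
  have dev_bound: "ennreal (norm (dev x)) \<le> ennreal (e' * 3 powr al) * ennreal ((1 + norm x) powr (- al)) + w (norm x)"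
    if x: "Im x > 0" for x
  proof (cases "norm x < R0")
    case True
    have xc: "x \<in> cut_plane" and xn: "x \<notin> \<real>\<^sub>\<le>\<^sub>0" and x0: "x \<noteq> 0" using x by (auto simp: complex_nonpos_Reals_iff)
    show ?thesis
    proof (cases "norm x = 1")
      case False
      have "\<bar>1 - norm x\<bar> \<le> norm (1 - x)" using norm_triangle_ineq3[of 1 x] by simp
      then have "norm (1 - x) powr (- al) \<le> \<bar>1 - norm x\<bar> powr (- al)"
        using al False by (intro powr_mono2') auto
      then have "norm (dev x) \<le> C * (1 + \<bar>ln (norm x)\<bar>) + norm k * \<bar>1 - norm x\<bar> powr (- al)"
        unfolding dev_def using C(2)[OF xn] norm_F1[OF xc]
        by (intro norm_triangle_le add_mono) (auto simp: norm_mult mult_left_mono)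
      then have "ennreal (norm (dev x)) \<le> w (norm x)"
        using False x0 \<open>norm x < R0\<close> by (auto simp: w_def ennreal_leI)
      then show ?thesis by (simp add: add_increasing)
    qed (simp add: w_def)
  next
    case False
    then have r: "norm x \<ge> R1 + 1" by (simp add: R0_def)
    have "norm x - 1 \<le> norm (x - 1)" using norm_triangle_ineq2[of x 1] by simp
    then have x1: "norm (x - 1) \<ge> R1" and x2: "norm (x - 1) \<ge> (1 + norm x) / 3"
      using r R1(1) by (linarith, simp add: field_simps)
    have "norm (dev x) = norm (x - 1) powr (- al) * norm (A.transfer_factor x + of_real (pi / sin (pi * al)))"
      unfolding dev_def k_def A.log_transform_minus_stieltjes[OF x] by (simp add: norm_mult norm_powr_real_powr')
    also have "\<dots> \<le> ((1 + norm x) / 3) powr (- al) * e'"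
      using x1 x2 e' x al r by (intro mult_mono powr_mono2' R1(2)) (auto intro: add_pos_nonneg)
    also have "\<dots> = e' * 3 powr al * (1 + norm x) powr (- al)"
      using norm_ge_zero[of x] by (simp add: powr_divide powr_minus field_simps)
    finally have "ennreal (norm (dev x)) \<le> ennreal (e' * 3 powr al) * ennreal ((1 + norm x) powr (- al))"
      using e' by (simp add: ennreal_mult[symmetric] ennreal_leI)
    then show ?thesis by (simp add: add_increasing2)
  qed
  define N where "N r = (\<integral>\<^sup>+t. w (r * t) \<partial>prod_measure as)" for r
  define Phi where "Phi r = (\<integral>\<^sup>+t. ennreal ((1 + r * t) powr (- al)) \<partial>prod_measure as)" for r
  have [measurable]: "w \<in> borel_measurable borel" using wM by (simp add: Mellin_finite_def)
  have "R0 > 1" using R1 by (simp add: R0_def)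
  then have w0: "w v = 0" if "v \<ge> R0" for v using that by (auto simp: w_def)
  have "\<forall>e>0. \<exists>R>0. \<forall>r\<ge>R. N r \<le> ennreal e * Phi r"
    unfolding N_def Phi_def
    using prod_measure_negligible[where as=as and al=al and w=w, OF as al(1) wM w0] by blast
  moreover have "e' * 3 powr al > 0" using e' by simp
  ultimately obtain R where R: "R > 0" "\<And>r. r \<ge> R \<Longrightarrow> N r \<le> ennreal (e' * 3 powr al) * Phi r"
    by blast
  show ?thesis
  proof (rule that[of R])
    fix x :: complex assume x: "Im x > 0" "norm x \<ge> R"
    have xc: "x \<in> cut_plane" and xn: "x \<notin> \<real>\<^sub>\<le>\<^sub>0" using x by (auto simp: complex_nonpos_Reals_iff)
    let ?r = "norm x"
    have Phi_fin: "integrable (prod_measure as) (\<lambda>t. (1 + ?r * t) powr (- al))"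
    proof (rule B.integrable_const_bound[of _ 1])
      show "AE t in prod_measure as. norm ((1 + ?r * t) powr (- al)) \<le> 1"
        using B.supp
      proof eventually_elim
        case (elim t)
        then have "(1 + ?r * t) powr (- al) \<le> 1 powr (- al)" using al by (intro powr_mono2') auto
        then show ?case by simp
      qed
    qed measurable
    define P where "P = (LINT t|prod_measure as. (1 + ?r * t) powr (- al))"
    have Phi: "Phi ?r = ennreal P"
      unfolding Phi_def P_def using Phi_fin by (intro nn_integral_eq_integral) auto
    have F: "M.stieltjes x = (LINT t|prod_measure as. A.stieltjes (x * of_real t))"
      and Fint: "integrable (prod_measure as) (\<lambda>t. A.stieltjes (x * of_real t))"
      using integral_mult_conv[of "\<lambda>u. 1 / (1 - x * of_real u)"] M.integrable_stieltjes[OF xc]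
      unfolding M.stieltjes_def by (simp_all add: A.stieltjes_def mult_ac)
    have K: "M.log_transform x = (LINT t|prod_measure as. A.log_transform (x * of_real t))"
      and Kint: "integrable (prod_measure as) (\<lambda>t. A.log_transform (x * of_real t))"
      using integral_mult_conv[of "\<lambda>u. log_kernel (x * of_real u)"] M.integrable_log_kernel[OF xn]
      unfolding M.log_transform_def by (simp_all add: A.log_transform_def mult_ac)
    have dev_int: "integrable (prod_measure as) (\<lambda>t. dev (x * of_real t))"
      unfolding dev_def using Fint Kint by simp
    have dev_eq: "M.log_transform x + k * M.stieltjes x = (LINT t|prod_measure as. dev (x * of_real t))"
      unfolding F K dev_def using Fint Kint by simp
    have "ennreal (norm (M.log_transform x + k * M.stieltjes x)) \<le> (\<integral>\<^sup>+t. ennreal (norm (dev (x * of_real t))) \<partial>prod_measure as)"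
      unfolding dev_eq by (rule integral_norm_bound_ennreal[OF dev_int])
    also have "\<dots> \<le> (\<integral>\<^sup>+t. ennreal (e' * 3 powr al) * ennreal ((1 + ?r * t) powr (- al)) + w (?r * t) \<partial>prod_measure as)"
    proof (rule nn_integral_mono_AE)
      show "AE t in prod_measure as. ennreal (norm (dev (x * of_real t))) \<le>
          ennreal (e' * 3 powr al) * ennreal ((1 + ?r * t) powr (- al)) + w (?r * t)"
        using B.supp
      proof eventually_elim
        case (elim t)
        then show ?case using dev_bound[of "x * of_real t"] x by (simp add: norm_mult)
      qed
    qed
    also have "\<dots> = ennreal (e' * 3 powr al) * Phi ?r + N ?r"
      by (simp add: nn_integral_add nn_integral_cmult Phi_def N_def)
    also have "\<dots> \<le> ennreal (e' * 3 powr al) * Phi ?r + ennreal (e' * 3 powr al) * Phi ?r"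
      by (intro add_left_mono R x)
    also have "\<dots> = ennreal (e / 2 * P)"
    proof -
      have P0: "P \<ge> 0" unfolding P_def by (rule integral_nonneg_AE) simp
      have "e' * 3 powr al = e / 4" by (simp add: e'_def)
      then have "ennreal (e' * 3 powr al) * Phi ?r = ennreal (e / 4 * P)"
        unfolding Phi using e P0 by (subst ennreal_mult[symmetric]) (auto simp: e'_def)
      then show ?thesis using e P0 by (simp flip: ennreal_plus)
    qed
    finally have num: "norm (M.log_transform x + k * M.stieltjes x) \<le> e / 2 * P"
      by (rule ennreal_le_iff[THEN iffD1, rotated])
         (use e in \<open>auto simp: P_def intro!: mult_nonneg_nonneg integral_nonneg_AE\<close>)
    have "P \<le> (LINT t|prod_measure as. Re (A.stieltjes (x * of_real t)) + Im (A.stieltjes (x * of_real t)))"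
      unfolding P_def
    proof (rule integral_mono_AE[OF Phi_fin])
      show "AE t in prod_measure as. (1 + ?r * t) powr (- al) \<le> Re (A.stieltjes (x * of_real t)) + Im (A.stieltjes (x * of_real t))"
        using B.supp
      proof eventually_elim
        case (elim t)
        let ?y = "x * of_real t"
        have y: "Im ?y > 0" "norm ?y = ?r * t" using elim x by (auto simp: norm_mult)
        then have yc: "?y \<in> cut_plane" by (metis ComplI Im_complex_of_real imageE less_irrefl)
        have "?y \<noteq> 1" using y(1) by (metis less_irrefl one_complex.sel(2))
        then have y1: "1 - ?y \<noteq> 0" by simp
        have "norm (1 - ?y) \<le> 1 + ?r * t" using norm_triangle_ineq4[of 1 ?y] y by simp
        then have "(1 + ?r * t) powr (- al) \<le> norm (1 - ?y) powr (- al)"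
          using y1 al by (intro powr_mono2') auto
        also have "\<dots> = norm (A.stieltjes ?y)" by (rule norm_F1[OF yc, symmetric])
        also have "\<dots> \<le> \<bar>Re (A.stieltjes ?y)\<bar> + \<bar>Im (A.stieltjes ?y)\<bar>" by (rule cmod_le)
        also have "\<bar>Im (A.stieltjes ?y)\<bar> = Im (A.stieltjes ?y)" using A.Im_stieltjes_pos[OF y(1)] by simp
        also have "\<bar>Re (A.stieltjes ?y)\<bar> = Re (A.stieltjes ?y)"
        proof -
          have "Im (1 - ?y) < 0" using y by simp
          then have nn: "1 - ?y \<notin> \<real>\<^sub>\<le>\<^sub>0" by (metis complex_nonpos_Reals_iff less_irrefl)
          have "\<bar>Im (Ln (1 - ?y))\<bar> < pi"
            using Im_Ln_less_pi[OF nn] mpi_less_Im_Ln[OF y1] by linarith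
          then have "\<bar>al * Im (Ln (1 - ?y))\<bar> \<le> pi / 2"
            using al mult_mono[of al "1/2" "\<bar>Im (Ln (1 - ?y))\<bar>" pi] by (simp add: abs_mult)
          then have "cos (al * Im (Ln (1 - ?y))) \<ge> 0" by (intro cos_ge_zero) auto
          then have "Re (A.stieltjes ?y) \<ge> 0"
            unfolding A.stieltjes_beta[OF yc] using y1 by (simp add: powr_def Re_exp)
          then show ?thesis by simp
        qed
        finally show ?case .
      qed
    qed (use Fint in auto)
    also have "\<dots> = Re (M.stieltjes x) + Im (M.stieltjes x)"
      unfolding F using Fint by simp
    also have "\<dots> \<le> 2 * norm (M.stieltjes x)"
      using complex_Re_le_cmod[of "M.stieltjes x"] abs_Im_le_cmod[of "M.stieltjes x"] by linarith
    finally have den: "P \<le> 2 * norm (M.stieltjes x)" .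
    have F0: "M.stieltjes x \<noteq> 0" by (rule M.stieltjes_nonzero[OF xc])
    have "e / 2 * P \<le> e / 2 * (2 * norm (M.stieltjes x))" using e den by (intro mult_left_mono) auto
    then have "norm (M.log_transform x + k * M.stieltjes x) \<le> e * norm (M.stieltjes x)" using num by simp
    then have "norm ((M.log_transform x + k * M.stieltjes x) / M.stieltjes x) \<le> e"
      using F0 by (simp add: norm_divide pos_divide_le_eq)
    then show "norm (M.log_transform x / M.stieltjes x + of_real (pi / sin (pi * al)) * exp (- \<i> * pi * al)) \<le> e"
      using F0 by (simp add: k_def add_divide_distrib)
  qed
qed

section \<open>The density at the right end point\<close>

text \<open>The exponent \<open>g\<close> and the analytic factor \<open>G\<close> describe the density at its right end point, in the variable
\<open>v = 1 - t\<close>.\<close>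

definition edge_density :: "real \<Rightarrow> (complex \<Rightarrow> complex) \<Rightarrow> real \<Rightarrow> real" where
  "edge_density g G t = indicator {0<..<1} t * ((1 - t) powr g * Re (G (of_real (1 - t))))"

definition has_edge_density :: "real measure \<Rightarrow> real \<Rightarrow> (complex \<Rightarrow> complex) \<Rightarrow> bool" where
  "has_edge_density M g G \<longleftrightarrow> g > -1 \<and> G holomorphic_on ball 0 1 \<and> G 0 \<noteq> 0 \<and>
     (\<forall>v. 0 \<le> v \<and> v < 1 \<longrightarrow> G (of_real v) = of_real (Re (G (of_real v))) \<and> 0 \<le> Re (G (of_real v))) \<and>
     M = density lborel (\<lambda>t. ennreal (edge_density g G t))"

lemma edge_density_measurable [measurable]:
  assumes "G holomorphic_on ball 0 1"
  shows "edge_density g G \<in> borel_measurable borel"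
proof -
  have "continuous_on {0<..<1} (\<lambda>t. G (of_real (1 - t)))"
  proof (rule continuous_on_compose2[OF holomorphic_on_imp_continuous_on[OF assms]])
    show "(\<lambda>t. complex_of_real (1 - t)) ` {0<..<1} \<subseteq> ball 0 1"
    proof
      fix z assume "z \<in> (\<lambda>t. complex_of_real (1 - t)) ` {0<..<1}"
      then obtain t where t: "0 < t" "t < 1" "z = of_real (1 - t)" by auto
      then have "norm z = \<bar>1 - t\<bar>" by (simp only: norm_of_real)
      then show "z \<in> ball 0 1" using t by simp
    qed
  qed (intro continuous_intros)
  then have "continuous_on {0<..<1} (\<lambda>t. (1 - t) powr g * Re (G (of_real (1 - t))))"
    by (intro continuous_intros) auto
  from borel_measurable_continuous_on_indicator[OF _ this]
  show ?thesis by (simp add: edge_density_def[abs_def])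
qed

lemma has_edge_density_beta:
  assumes a: "0 < a" "a < 1"
  shows "has_edge_density (beta_measure a) (- a) (\<lambda>v. (1 - v) powr (of_real a - 1) / of_real (Beta a (1 - a)))"
  unfolding has_edge_density_def
proof (intro conjI allI impI)
  have B: "Beta a (1 - a) > 0" using a by (intro Beta_pos) auto
  have nn: "1 - v \<notin> \<real>\<^sub>\<le>\<^sub>0" if "norm v < 1" for v :: complex
    using that complex_Re_le_cmod[of v] by (auto simp: complex_nonpos_Reals_iff)
  show "(\<lambda>v. (1 - v) powr (of_real a - 1) / of_real (Beta a (1 - a))) holomorphic_on ball 0 1"
    using B nn by (intro holomorphic_intros) auto
  have val: "(1 - complex_of_real v) powr (of_real a - 1) / of_real (Beta a (1 - a)) = of_real ((1 - v) powr (a - 1) / Beta a (1 - a))"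
    if "v < 1" for v
  proof -
    have "(1 - complex_of_real v) powr (of_real a - 1) = complex_of_real (1 - v) powr complex_of_real (a - 1)" by simp
    also have "\<dots> = of_real ((1 - v) powr (a - 1))" using that by (intro powr_of_real) auto
    finally show ?thesis by simp
  qed
  show "(1 - 0) powr (complex_of_real a - 1) / of_real (Beta a (1 - a)) \<noteq> 0" using B by simp
  fix v :: real assume v: "0 \<le> v \<and> v < 1"
  show "(1 - complex_of_real v) powr (of_real a - 1) / of_real (Beta a (1 - a)) =
      of_real (Re ((1 - of_real v) powr (of_real a - 1) / of_real (Beta a (1 - a))))"
    using v by (simp only: val Re_complex_of_real)
  show "0 \<le> Re ((1 - complex_of_real v) powr (of_real a - 1) / of_real (Beta a (1 - a)))"
    using v B by (simp only: val Re_complex_of_real) (simp add: divide_nonneg_pos)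
next
  have val: "Re ((1 - complex_of_real (1 - t)) powr (of_real a - 1) / of_real (Beta a (1 - a))) = t powr (a - 1) / Beta a (1 - a)"
    if "t > 0" for t
  proof -
    have "(1 - complex_of_real (1 - t)) powr (of_real a - 1) = complex_of_real t powr complex_of_real (a - 1)" by simp
    also have "\<dots> = of_real (t powr (a - 1))" using that by (intro powr_of_real) auto
    finally have "(1 - complex_of_real (1 - t)) powr (of_real a - 1) = of_real (t powr (a - 1))" .
    then show ?thesis by (simp only: of_real_divide[symmetric] Re_complex_of_real)
  qed
  have "beta_density a t = edge_density (- a) (\<lambda>v. (1 - v) powr (of_real a - 1) / of_real (Beta a (1 - a))) t" for t
  proof (cases "t \<in> {0<..<1}")
    case True
    then show ?thesis unfolding beta_density_def edge_density_def by (subst val) auto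
  qed (auto simp: beta_density_def edge_density_def)
  then show "beta_measure a = density lborel (\<lambda>t. ennreal (edge_density (- a) (\<lambda>v. (1 - v) powr (of_real a - 1) / of_real (Beta a (1 - a))) t))"
    by (simp add: beta_measure_def)
qed (use a in auto)

lemma ennreal_mult4:
  "0 \<le> x \<Longrightarrow> 0 \<le> y \<Longrightarrow> 0 \<le> z \<Longrightarrow> 0 \<le> w \<Longrightarrow>
    ennreal x * (ennreal y * (ennreal z * ennreal w)) = ennreal (x * (y * (z * w)))"
  by (simp add: ennreal_mult)

text \<open>One multiplication by a further beta variable.  The substitution \<open>s = 1 - v u\<close> in the convolution
integral at \<open>t = 1 - v\<close> splits off the power \<open>v^(g+1-a)\<close>; what remains is an integral over
\<open>u\<close> in \<open>(0, 1)\<close> in which \<open>v\<close> enters analytically.\<close>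

locale edge_step =
  fixes a g :: real and G :: "complex \<Rightarrow> complex"
  assumes a: "0 < a" "a < 1" and g: "g > -1" and G: "G holomorphic_on ball 0 1" "G 0 \<noteq> 0"
    and G_real: "\<And>v. 0 \<le> v \<Longrightarrow> v < 1 \<Longrightarrow> G (of_real v) = of_real (Re (G (of_real v)))"
    and G_nonneg: "\<And>v. 0 \<le> v \<Longrightarrow> v < 1 \<Longrightarrow> 0 \<le> Re (G (of_real v))"
begin

text \<open>The part of the integrand that depends on \<open>v\<close>.\<close>

definition kern :: "complex \<Rightarrow> real \<Rightarrow> complex" where
  "kern v u = (1 - v * of_real u) powr of_real (a - 2 - g) * G (v * (1 - of_real u) / (1 - v * of_real u))"

abbreviation wt :: "real \<Rightarrow> real" where
  "wt u \<equiv> u powr (- a) * (1 - u) powr g"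

abbreviation weight :: "real \<Rightarrow> real" where
  "weight u \<equiv> indicator {0<..<1} u * wt u"

abbreviation integrand :: "complex \<Rightarrow> real \<Rightarrow> complex" where
  "integrand v u \<equiv> indicator {0<..<1} u *\<^sub>R (of_real (wt u) * kern v u)"

definition next_G :: "complex \<Rightarrow> complex" where
  "next_G v = (LINT u|lborel. integrand v u) / of_real (Beta a (1 - a))"

text \<open>The Moebius map \<open>v \<mapsto> v (1 - u) / (1 - v u)\<close> keeps the unit disc invariant, so the analytic factor
of the previous density may be evaluated there.\<close>

lemma arg_ok:
  fixes v :: complex
  assumes "norm v < 1" "0 \<le> u" "u \<le> 1"
  shows "1 - v * of_real u \<notin> \<real>\<^sub>\<le>\<^sub>0" and "norm (v * (1 - of_real u) / (1 - v * of_real u)) < 1"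
    and "1 - v * of_real u \<noteq> 0" and "Re v * u < 1"
proof -
  have le: "norm v * u \<le> norm v * 1" using assms by (intro mult_left_mono) auto
  have "Re (v * of_real u) \<le> norm (v * of_real u)" by (rule complex_Re_le_cmod)
  also have "\<dots> = norm v * u" using assms by (simp add: norm_mult)
  finally have "Re (v * of_real u) \<le> norm v * u" .
  then have "Re (1 - v * of_real u) > 0" using le assms by simp
  then show "Re v * u < 1" by simp
  from \<open>Re (1 - v * of_real u) > 0\<close> show 1: "1 - v * of_real u \<notin> \<real>\<^sub>\<le>\<^sub>0" by (auto simp: complex_nonpos_Reals_iff)
  then show 2: "1 - v * of_real u \<noteq> 0" by auto
  have "norm (v * (1 - of_real u)) = norm v * (1 - u)"
    using assms by (metis abs_of_nonneg diff_ge_0_iff_ge norm_mult norm_of_real of_real_1 of_real_diff)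
  moreover have "norm (1 - v * of_real u) \<ge> 1 - norm v * u"
    using norm_triangle_ineq2[of 1 "v * of_real u"] assms by (simp add: norm_mult)
  moreover have "norm v * (1 - u) < 1 - norm v * u" using assms by (simp add: algebra_simps)
  ultimately have "norm (v * (1 - of_real u)) < norm (1 - v * of_real u)" by linarith
  then show "norm (v * (1 - of_real u) / (1 - v * of_real u)) < 1"
    using 2 by (simp add: norm_divide divide_less_eq)
qed

lemma kern_continuous: "continuous_on (ball 0 1 \<times> {0..1}) (\<lambda>p. kern (fst p) (snd p))"
proof -
  have "continuous_on (ball 0 1 \<times> {0..1}) (\<lambda>p. G (fst p * (1 - of_real (snd p)) / (1 - fst p * of_real (snd p))))"
    by (rule continuous_on_compose2[OF holomorphic_on_imp_continuous_on[OF G(1)]])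
       (use arg_ok in \<open>auto intro!: continuous_intros\<close>)
  then show ?thesis unfolding kern_def
    by (intro continuous_intros) (use arg_ok(3,4) in \<open>force intro!: continuous_intros\<close>)+
qed

lemma kern_bound:
  assumes "r < 1"
  obtains C where "C > 0" "\<And>v u. norm v \<le> r \<Longrightarrow> 0 \<le> u \<Longrightarrow> u \<le> 1 \<Longrightarrow> norm (kern v u) \<le> C"
proof -
  have "compact ((\<lambda>p. kern (fst p) (snd p)) ` (cball 0 r \<times> {0..1}))"
    by (intro compact_continuous_image continuous_on_subset[OF kern_continuous] compact_Times) (use assms in auto)
  then have "bounded ((\<lambda>p. kern (fst p) (snd p)) ` (cball 0 r \<times> {0..1}))" by (rule compact_imp_bounded)
  then obtain C where C: "C > 0" "\<And>p. p \<in> cball 0 r \<times> {0..1} \<Longrightarrow> norm (kern (fst p) (snd p)) \<le> C"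
    unfolding bounded_pos by blast
  show ?thesis
    by (rule that[OF C(1)]) (use C(2)[of "(_, _)"] in auto)
qed

lemma weight_integrable: "integrable lborel (\<lambda>u. weight u)"
  and weight_integral: "(LINT u|lborel. weight u) = Beta (1 - a) (g + 1)"
  using has_bochner_integral_Beta[of "1 - a" "g + 1"] a g by (auto simp: has_bochner_integral_iff)

lemma kern_measurable:
  assumes "norm v < 1"
  shows "(\<lambda>u. integrand v u) \<in> borel_measurable borel"
proof (rule borel_measurable_continuous_on_indicator)
  have "continuous_on {0<..<1} (\<lambda>u. kern (fst (v, u)) (snd (v, u)))"
    by (rule continuous_on_compose2[OF kern_continuous, where f="\<lambda>u. (v, u)"])
       (use assms in \<open>auto intro!: continuous_intros\<close>)
  then show "continuous_on {0<..<1} (\<lambda>u. of_real (wt u) * kern v u)"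
    by (intro continuous_intros) auto
qed simp

lemma integrand_bound:
  assumes "norm (kern v u) \<le> C"
  shows "norm (integrand v u)
     \<le> C * (weight u)"
proof -
  have "norm (integrand v u) =
      (weight u) * norm (kern v u)"
    by (simp add: norm_mult indicator_def)
  also have "\<dots> \<le> (weight u) * C"
    using assms by (intro mult_left_mono) auto
  finally show ?thesis by (simp add: mult.commute)
qed

lemma integrand_integrable:
  assumes "norm v < 1"
  shows "integrable lborel (\<lambda>u. integrand v u)"
proof -
  obtain C where C: "C > 0" "\<And>w u. norm w \<le> norm v \<Longrightarrow> 0 \<le> u \<Longrightarrow> u \<le> 1 \<Longrightarrow> norm (kern w u) \<le> C"
    using kern_bound[OF assms] by metis
  show ?thesis
  proof (rule Bochner_Integration.integrable_bound)
    show "integrable lborel (\<lambda>u. C * (weight u))"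
      using weight_integrable by (rule integrable_mult_right)
    show "AE u in lborel. norm (integrand v u)
        \<le> norm (C * (weight u))"
    proof (rule AE_I2)
      fix u :: real
      show "norm (integrand v u)
        \<le> norm (C * (weight u))"
      proof (cases "u \<in> {0<..<1}")
        case True
        then show ?thesis using integrand_bound[of v u C] C by fastforce
      qed simp
    qed
  qed (use kern_measurable[OF assms] in simp)
qed

lemma next_G_holomorphic: "next_G holomorphic_on ball 0 1"
proof -
  have B: "Beta a (1 - a) > 0" using a by (intro Beta_pos) auto
  have "(\<lambda>v. LINT u|lborel. integrand v u) holomorphic_on ball 0 1"
  proof (rule holomorphic_on_lebesgue_integral)
    show "(\<lambda>u. integrand v u) \<in> borel_measurable lborel"
      if "v \<in> ball 0 1" for v using kern_measurable[of v] that by simp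
    show "AE u in lborel. (\<lambda>v. integrand v u) holomorphic_on ball 0 1"
    proof (rule AE_I2)
      fix u :: real
      show "(\<lambda>v. integrand v u) holomorphic_on ball 0 1"
      proof (cases "u \<in> {0<..<1}")
        case True
        have "(G \<circ> (\<lambda>v. v * (1 - of_real u) / (1 - v * of_real u))) holomorphic_on ball 0 1"
          by (rule holomorphic_on_compose_gen[OF _ G(1)])
             (use arg_ok True in \<open>auto intro!: holomorphic_intros\<close>)
        then have "(\<lambda>v. G (v * (1 - of_real u) / (1 - v * of_real u))) holomorphic_on ball 0 1" by (simp add: o_def)
        then have "(\<lambda>v. kern v u) holomorphic_on ball 0 1"
          unfolding kern_def using arg_ok True by (intro holomorphic_intros) auto
        then show ?thesis unfolding scaleR_conv_of_real by (intro holomorphic_intros)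
      qed simp
    qed
    fix v :: complex assume "v \<in> ball 0 1"
    define s where "s = (1 - norm v) / 2"
    have s: "s > 0" "norm v + s < 1" using \<open>v \<in> ball 0 1\<close> by (auto simp: s_def field_simps)
    obtain C where C: "C > 0" "\<And>w u. norm w \<le> norm v + s \<Longrightarrow> 0 \<le> u \<Longrightarrow> u \<le> 1 \<Longrightarrow> norm (kern w u) \<le> C"
      using kern_bound[OF s(2)] by metis
    have nw: "norm w \<le> norm v + s" if "w \<in> cball v s" for w
      using that norm_triangle_ineq2[of w v] by (simp add: dist_norm norm_minus_commute)
    have "AE u in lborel. \<forall>w\<in>cball v s. norm (integrand w u)
         \<le> C * (weight u)"
    proof (intro AE_I2 ballI)
      fix u :: real and w assume w: "w \<in> cball v s"
      show "norm (integrand w u)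
         \<le> C * (weight u)"
      proof (cases "u \<in> {0<..<1}")
        case True
        then show ?thesis using C(2)[OF nw[OF w]] by (intro integrand_bound) auto
      qed simp
    qed
    moreover have "integrable lborel (\<lambda>u. C * (weight u))"
      using weight_integrable by (rule integrable_mult_right)
    moreover have "cball v s \<subseteq> ball 0 1" using nw s by fastforce
    ultimately show "\<exists>r>0. cball v r \<subseteq> ball 0 1 \<and> (\<exists>h. integrable lborel h \<and> (AE u in lborel. \<forall>w\<in>cball v r.
        norm (integrand w u) \<le> h u))"
      using s(1) by blast
  qed simp
  then show ?thesis unfolding next_G_def[abs_def] using B by (intro holomorphic_intros) auto
qed

lemma next_G_0: "next_G 0 \<noteq> 0"
proof -
  have "(LINT u|lborel. integrand 0 u) =
        (LINT u|lborel. complex_of_real (weight u) * G 0)"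
    by (intro Bochner_Integration.integral_cong) (auto simp: kern_def indicator_def)
  also have "\<dots> = complex_of_real (Beta (1 - a) (g + 1)) * G 0"
    by (simp only: integral_mult_left_zero integral_complex_of_real weight_integral)
  finally show ?thesis
    using Beta_pos[of a "1 - a"] Beta_pos[of "1 - a" "g + 1"] a g G(2) by (simp add: next_G_def)
qed

definition real_kern :: "real \<Rightarrow> real \<Rightarrow> real" where
  "real_kern v u = (1 - v * u) powr (a - 2 - g) * Re (G (of_real (v * (1 - u) / (1 - v * u))))"

abbreviation real_integrand :: "real \<Rightarrow> real \<Rightarrow> real" where
  "real_integrand v u \<equiv> indicator {0<..<1} u * (wt u * real_kern v u)"

lemma ratio_range:
  assumes "0 \<le> v" "v < 1" "0 \<le> u" "u \<le> (1::real)"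
  shows "0 \<le> v * (1 - u) / (1 - v * u)" "v * (1 - u) / (1 - v * u) < 1" "1 - v * u > 0"
proof -
  have "v * u \<le> v * 1" using assms by (intro mult_left_mono) auto
  then show 1: "1 - v * u > 0" using assms by linarith
  then show "0 \<le> v * (1 - u) / (1 - v * u)" using assms by simp
  show "v * (1 - u) / (1 - v * u) < 1" using 1 assms by (simp add: divide_less_eq algebra_simps)
qed

lemma kern_of_real:
  assumes "0 \<le> v" "v < 1" "0 \<le> u" "u \<le> 1"
  shows "kern (of_real v) u = of_real (real_kern v u)" "real_kern v u \<ge> 0"
proof -
  note r = ratio_range[OF assms]
  have "(1 - complex_of_real v * of_real u) powr of_real (a - 2 - g) = complex_of_real (1 - v * u) powr of_real (a - 2 - g)" by simp
  also have "\<dots> = of_real ((1 - v * u) powr (a - 2 - g))" using r by (intro powr_of_real) auto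
  finally have 1: "(1 - complex_of_real v * of_real u) powr of_real (a - 2 - g) = of_real ((1 - v * u) powr (a - 2 - g))" .
  have 2: "complex_of_real v * (1 - of_real u) / (1 - of_real v * of_real u) = of_real (v * (1 - u) / (1 - v * u))" by simp
  show "kern (of_real v) u = of_real (real_kern v u)"
    unfolding kern_def real_kern_def 1 2 of_real_mult using G_real[OF r(1,2)] by metis
  show "real_kern v u \<ge> 0" unfolding real_kern_def using G_nonneg[OF r(1,2)] by (intro mult_nonneg_nonneg) auto
qed

lemma next_G_of_real:
  assumes "0 \<le> v" "v < 1"
  defines "R \<equiv> LINT u|lborel. real_integrand v u"
  shows "next_G (of_real v) = of_real (R / Beta a (1 - a))" "R \<ge> 0"
    "ennreal R = (\<integral>\<^sup>+u. ennreal (real_integrand v u) \<partial>lborel)"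
proof -
  have eq: "integrand (of_real v) u =
      complex_of_real (real_integrand v u)" for u
    using kern_of_real(1)[OF assms(1,2), of u] by (cases "u \<in> {0<..<1}") auto
  have int: "integrable lborel (\<lambda>u. complex_of_real (real_integrand v u))"
    using integrand_integrable[of "of_real v"] assms unfolding eq by simp
  then have intR: "integrable lborel (\<lambda>u. real_integrand v u)"
    using complex_of_real_integrable_eq by blast
  show "next_G (of_real v) = of_real (R / Beta a (1 - a))"
    unfolding next_G_def eq integral_complex_of_real R_def by simp
  have nn: "real_integrand v u \<ge> 0" for u
    using kern_of_real(2)[OF assms(1,2), of u] by (cases "u \<in> {0<..<1}") auto
  show "R \<ge> 0" unfolding R_def using nn by (intro integral_nonneg_AE) auto
  show "ennreal R = (\<integral>\<^sup>+u. ennreal (real_integrand v u) \<partial>lborel)"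
    unfolding R_def using intR nn by (intro nn_integral_eq_integral[symmetric]) auto
qed

lemma edge_density_nonneg: "edge_density g G t \<ge> 0"
  using G_nonneg[of "1 - t"] by (cases "t \<in> {0<..<1}") (auto simp: edge_density_def simp del: of_real_diff)

text \<open>The left side is the density at \<open>t\<close> of the product.  For \<open>s = 1 - v u\<close> one has
\<open>1 - t / s = v (1 - u) / s\<close>, and the powers of \<open>v\<close> combine.\<close>

lemma convolution_density:
  "(\<integral>\<^sup>+s. ennreal (beta_density a s) * (ennreal (1 / s) * ennreal (edge_density g G (t / s))) \<partial>lborel) =
     ennreal (edge_density (g + 1 - a) next_G t)"
proof (cases "t \<in> {0<..<1}")
  case False
  have "ennreal (beta_density a s) * (ennreal (1 / s) * ennreal (edge_density g G (t / s))) = 0" for s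
  proof (cases "s \<in> {0<..<1}")
    case True
    then have "t / s \<notin> {0<..<1}" using False by (auto simp: divide_less_eq zero_less_divide_iff)
    then show ?thesis by (simp add: edge_density_def)
  qed (simp add: beta_density_def)
  moreover have "edge_density (g + 1 - a) next_G t = 0" using False by (simp add: edge_density_def)
  ultimately show ?thesis by (simp only: nn_integral_const) simp
next
  case True
  define v where "v = 1 - t"
  have v: "0 < v" "v < 1" "t = 1 - v" using True by (auto simp: v_def)
  have B: "Beta a (1 - a) > 0" using a by (intro Beta_pos) auto
  have [measurable]: "edge_density g G \<in> borel_measurable borel" by (rule edge_density_measurable[OF G(1)])
  have pt: "ennreal v * (ennreal (beta_density a (1 + - v * u)) * (ennreal (1 / (1 + - v * u)) * ennreal (edge_density g G (t / (1 + - v * u)))))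
     = ennreal (v powr (g + 1 - a) / Beta a (1 - a)) * ennreal (real_integrand v u)" for u
  proof (cases "u \<in> {0<..<1}")
    case False
    have "beta_density a (1 + - v * u) = 0 \<or> edge_density g G (t / (1 + - v * u)) = 0"
    proof (cases "u \<le> 0")
      case True
      then have "v * u \<le> 0" using v by (simp add: mult_nonneg_nonpos)
      then show ?thesis by (simp add: beta_density_def)
    next
      case u: False
      then have "v * 1 \<le> v * u" using False v by (intro mult_left_mono) auto
      show ?thesis
      proof (cases "1 - v * u > 0")
        case True
        then have "t / (1 - v * u) \<ge> 1" using v \<open>v * 1 \<le> v * u\<close> by (simp add: le_divide_eq)
        then show ?thesis by (simp add: edge_density_def)
      qed (simp add: beta_density_def)
    qed
    then show ?thesis using False by auto
  next
    case True
    then have u: "0 < u" "u < 1" by auto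
    note r = ratio_range[of v u]
    define s where "s = 1 - v * u"
    have s: "0 < s" "s < 1" using r(3) v u by (auto simp: s_def)
    have q: "1 - t / s = v * (1 - u) / s" using s v by (simp add: s_def field_simps)
    have ts: "t / s \<in> {0<..<1}"
    proof -
      have "v * (1 - u) / s > 0" using v u s by simp
      then have "t / s < 1" using q by linarith
      moreover have "t / s > 0" using v s by simp
      ultimately show ?thesis by (simp only: greaterThanLessThan_iff)
    qed
    have "beta_density a s = s powr (a - 1) * (v * u) powr (- a) / Beta a (1 - a)"
      using s by (simp add: beta_density_def s_def)
    moreover have "edge_density g G (t / s) = (v * (1 - u) / s) powr g * Re (G (of_real (v * (1 - u) / s)))"
      using ts by (simp add: edge_density_def q del: of_real_mult of_real_divide of_real_diff)
    ultimately have "v * (beta_density a s * (1 / s * edge_density g G (t / s))) =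
       v * (s powr (a - 1) * (v * u) powr (- a) / Beta a (1 - a) * (1 / s * ((v * (1 - u) / s) powr g * Re (G (of_real (v * (1 - u) / s))))))"
      by simp
    also have "(v * u) powr (- a) = v powr (- a) * u powr (- a)" using v u by (simp add: powr_mult)
    also have "(v * (1 - u) / s) powr g = v powr g * (1 - u) powr g / s powr g"
      using v u s by (simp add: powr_mult powr_divide)
    also have "v * (s powr (a - 1) * (v powr (- a) * u powr (- a)) / Beta a (1 - a) * (1 / s * (v powr g * (1 - u) powr g / s powr g * Re (G (of_real (v * (1 - u) / s))))))
      = (v * v powr (- a) * v powr g) / Beta a (1 - a) * (u powr (- a) * (1 - u) powr g * ((s powr (a - 1) / s / s powr g) * Re (G (of_real (v * (1 - u) / s)))))"
      by (simp add: field_simps)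
    also have "v * v powr (- a) * v powr g = v powr (g + 1 - a)"
      using v by (simp add: powr_diff powr_add powr_minus field_simps)
    also have "s powr (a - 1) / s / s powr g = s powr (a - 2 - g)"
      using s by (simp add: powr_diff power2_eq_square)
    finally have main: "v * (beta_density a s * (1 / s * edge_density g G (t / s))) =
        v powr (g + 1 - a) / Beta a (1 - a) * (real_integrand v u)"
      using True by (simp add: real_kern_def s_def)
    have "ennreal v * (ennreal (beta_density a s) * (ennreal (1 / s) * ennreal (edge_density g G (t / s)))) =
        ennreal (v * (beta_density a s * (1 / s * edge_density g G (t / s))))"
      using v s beta_density_nonneg[OF a, of s] edge_density_nonneg[of "t / s"]
      by (intro ennreal_mult4) auto
    also have "\<dots> = ennreal (v powr (g + 1 - a) / Beta a (1 - a)) * ennreal (real_integrand v u)"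
      unfolding main by (rule ennreal_mult) (use B kern_of_real(2)[of v u] v u in auto)
    finally show ?thesis by (simp add: s_def)
  qed
  have "(\<integral>\<^sup>+s. ennreal (beta_density a s) * (ennreal (1 / s) * ennreal (edge_density g G (t / s))) \<partial>lborel) =
     ennreal \<bar>- v\<bar> * (\<integral>\<^sup>+u. ennreal (beta_density a (1 + - v * u)) * (ennreal (1 / (1 + - v * u)) * ennreal (edge_density g G (t / (1 + - v * u)))) \<partial>lborel)"
    by (rule nn_integral_real_affine) (use v in \<open>auto\<close>)
  also have "\<dots> = (\<integral>\<^sup>+u. ennreal v * (ennreal (beta_density a (1 + - v * u)) * (ennreal (1 / (1 + - v * u)) * ennreal (edge_density g G (t / (1 + - v * u))))) \<partial>lborel)"
    using v by (subst nn_integral_cmult) auto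
  also have "\<dots> = (\<integral>\<^sup>+u. ennreal (v powr (g + 1 - a) / Beta a (1 - a)) * ennreal (real_integrand v u) \<partial>lborel)"
    by (simp only: pt)
  also have "\<dots> = ennreal (v powr (g + 1 - a) / Beta a (1 - a)) * (\<integral>\<^sup>+u. ennreal (real_integrand v u) \<partial>lborel)"
  proof (rule nn_integral_cmult)
    have eq: "real_integrand v u =
        Re (integrand (of_real v) u)" for u
      using kern_of_real(1)[of v u] v by (cases "u \<in> {0<..<1}") auto
    have "norm (complex_of_real v) < 1" using v by simp
    note [measurable] = kern_measurable[OF this]
    show "(\<lambda>u. ennreal (real_integrand v u)) \<in> borel_measurable lborel"
      unfolding eq by measurable
  qed
  also have "\<dots> = ennreal (v powr (g + 1 - a) * Re (next_G (of_real v)))"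
  proof -
    note n = next_G_of_real[OF less_imp_le[OF v(1)] v(2)]
    show ?thesis
      unfolding n(3)[symmetric] n(1) Re_complex_of_real using n(2) B
      by (subst ennreal_mult[symmetric]) auto
  qed
  also have "v powr (g + 1 - a) * Re (next_G (of_real v)) = edge_density (g + 1 - a) next_G t"
    using True v by (simp add: edge_density_def)
  finally show ?thesis .
qed

lemma mult_conv_edge_density:
  assumes M: "M = density lborel (\<lambda>t. ennreal (edge_density g G t))" and um: "unit_measure M"
  shows "has_edge_density (mult_conv (beta_measure a) M) (g + 1 - a) next_G"
  unfolding has_edge_density_def
proof (intro conjI allI impI)
  show "next_G holomorphic_on ball 0 1" by (rule next_G_holomorphic)
  show "next_G 0 \<noteq> 0" by (rule next_G_0)
  show "-1 < g + 1 - a" using a g by simp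
  show "next_G (of_real v) = of_real (Re (next_G (of_real v)))" if "0 \<le> v \<and> v < 1" for v
    using next_G_of_real(1)[of v] that by simp
  show "0 \<le> Re (next_G (of_real v))" if "0 \<le> v \<and> v < 1" for v
    using next_G_of_real[of v] that Beta_pos[of a "1 - a"] a by simp
  interpret A: unit_measure "beta_measure a" using a by (intro unit_measure_beta)
  interpret B: unit_measure M by (rule um)
  interpret unit_measure_pair "beta_measure a" M ..
  have [measurable]: "edge_density g G \<in> borel_measurable borel" by (rule edge_density_measurable[OF G(1)])
  have [measurable]: "edge_density (g + 1 - a) next_G \<in> borel_measurable borel"
    by (rule edge_density_measurable[OF next_G_holomorphic])
  show "mult_conv (beta_measure a) M = density lborel (\<lambda>t. ennreal (edge_density (g + 1 - a) next_G t))"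
  proof (rule measure_eqI)
    show "sets (mult_conv (beta_measure a) M) = sets (density lborel (\<lambda>t. ennreal (edge_density (g + 1 - a) next_G t)))"
      by (simp add: mult_conv_def)
    fix X assume "X \<in> sets (mult_conv (beta_measure a) M)"
    then have X[measurable]: "X \<in> sets borel" by (simp add: mult_conv_def)
    have "emeasure (mult_conv (beta_measure a) M) X = (\<integral>\<^sup>+u. indicator X u \<partial>mult_conv (beta_measure a) M)"
      using X by (simp add: mult_conv_def)
    also have "\<dots> = (\<integral>\<^sup>+s. \<integral>\<^sup>+t. indicator X (s * t) \<partial>M \<partial>beta_measure a)"
      by (rule nn_integral_mult_conv) measurable
    also have "\<dots> = (\<integral>\<^sup>+s. ennreal (beta_density a s) * (\<integral>\<^sup>+t. indicator X (s * t) \<partial>M) \<partial>lborel)"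
      by (rule nn_integral_beta) measurable
    also have "\<dots> = (\<integral>\<^sup>+s. \<integral>\<^sup>+t. ennreal (beta_density a s) * (ennreal (1 / s) * ennreal (edge_density g G (t / s))) * indicator X t \<partial>lborel \<partial>lborel)"
    proof (rule nn_integral_cong)
      fix s :: real
      show "ennreal (beta_density a s) * (\<integral>\<^sup>+t. indicator X (s * t) \<partial>M) =
         (\<integral>\<^sup>+t. ennreal (beta_density a s) * (ennreal (1 / s) * ennreal (edge_density g G (t / s))) * indicator X t \<partial>lborel)"
      proof (cases "s \<in> {0<..<1}")
        case True
        then have s: "s > 0" by simp
        have "(\<integral>\<^sup>+t. indicator X (s * t) \<partial>M) = (\<integral>\<^sup>+t. ennreal (edge_density g G t) * indicator X (s * t) \<partial>lborel)"
          unfolding M by (subst nn_integral_density) auto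
        also have "\<dots> = ennreal \<bar>1 / s\<bar> * (\<integral>\<^sup>+t. ennreal (edge_density g G (0 + 1 / s * t)) * indicator X (s * (0 + 1 / s * t)) \<partial>lborel)"
          using s by (intro nn_integral_real_affine) auto
        also have "\<dots> = (\<integral>\<^sup>+t. ennreal (1 / s) * (ennreal (edge_density g G (t / s)) * indicator X t) \<partial>lborel)"
          using s by (subst nn_integral_cmult) auto
        finally have "(\<integral>\<^sup>+t. indicator X (s * t) \<partial>M) = (\<integral>\<^sup>+t. ennreal (1 / s) * (ennreal (edge_density g G (t / s)) * indicator X t) \<partial>lborel)" .
        then have "ennreal (beta_density a s) * (\<integral>\<^sup>+t. indicator X (s * t) \<partial>M) =
           ennreal (beta_density a s) * (\<integral>\<^sup>+t. ennreal (1 / s) * (ennreal (edge_density g G (t / s)) * indicator X t) \<partial>lborel)" by simp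
        also have "\<dots> = (\<integral>\<^sup>+t. ennreal (beta_density a s) * (ennreal (1 / s) * (ennreal (edge_density g G (t / s)) * indicator X t)) \<partial>lborel)"
          by (rule nn_integral_cmult[symmetric]) measurable
        finally show ?thesis by (simp add: mult.assoc)
      qed (simp add: beta_density_def)
    qed
    also have "\<dots> = (\<integral>\<^sup>+t. \<integral>\<^sup>+s. ennreal (beta_density a s) * (ennreal (1 / s) * ennreal (edge_density g G (t / s))) * indicator X t \<partial>lborel \<partial>lborel)"
      by (rule lborel_pair.Fubini') measurable
    also have "\<dots> = (\<integral>\<^sup>+t. ennreal (edge_density (g + 1 - a) next_G t) * indicator X t \<partial>lborel)"
      by (simp only: convolution_density[symmetric]) (intro nn_integral_cong nn_integral_multc; measurable)
    also have "\<dots> = emeasure (density lborel (\<lambda>t. ennreal (edge_density (g + 1 - a) next_G t))) X"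
      by (rule emeasure_density[symmetric]) auto
    finally show "emeasure (mult_conv (beta_measure a) M) X = emeasure (density lborel (\<lambda>t. ennreal (edge_density (g + 1 - a) next_G t))) X" .
  qed
qed

end

lemma mult_conv_return:
  assumes "unit_measure M"
  shows "mult_conv M (return borel 1) = M"
proof -
  interpret A: unit_measure M by fact
  interpret B: unit_measure "return borel 1" using unit_measure_prod_measure[of "[]"] by simp
  interpret unit_measure_pair M "return borel 1" ..
  show ?thesis
  proof (rule measure_eqI)
    show "sets (mult_conv M (return borel 1)) = sets M" by (simp add: mult_conv_def A.sets_M)
    fix X assume "X \<in> sets (mult_conv M (return borel 1))"
    then have X[measurable]: "X \<in> sets borel" by (simp add: mult_conv_def)
    have "emeasure (mult_conv M (return borel 1)) X = (\<integral>\<^sup>+u. indicator X u \<partial>mult_conv M (return borel 1))"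
      using X by (simp add: mult_conv_def)
    also have "\<dots> = (\<integral>\<^sup>+s. indicator X s \<partial>M)"
      by (subst nn_integral_mult_conv) (auto simp: nn_integral_return)
    also have "\<dots> = emeasure M X" using X by (simp add: A.sets_M)
    finally show "emeasure (mult_conv M (return borel 1)) X = emeasure M X" .
  qed
qed

lemma prod_measure_edge_density:
  assumes "as \<noteq> []" "\<And>a. a \<in> set as \<Longrightarrow> 0 < a \<and> a < 1"
  shows "\<exists>g G. has_edge_density (prod_measure as) g G"
  using assms
proof (induction as)
  case (Cons a as)
  have a: "0 < a" "a < 1" using Cons.prems(2)[of a] by auto
  show ?case
  proof (cases "as = []")
    case True
    then have "prod_measure (a # as) = beta_measure a"
      using unit_measure_beta[OF a] by (simp add: mult_conv_return)
    then show ?thesis using has_edge_density_beta[OF a] by metis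
  next
    case False
    then obtain g G where H: "has_edge_density (prod_measure as) g G" using Cons by auto
    interpret edge_step a g G using H a by unfold_locales (auto simp: has_edge_density_def)
    have "unit_measure (prod_measure as)" using Cons.prems by (intro unit_measure_prod_measure) auto
    then have "has_edge_density (mult_conv (beta_measure a) (prod_measure as)) (g + 1 - a) next_G"
      using H by (intro mult_conv_edge_density) (auto simp: has_edge_density_def)
    then show ?thesis by auto
  qed
qed simp

section \<open>The Stieltjes transform near the branch point\<close>

text \<open>The two possible singular functions of \<open>w = Ln (1 - x)\<close>, namely \<open>w\<close> itself and a power \<open>exp (g w)\<close>,
enter only through these properties: monodromy, growth at \<open>x = 1\<close>, and a growth slower than
\<open>1 / (1 - x)\<close>.  The width \<open>4 \<pi>\<close> leaves room for one full turn in addition to the principal strip.\<close>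

definition log_like :: "(complex \<Rightarrow> complex) \<Rightarrow> bool" where
  "log_like La \<longleftrightarrow> La holomorphic_on UNIV \<and> (\<forall>w. La (w + 2 * of_real pi * \<i>) \<noteq> La w) \<and>
     (\<forall>K. \<exists>R. \<forall>w. Re w < R \<and> \<bar>Im w\<bar> \<le> 4 * pi \<longrightarrow> norm (La w) > K) \<and>
     (\<forall>e>0. \<exists>R. \<forall>w. Re w < R \<and> \<bar>Im w\<bar> \<le> 4 * pi \<longrightarrow> norm (exp w * La w) < e)"

lemma log_like_exp:
  assumes "-1 < g" "g < 0"
  shows "log_like (\<lambda>w. exp (of_real g * w))"
  unfolding log_like_def
proof (intro conjI allI impI)
  show "(\<lambda>w. exp (of_real g * w)) holomorphic_on UNIV" by (intro holomorphic_intros)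
  fix w :: complex
  show "exp (of_real g * (w + 2 * of_real pi * \<i>)) \<noteq> exp (of_real g * w)"
  proof
    assume "exp (of_real g * (w + 2 * of_real pi * \<i>)) = exp (of_real g * w)"
    then have "exp (of_real (2 * pi * g) * \<i>) = 1"
      by (simp add: distrib_left exp_add mult_ac)
    then obtain n :: int where "2 * pi * g = of_int (2 * n) * pi" by (auto simp: exp_eq_1)
    then have "g = of_int n" by simp
    then have "-1 < n" "n < 0" using assms by simp_all
    then show False by simp
  qed
next
  fix K :: real
  define R where "R = ln (max K 1) / g"
  have "norm (exp (of_real g * w)) > K" if "Re w < R" for w
  proof -
    have "g * Re w > ln (max K 1)" using that assms by (simp add: R_def neg_less_divide_eq mult.commute)
    then have "exp (ln (max K 1)) < exp (g * Re w)" by (subst exp_less_cancel_iff)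
    moreover have "exp (ln (max K 1)) = max K 1" by (rule exp_ln) simp
    ultimately have "max K 1 < exp (g * Re w)" by (simp only:)
    then show ?thesis by simp
  qed
  then show "\<exists>R. \<forall>w. Re w < R \<and> \<bar>Im w\<bar> \<le> 4 * pi \<longrightarrow> norm (exp (of_real g * w)) > K" by blast
next
  fix e :: real assume e: "e > 0"
  have "norm (exp w * exp (of_real g * w)) < e" if "Re w < ln e / (1 + g)" for w
  proof -
    have "(1 + g) * Re w < ln e" using that assms by (simp add: pos_less_divide_eq mult.commute)
    then have "exp (Re w + g * Re w) < e" using e by (simp add: distrib_right exp_less_cancel_iff[symmetric, of _ "ln e"] del: exp_less_cancel_iff)
    then show ?thesis by (simp add: norm_mult exp_add)
  qed
  then show "\<exists>R. \<forall>w. Re w < R \<and> \<bar>Im w\<bar> \<le> 4 * pi \<longrightarrow> norm (exp w * exp (of_real g * w)) < e" by blast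
qed

lemma log_like_id: "log_like (\<lambda>w. w)"
  unfolding log_like_def
proof (intro conjI allI impI)
  fix K :: real
  have "norm w > K" if "Re w < - \<bar>K\<bar>" for w using that abs_Re_le_cmod[of w] by linarith
  then show "\<exists>R. \<forall>w. Re w < R \<and> \<bar>Im w\<bar> \<le> 4 * pi \<longrightarrow> norm w > K" by blast
next
  fix e :: real assume e: "e > 0"
  have "((\<lambda>r::real. exp r * (\<bar>r\<bar> + 4 * pi)) \<longlongrightarrow> 0) at_bot" by real_asymp
  then have "\<forall>\<^sub>F r in at_bot. exp r * (\<bar>r\<bar> + 4 * pi) < e" using e by (intro order_tendstoD(2))
  then obtain R where R: "\<And>r. r \<le> R \<Longrightarrow> exp r * (\<bar>r\<bar> + 4 * pi) < e" by (auto simp: eventually_at_bot_linorder)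
  have "norm (exp w * w) < e" if "Re w < R" "\<bar>Im w\<bar> \<le> 4 * pi" for w
  proof -
    have "norm (exp w * w) \<le> exp (Re w) * (\<bar>Re w\<bar> + 4 * pi)"
      using cmod_le[of w] that by (auto simp: norm_mult intro!: mult_left_mono)
    then show ?thesis using R[of "Re w"] that by simp
  qed
  then show "\<exists>R. \<forall>w. Re w < R \<and> \<bar>Im w\<bar> \<le> 4 * pi \<longrightarrow> norm (exp w * w) < e" by blast
qed (auto intro: holomorphic_intros)

text \<open>With the radius \<open>1/5\<close> the point \<open>1 - 1 / x\<close>, where the factor \<open>1 - x t\<close> vanishes in terms of
\<open>1 - t\<close>, stays in the disc of radius \<open>1/2\<close>, well inside the domain of the analytic factor.\<close>

lemma near_1_bounds:
  fixes x :: complex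
  assumes "x \<in> ball 1 (1/5)"
  shows "x \<noteq> 0" "norm (1 - 1 / x) < 1/2" "Re x > 0"
proof -
  have d: "norm (1 - x) < 1/5" using assms by (simp add: dist_norm)
  then have "norm x > 4/5" using norm_triangle_ineq2[of 1 "1 - x"] by simp
  then show x0: "x \<noteq> 0" by auto
  have "1 - 1 / x = (x - 1) / x" using x0 by (simp add: diff_divide_distrib)
  then have "norm (1 - 1 / x) = norm (1 - x) / norm x" by (simp add: norm_divide norm_minus_commute)
  also have "\<dots> < (1/5) / (4/5)" using d \<open>norm x > 4/5\<close> by (intro frac_less) auto
  finally show "norm (1 - 1 / x) < 1/2" by simp
  show "Re x > 0" using complex_Re_le_cmod[of "1 - x"] d by simp
qed

definition divided_difference :: "(complex \<Rightarrow> complex) \<Rightarrow> complex \<Rightarrow> complex \<Rightarrow> complex" where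
  "divided_difference Q v w = (if w = v then deriv Q v else (Q w - Q v) / (w - v))"

text \<open>For \<open>v\<close> close to the unit circle, where \<open>Q\<close> may be unbounded, the two points are at a distance of at
least \<open>1/4\<close>, so that only the value \<open>Q v\<close> itself is needed.\<close>

lemma divided_difference_bound:
  assumes Q: "Q holomorphic_on ball 0 1"
  obtains C where "C > 0" "\<And>v w. norm v < 1 \<Longrightarrow> norm w \<le> 1/2 \<Longrightarrow> norm (divided_difference Q v w) \<le> C + 4 * norm (Q v)"
proof -
  have sub: "cball 0 (3/4) \<subseteq> ball (0::complex) 1" by auto
  have "continuous_on (cball 0 (3/4)) Q" "continuous_on (cball 0 (3/4)) (deriv Q)"
    using holomorphic_on_subset[OF Q sub] holomorphic_on_subset[OF holomorphic_deriv[OF Q] sub]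
    by (auto intro: holomorphic_on_imp_continuous_on)
  then have "bounded (Q ` cball 0 (3/4))" "bounded (deriv Q ` cball 0 (3/4))"
    by (auto intro!: compact_imp_bounded compact_continuous_image)
  then obtain C1 C2 where C1: "C1 > 0" "\<And>z. z \<in> cball 0 (3/4) \<Longrightarrow> norm (Q z) \<le> C1"
    and C2: "C2 > 0" "\<And>z. z \<in> cball 0 (3/4) \<Longrightarrow> norm (deriv Q z) \<le> C2"
    unfolding bounded_pos by blast
  show ?thesis
  proof (rule that[of "4 * C1 + C2"])
    fix v w :: complex assume v: "norm v < 1" and w: "norm w \<le> 1/2"
    show "norm (divided_difference Q v w) \<le> 4 * C1 + C2 + 4 * norm (Q v)"
    proof (cases "norm v \<le> 3/4")
      case True
      have "norm (divided_difference Q v w) \<le> C2"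
      proof (cases "w = v")
        case False
        have "norm (Q w - Q v) \<le> C2 * norm (w - v)"
        proof (rule field_differentiable_bound[where S="cball 0 (3/4)" and f'="deriv Q"])
          fix z :: complex assume "z \<in> cball 0 (3/4)"
          then show "(Q has_field_derivative deriv Q z) (at z within cball 0 (3/4))"
            using holomorphic_derivI[OF Q _, of z "cball 0 (3/4)"] sub by auto
        qed (use C2 True w in auto)
        then show ?thesis using False by (simp add: divided_difference_def norm_divide pos_divide_le_eq)
      qed (use C2 True in \<open>simp add: divided_difference_def\<close>)
      also have "\<dots> \<le> 4 * C1 + C2 + 4 * norm (Q v)" using C1 by simp
      finally show ?thesis .
    next
      case False
      have d: "norm (w - v) \<ge> 1/4" using norm_triangle_ineq2[of v w] False w by (simp add: norm_minus_commute)
      then have "w \<noteq> v" by auto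
      then have "norm (divided_difference Q v w) = norm (Q w - Q v) / norm (w - v)"
        by (simp add: divided_difference_def norm_divide)
      also have "\<dots> \<le> (norm (Q w) + norm (Q v)) / (1/4)"
        using d by (intro frac_le norm_triangle_ineq4) auto
      also have "\<dots> \<le> 4 * C1 + C2 + 4 * norm (Q v)"
        using C1(2)[of w] C2(1) w by simp
      finally show ?thesis .
    qed
  qed (use C1 C2 in auto)
qed

text \<open>In terms of \<open>v = 1 - t\<close> and \<open>\<omega> = 1 - 1 / x\<close> the denominator is \<open>1 - x t = x (v - \<omega>)\<close>.  Replacing
\<open>Q(v)\<close> by \<open>Q(\<omega>)\<close> costs a divided difference of \<open>Q\<close>, which is holomorphic in \<open>\<omega>\<close> across the cut; the
whole multivaluedness is carried by the transform of \<open>N\<close>.\<close>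

lemma singular_decomposition:
  fixes q :: "real \<Rightarrow> complex"
  assumes sets: "sets N = sets borel" and Q: "Q holomorphic_on ball 0 1"
    and supp: "AE t in N. 0 < t \<and> t < 1 \<and> q t = Q (of_real (1 - t))"
    and q: "integrable N q" and one: "integrable N (\<lambda>t. 1 :: real)"
  obtains A where "A holomorphic_on ball 1 (1/5)"
    "\<And>x. x \<in> ball 1 (1/5) \<Longrightarrow> x \<in> cut_plane \<Longrightarrow>
      (LINT t|N. q t / (1 - x * of_real t)) = A x + Q (1 - 1 / x) * (LINT t|N. 1 / (1 - x * of_real t))"
proof -
  note [measurable_cong] = sets
  have [measurable]: "q \<in> borel_measurable N" using q by simp
  define D where "D w t = (if w = complex_of_real (1 - t) then deriv Q w else (Q w - q t) / (w - of_real (1 - t)))" for w t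
  define H where "H w = (LINT t|N. D w t)" for w
  have D_eq: "AE t in N. 0 < t \<and> t < 1 \<and> (\<forall>w. D w t = divided_difference Q (of_real (1 - t)) w)"
    using supp by eventually_elim (auto simp: D_def divided_difference_def)
  obtain C where C: "C > 0" "\<And>v w. norm v < 1 \<Longrightarrow> norm w \<le> 1/2 \<Longrightarrow> norm (divided_difference Q v w) \<le> C + 4 * norm (Q v)"
    using divided_difference_bound[OF Q] by metis
  have n1: "norm (complex_of_real (1 - t)) < 1" if "0 < t" "t < 1" for t
    using that by (simp only: norm_of_real)
  have Dm: "D w \<in> borel_measurable N" for w unfolding D_def[abs_def] by measurable
  have bd: "AE t in N. \<forall>w\<in>cball 0 (1/2). norm (D w t) \<le> C + 4 * norm (q t)"
    using D_eq supp
  proof eventually_elim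
    case (elim t)
    then show ?case using C(2)[OF n1[of t]] by auto
  qed
  have gi: "integrable N (\<lambda>t. C + 4 * norm (q t))"
    using integrable_mult_right[OF one, of C] q by (intro Bochner_Integration.integrable_add) auto
  have H: "H holomorphic_on ball 0 (1/2)"
    unfolding H_def[abs_def]
  proof (rule holomorphic_on_lebesgue_integral)
    show "AE t in N. (\<lambda>w. D w t) holomorphic_on ball 0 (1/2)"
      using D_eq
    proof eventually_elim
      case (elim t)
      define z where "z = complex_of_real (1 - t)"
      have "norm z < 1" unfolding z_def using elim by (intro n1) auto
      then have "(\<lambda>w. if w = z then deriv Q z else (Q w - Q z) / (w - z)) holomorphic_on ball 0 1"
        by (intro pole_lemma[OF Q]) simp
      moreover have "(\<lambda>w. D w t) = (\<lambda>w. if w = z then deriv Q z else (Q w - Q z) / (w - z))"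
        using elim by (auto simp only: z_def divided_difference_def)
      ultimately have "(\<lambda>w. D w t) holomorphic_on ball 0 1" by (simp only:)
      then show ?case by (rule holomorphic_on_subset) auto
    qed
    fix z :: complex assume "z \<in> ball 0 (1/2)"
    then obtain r where r: "r > 0" "cball z r \<subseteq> ball 0 (1/2)" by (metis open_ball open_contains_cball)
    have "AE t in N. \<forall>w\<in>cball z r. norm (D w t) \<le> C + 4 * norm (q t)"
      using bd by eventually_elim (use r in force)
    then show "\<exists>r>0. cball z r \<subseteq> ball 0 (1/2) \<and> (\<exists>g. integrable N g \<and> (AE t in N. \<forall>w\<in>cball z r. norm (D w t) \<le> g t))"
      using r gi by blast
  qed (use Dm in auto)
  show ?thesis
  proof (rule that[of "\<lambda>x. H (1 - 1 / x) / x"])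
    have "(H \<circ> (\<lambda>x. 1 - 1 / x)) holomorphic_on ball 1 (1/5)"
      by (rule holomorphic_on_compose_gen[OF _ H])
         (use near_1_bounds in \<open>force intro!: holomorphic_intros\<close>)+
    then show "(\<lambda>x. H (1 - 1 / x) / x) holomorphic_on ball 1 (1/5)"
      unfolding o_def using near_1_bounds(1) by (intro holomorphic_intros) auto
    fix x :: complex assume x: "x \<in> ball 1 (1/5)" "x \<in> cut_plane"
    define om where "om = 1 - 1 / x"
    have x0: "x \<noteq> 0" and om: "norm om < 1/2" using near_1_bounds[OF x(1)] by (auto simp: om_def)
    obtain c where c: "c > 0" "\<And>t. 0 \<le> t \<Longrightarrow> t \<le> 1 \<Longrightarrow> c \<le> norm (1 - x * complex_of_real t)"
      using cut_plane_bound[OF x(2)] by (metis centre_in_cball less_imp_le)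
    have i1: "integrable N (\<lambda>t. 1 / (1 - x * of_real t))"
    proof (rule Bochner_Integration.integrable_bound)
      show "integrable N (\<lambda>t. 1 / c * (1::real))" by (rule integrable_mult_right[OF one])
      show "AE t in N. norm (1 / (1 - x * complex_of_real t)) \<le> norm (1 / c * (1::real))"
        using supp
      proof eventually_elim
        case (elim t)
        then show ?case using c(1) c(2)[of t] by (simp add: norm_divide frac_le)
      qed
    qed measurable
    have iD: "integrable N (D om)"
    proof (rule Bochner_Integration.integrable_bound[OF gi Dm])
      show "AE t in N. norm (D om t) \<le> norm (C + 4 * norm (q t))"
        using bd
      proof eventually_elim
        case (elim t)
        have "norm (D om t) \<le> C + 4 * norm (q t)" using elim om by simp
        also have "\<dots> \<le> norm (C + 4 * norm (q t))" by simp
        finally show ?case .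
      qed
    qed
    have "(LINT t|N. q t / (1 - x * of_real t)) = (LINT t|N. D om t / x + Q om * (1 / (1 - x * of_real t)))"
    proof (rule integral_cong_AE)
      show "AE t in N. q t / (1 - x * of_real t) = D om t / x + Q om * (1 / (1 - x * of_real t))"
        using supp
      proof eventually_elim
        case (elim t)
        have nz: "1 - x * of_real t \<noteq> 0" using c(1) c(2)[of t] elim by auto
        have eq: "1 - x * of_real t = x * (of_real (1 - t) - om)" using x0 by (simp add: om_def algebra_simps)
        then have ne: "of_real (1 - t) - om \<noteq> 0" using nz by auto
        then have "D om t = (q t - Q om) / (of_real (1 - t) - om)"
          unfolding D_def by (metis eq_iff_diff_eq_0 minus_diff_eq minus_divide_divide)
        then have "D om t / x = (q t - Q om) / (1 - x * of_real t)"
          unfolding eq by (simp add: mult.commute)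
        then show ?case by (simp add: diff_divide_distrib)
      qed
    qed (use Dm in measurable)
    also have "\<dots> = H om / x + Q om * (LINT t|N. 1 / (1 - x * of_real t))"
      using iD i1 unfolding H_def by (simp only: Bochner_Integration.integral_add integrable_divide integrable_mult_right
          integral_divide_zero integral_mult_right_zero)
    finally show "(LINT t|N. q t / (1 - x * of_real t)) = H (1 - 1 / x) / x + Q (1 - 1 / x) * (LINT t|N. 1 / (1 - x * of_real t))"
      by (simp add: om_def)
  qed
qed

lemma uniform_stieltjes:
  assumes "x \<in> cut_plane" "x \<noteq> 0"
  shows "(LINT t|lborel. indicator {0<..<1} t *\<^sub>R (1 / (1 - x * of_real t))) = - Ln (1 - x) / x"
proof -
  have nz: "1 - x * of_real t \<notin> \<real>\<^sub>\<le>\<^sub>0" if "0 \<le> t" "t \<le> 1" for t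
  proof
    assume n: "1 - x * of_real t \<in> \<real>\<^sub>\<le>\<^sub>0"
    then have im: "Im x * t = 0" and re: "Re x * t \<ge> 1" by (auto simp: complex_nonpos_Reals_iff)
    then have "t > 0" using that by (cases "t = 0") auto
    then have "Im x = 0" using im by simp
    moreover have "Re x \<ge> 1"
    proof (rule ccontr)
      assume "\<not> 1 \<le> Re x"
      then have "Re x * t < 1 * t" using \<open>t > 0\<close> by (intro mult_strict_right_mono) auto
      then show False using re that by simp
    qed
    ultimately have "x = complex_of_real (Re x)" "Re x \<in> {1..}" by (auto simp: complex_eq_iff)
    then show False using assms(1) by (metis ComplD imageI)
  qed
  have "((\<lambda>t. 1 / (1 - x * of_real t)) has_integral (- Ln (1 - x * of_real 1) / x - (- Ln (1 - x * of_real 0) / x))) {0..1}"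
  proof (rule fundamental_theorem_of_calculus)
    fix t :: real assume t: "t \<in> {0..1}"
    have "((\<lambda>z. - Ln (1 - x * z) / x) has_field_derivative 1 / (1 - x * of_real t)) (at (of_real t))"
      using nz[of t] t assms by (auto intro!: derivative_eq_intros simp: inverse_eq_divide)
    from has_vector_derivative_real_field[OF this]
    show "((\<lambda>t. - Ln (1 - x * of_real t) / x) has_vector_derivative 1 / (1 - x * of_real t)) (at t within {0..1})" .
  qed simp
  then have I: "integral {0..1} (\<lambda>t. 1 / (1 - x * of_real t)) = - Ln (1 - x) / x" by (auto dest: integral_unique)
  have "set_integrable lborel {0..1} (\<lambda>t. 1 / (1 - x * complex_of_real t))"
    by (rule borel_integrable_atLeastAtMost') (use nz in \<open>force intro!: continuous_intros\<close>)
  then have "(LINT t:{0..1}|lborel. 1 / (1 - x * complex_of_real t)) = - Ln (1 - x) / x"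
    using set_borel_integral_eq_integral(2) I by metis
  moreover have "(LINT t:{0..1}|lborel. 1 / (1 - x * complex_of_real t)) =
      (LINT t|lborel. indicator {0<..<1} t *\<^sub>R (1 / (1 - x * of_real t)))"
    unfolding set_lebesgue_integral_def
  proof (rule integral_cong_AE)
    show "AE t in lborel. indicator {0..1} t *\<^sub>R (1 / (1 - x * complex_of_real t)) = indicator {0<..<1} t *\<^sub>R (1 / (1 - x * of_real t))"
      by (rule AE_I[where N="{0, 1}"]) (auto simp: indicator_def emeasure_lborel_countable split: if_splits)
  qed measurable
  ultimately show ?thesis by simp
qed

text \<open>Any density with the same analytic behaviour can serve as a model: it suffices that the quotient \<open>Q\<close>
of the two densities is analytic in the disc.\<close>

lemma edge_density_model:
  assumes H: "has_edge_density M g G" and um: "unit_measure M"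
    and d: "d \<in> borel_measurable borel" "\<And>t. d t \<ge> 0" "integrable lborel d"
    and d0: "\<And>t. t \<notin> {0<..<1} \<Longrightarrow> d t = 0"
    and Q: "Q holomorphic_on ball 0 1"
    and eq: "\<And>t. 0 < t \<Longrightarrow> t < 1 \<Longrightarrow> complex_of_real (edge_density g G t) = of_real (d t) * Q (of_real (1 - t))"
  obtains A where "A holomorphic_on ball 1 (1/5)"
    "\<And>x. x \<in> ball 1 (1/5) \<Longrightarrow> x \<in> cut_plane \<Longrightarrow>
      unit_measure.stieltjes M x = A x + Q (1 - 1 / x) * (LINT t|lborel. d t *\<^sub>R (1 / (1 - x * of_real t)))"
proof -
  interpret unit_measure M by (rule um)
  have G: "G holomorphic_on ball 0 1" and M: "M = density lborel (\<lambda>t. ennreal (edge_density g G t))"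
    and Gn: "\<And>v. 0 \<le> v \<Longrightarrow> v < 1 \<Longrightarrow> 0 \<le> Re (G (of_real v))"
    using H by (auto simp: has_edge_density_def)
  note [measurable] = edge_density_measurable[OF G] d(1)
  have en: "edge_density g G t \<ge> 0" for t
    using Gn[of "1 - t"] by (cases "t \<in> {0<..<1}") (auto simp: edge_density_def simp del: of_real_diff)
  define q where "q t = indicator {0<..<1} t *\<^sub>R Q (of_real (1 - t))" for t
  have qm [measurable]: "q \<in> borel_measurable borel"
    unfolding q_def[abs_def]
  proof (rule borel_measurable_continuous_on_indicator)
    have "complex_of_real (1 - t) \<in> ball 0 1" if "t \<in> {0<..<1}" for t
    proof -
      have "norm (complex_of_real (1 - t)) = \<bar>1 - t\<bar>" by (simp only: norm_of_real)
      then show ?thesis using that by simp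
    qed
    then show "continuous_on {0<..<1} (\<lambda>t. Q (of_real (1 - t)))"
      by (intro continuous_on_compose2[OF holomorphic_on_imp_continuous_on[OF Q]] continuous_intros) blast
  qed simp
  have dq: "d t *\<^sub>R q t = of_real (edge_density g G t)" for t
    using eq[of t] by (cases "t \<in> {0<..<1}") (auto simp: q_def edge_density_def scaleR_conv_of_real)
  define N where "N = density lborel (\<lambda>t. ennreal (d t))"
  have iN: "integrable N f \<longleftrightarrow> integrable lborel (\<lambda>t. d t *\<^sub>R f t)" if "f \<in> borel_measurable borel"
    for f :: "real \<Rightarrow> 'b::{banach, second_countable_topology}"
    unfolding N_def using that d by (intro integrable_density) auto
  have LN: "(LINT t|N. f t) = (LINT t|lborel. d t *\<^sub>R f t)" if "f \<in> borel_measurable borel"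
    for f :: "real \<Rightarrow> complex"
    unfolding N_def using that d by (intro integral_density) auto
  have "integrable M (\<lambda>t. 1::real)" by simp
  then have "integrable lborel (edge_density g G)"
    unfolding M by (subst (asm) integrable_density) (use en in auto)
  then have iq: "integrable N q" by (subst iN) (auto simp: dq)
  have i1: "integrable N (\<lambda>t. 1::real)" by (subst iN) (use d in auto)
  have sup: "AE t in N. 0 < t \<and> t < 1 \<and> q t = Q (of_real (1 - t))"
    unfolding N_def
  proof (subst AE_density)
    show "AE t in lborel. 0 < ennreal (d t) \<longrightarrow> 0 < t \<and> t < 1 \<and> q t = Q (of_real (1 - t))"
      by (intro AE_I2) (metis d0 ennreal_0 greaterThanLessThan_iff indicator_simps(1) less_irrefl q_def scaleR_one)
  qed measurable
  obtain A where A: "A holomorphic_on ball 1 (1/5)"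
    "\<And>x. x \<in> ball 1 (1/5) \<Longrightarrow> x \<in> cut_plane \<Longrightarrow>
      (LINT t|N. q t / (1 - x * of_real t)) = A x + Q (1 - 1 / x) * (LINT t|N. 1 / (1 - x * of_real t))"
    using singular_decomposition[OF _ Q sup iq i1] by (auto simp: N_def)
  show ?thesis
  proof (rule that[OF A(1)])
    fix x :: complex assume x: "x \<in> ball 1 (1/5)" "x \<in> cut_plane"
    have "stieltjes x = (LINT t|lborel. edge_density g G t *\<^sub>R (1 / (1 - x * of_real t)))"
      unfolding stieltjes_def unfolding M by (subst integral_density) (use en in auto)
    also have "\<dots> = (LINT t|lborel. d t *\<^sub>R (q t / (1 - x * of_real t)))"
    proof (rule Bochner_Integration.integral_cong)
      fix t :: real
      have "d t *\<^sub>R (q t / (1 - x * of_real t)) = (d t *\<^sub>R q t) / (1 - x * of_real t)"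
        by (simp add: scaleR_conv_of_real)
      also have "\<dots> = edge_density g G t *\<^sub>R (1 / (1 - x * of_real t))"
        unfolding dq by (simp add: scaleR_conv_of_real)
      finally show "edge_density g G t *\<^sub>R (1 / (1 - x * of_real t)) = d t *\<^sub>R (q t / (1 - x * of_real t))" ..
    qed simp
    also have "\<dots> = (LINT t|N. q t / (1 - x * of_real t))" by (rule LN[symmetric]) measurable
    also have "\<dots> = A x + Q (1 - 1 / x) * (LINT t|N. 1 / (1 - x * of_real t))" by (rule A(2)[OF x])
    also have "(LINT t|N. 1 / (1 - x * of_real t)) = (LINT t|lborel. d t *\<^sub>R (1 / (1 - x * of_real t)))"
      by (rule LN) measurable
    finally show "stieltjes x = A x + Q (1 - 1 / x) * (LINT t|lborel. d t *\<^sub>R (1 / (1 - x * of_real t)))" .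
  qed
qed


text \<open>Write \<open>g = g0 + k\<close> with an integer \<open>k\<close> and \<open>-1 < g0 \<le> 0\<close>, and move \<open>v^k\<close> into the analytic factor.
The model is the uniform distribution for \<open>g0 = 0\<close> and the beta distribution with parameter \<open>-g0\<close>
otherwise; their transforms are \<open>- Ln (1 - x) / x\<close> and \<open>(1 - x)^g0\<close>.\<close>

lemma stieltjes_near_1:
  assumes H: "has_edge_density M g G" and um: "unit_measure M"
  obtains A B La where "A holomorphic_on ball 1 (1/5)" "B holomorphic_on ball 1 (1/5)" "log_like La"
    "\<forall>\<^sub>F x in at 1. B x \<noteq> 0"
    "\<And>x. x \<in> ball 1 (1/5) \<Longrightarrow> x \<in> cut_plane \<Longrightarrow> unit_measure.stieltjes M x = A x + B x * La (Ln (1 - x))"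
proof -
  have G: "g > -1" "G holomorphic_on ball 0 1" "G 0 \<noteq> 0"
    and Gr: "\<And>v. 0 \<le> v \<Longrightarrow> v < 1 \<Longrightarrow> G (of_real v) = of_real (Re (G (of_real v)))"
    using H by (auto simp: has_edge_density_def)
  define k where "k = nat \<lceil>g\<rceil>"
  define g0 where "g0 = g - real k"
  have "\<lceil>g\<rceil> \<ge> 0" using G by linarith
  then have k: "real k = of_int \<lceil>g\<rceil>" by (simp add: k_def)
  have g0: "-1 < g0" "g0 \<le> 0" unfolding g0_def k by linarith+
  have powg: "v powr g = v ^ k * v powr g0" if "v > 0" for v :: real
    using that by (simp add: g0_def powr_diff powr_realpow)
  have ed: "complex_of_real (edge_density g G t) = of_real (v ^ k * v powr g0) * G (of_real v)"
    if "0 < t" "t < 1" "v = 1 - t" for t v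
  proof -
    have "edge_density g G t = v powr g * Re (G (of_real v))" using that by (simp add: edge_density_def)
    then show ?thesis using Gr[of v] powg[of v] that by (metis diff_gt_0_iff_gt diff_less_eq less_add_same_cancel1 less_imp_le of_real_mult)
  qed
  have om_holo: "(\<lambda>x. Q (1 - 1 / x)) holomorphic_on ball 1 (1/5)" if "Q holomorphic_on ball 0 1" for Q
  proof -
    have "(Q \<circ> (\<lambda>x. 1 - 1 / x)) holomorphic_on ball 1 (1/5)"
    proof (rule holomorphic_on_compose_gen[OF _ that])
      show "(\<lambda>x. 1 - 1 / x) holomorphic_on ball 1 (1/5)"
        using near_1_bounds(1) by (intro holomorphic_intros) auto
      show "(\<lambda>x::complex. 1 - 1 / x) ` ball 1 (1/5) \<subseteq> ball 0 1"
      proof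
        fix w assume "w \<in> (\<lambda>x::complex. 1 - 1 / x) ` ball 1 (1/5)"
        then obtain x where "x \<in> ball 1 (1/5)" "w = 1 - 1 / x" by blast
        then show "w \<in> ball 0 1" using near_1_bounds(2)[of x] by simp
      qed
    qed
    then show ?thesis by (simp add: o_def)
  qed
  have G_ev: "\<forall>\<^sub>F x in at 1. (1 - 1 / x) ^ k * G (1 - 1 / x) \<noteq> 0"
  proof -
    have "isCont (\<lambda>x. G (1 - 1 / x)) 1"
      using om_holo[OF G(2)] by (intro continuous_on_interior[OF holomorphic_on_imp_continuous_on]) auto
    then have "((\<lambda>x. G (1 - 1 / x)) \<longlongrightarrow> G 0) (at 1)" by (simp add: isCont_def)
    then have "\<forall>\<^sub>F x in at 1. G (1 - 1 / x) \<noteq> 0" using G(3) by (rule tendsto_imp_eventually_ne)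
    moreover have "\<forall>\<^sub>F x in at (1::complex). x \<noteq> 1" by (simp add: eventually_at_filter)
    ultimately show ?thesis by eventually_elim auto
  qed
  show ?thesis
  proof (cases "g0 = 0")
    case True
    define Q where "Q v = v ^ k * G v" for v
    have Q: "Q holomorphic_on ball 0 1" unfolding Q_def[abs_def] by (intro holomorphic_intros G)
    have "complex_of_real (edge_density g G t) = of_real (indicator {0<..<1} t) * Q (of_real (1 - t))" if "0 < t" "t < 1" for t
      using ed[OF that refl] that True by (simp add: Q_def)
    then obtain A where A: "A holomorphic_on ball 1 (1/5)"
      "\<And>x. x \<in> ball 1 (1/5) \<Longrightarrow> x \<in> cut_plane \<Longrightarrow>
        unit_measure.stieltjes M x = A x + Q (1 - 1 / x) * (LINT t|lborel. indicator {0<..<1} t *\<^sub>R (1 / (1 - x * of_real t)))"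
      using edge_density_model[OF H um _ _ _ _ Q, of "indicator {0<..<1}"] by (auto simp: indicator_def)
    show ?thesis
    proof (rule that[of A "\<lambda>x. - Q (1 - 1 / x) / x" "\<lambda>w. w"])
      show "(\<lambda>x. - Q (1 - 1 / x) / x) holomorphic_on ball 1 (1/5)"
        using near_1_bounds(1) by (intro holomorphic_intros om_holo Q) auto
      have "\<forall>\<^sub>F x in at (1::complex). x \<noteq> 0" by (rule tendsto_imp_eventually_ne[of "\<lambda>x. x" 1]) auto
      with G_ev show "\<forall>\<^sub>F x in at 1. - Q (1 - 1 / x) / x \<noteq> 0"
        by eventually_elim (auto simp: Q_def)
      fix x :: complex assume x: "x \<in> ball 1 (1/5)" "x \<in> cut_plane"
      show "unit_measure.stieltjes M x = A x + - Q (1 - 1 / x) / x * Ln (1 - x)"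
        using A(2)[OF x] uniform_stieltjes[OF x(2) near_1_bounds(1)[OF x(1)]] by simp
    qed (use A log_like_id in auto)
  next
    case False
    then have g0n: "0 < - g0" "- g0 < 1" using g0 by auto
    interpret b: beta_parameter "- g0" using g0n by unfold_locales
    define c where "c = Beta (- g0) (1 - (- g0))"
    have c: "c > 0" unfolding c_def using g0n by (intro Beta_pos) auto
    \<comment> \<open>The quotient of \<open>v^k G(v)\<close> by the analytic factor \<open>(1 - v)^(-g0-1) / c\<close> of the beta density.\<close>
    define Q where "Q v = of_real c * (v ^ k * G v * (1 - v) powr of_real (1 + g0))" for v
    have nn: "1 - v \<notin> \<real>\<^sub>\<le>\<^sub>0" if "norm v < 1" for v :: complex
      using that complex_Re_le_cmod[of v] by (auto simp: complex_nonpos_Reals_iff)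
    have Q: "Q holomorphic_on ball 0 1" unfolding Q_def[abs_def]
      using nn by (intro holomorphic_intros G) auto
    have eq: "complex_of_real (edge_density g G t) = of_real (beta_density (- g0) t) * Q (of_real (1 - t))" if t: "0 < t" "t < 1" for t
    proof -
      have "(1 - complex_of_real (1 - t)) powr of_real (1 + g0) = complex_of_real t powr of_real (1 + g0)" by simp
      also have "\<dots> = of_real (t powr (1 + g0))" using t by (intro powr_of_real) auto
      finally have 1: "(1 - complex_of_real (1 - t)) powr of_real (1 + g0) = of_real (t powr (1 + g0))" .
      have "beta_density (- g0) t * (c * t powr (1 + g0)) = (1 - t) powr g0 * (t powr (- g0 - 1) * t powr (1 + g0))"
        using t c by (simp add: beta_density_def c_def)
      also have "t powr (- g0 - 1) * t powr (1 + g0) = 1" using t by (simp flip: powr_add)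
      finally have 2: "beta_density (- g0) t * (c * t powr (1 + g0)) = (1 - t) powr g0" by simp
      have "of_real (beta_density (- g0) t) * Q (of_real (1 - t)) =
        of_real (beta_density (- g0) t * (c * t powr (1 + g0))) * (of_real ((1 - t) ^ k) * G (of_real (1 - t)))"
        unfolding Q_def 1 by (simp only: of_real_mult of_real_power mult_ac)
      also have "\<dots> = of_real ((1 - t) ^ k * (1 - t) powr g0) * G (of_real (1 - t))"
        unfolding 2 by (simp only: of_real_mult mult_ac)
      finally show ?thesis using ed[OF t refl] by simp
    qed
    have bi: "integrable lborel (beta_density (- g0))"
      using has_bochner_integral_Beta[of "- g0" "1 - (- g0)"] g0n
      by (auto simp: beta_density_def[abs_def] has_bochner_integral_iff)
    have nonneg: "0 \<le> beta_density (- g0) t" for t using g0n by (rule beta_density_nonneg)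
    have zero: "beta_density (- g0) t = 0" if "t \<notin> {0<..<1}" for t using that by (simp add: beta_density_def)
    obtain A where A: "A holomorphic_on ball 1 (1/5)"
      "\<And>x. x \<in> ball 1 (1/5) \<Longrightarrow> x \<in> cut_plane \<Longrightarrow>
        unit_measure.stieltjes M x = A x + Q (1 - 1 / x) * (LINT t|lborel. beta_density (- g0) t *\<^sub>R (1 / (1 - x * of_real t)))"
      by (rule edge_density_model[OF H um beta_density_measurable nonneg bi zero Q eq]) (assumption | (rule that, assumption, assumption))+
    show ?thesis
    proof (rule that[of A "\<lambda>x. Q (1 - 1 / x)" "\<lambda>w. exp (of_real g0 * w)"])
      show "\<forall>\<^sub>F x in at 1. Q (1 - 1 / x) \<noteq> 0"
      proof -
        have "\<forall>\<^sub>F x in at (1::complex). x \<in> ball 1 (1/5)"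
          by (rule eventually_at_in_open') auto
        with G_ev show ?thesis
        proof eventually_elim
          case (elim x)
          have "norm (1 - 1 / x) < 1" using near_1_bounds(2)[OF elim(2)] by simp
          then have "1 - (1 - 1 / x) \<noteq> 0" using nn[of "1 - 1 / x"] by auto
          then show ?case using elim(1) c by (simp add: Q_def)
        qed
      qed
      fix x :: complex assume x: "x \<in> ball 1 (1/5)" "x \<in> cut_plane"
      have "1 - x \<noteq> 0" using x(2) by (auto intro: image_eqI[of _ _ 1])
      have "(LINT t|lborel. beta_density (- g0) t *\<^sub>R (1 / (1 - x * of_real t))) = b.stieltjes x"
        unfolding b.stieltjes_def unfolding beta_measure_def
        by (subst integral_density) (use g0n beta_density_nonneg in auto)
      also have "\<dots> = exp (of_real g0 * Ln (1 - x))"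
        using b.stieltjes_beta[OF x(2)] \<open>1 - x \<noteq> 0\<close> by (simp add: powr_def)
      finally show "unit_measure.stieltjes M x = A x + Q (1 - 1 / x) * exp (of_real g0 * Ln (1 - x))"
        using A(2)[OF x] by simp
    qed (use A om_holo[OF Q] log_like_exp[of g0] g0 False in auto)
  qed
qed

section \<open>Continuation around the branch point\<close>

text \<open>The condition that \<open>branch_point\<close> imposes on each point \<open>z\<close> close to \<open>a\<close>.\<close>

definition circle_branch :: "(complex \<Rightarrow> complex) \<Rightarrow> complex \<Rightarrow> complex \<Rightarrow> bool" where
  "circle_branch f a z \<longleftrightarrow> (\<exists>h. analytic_continuation_along
               (\<lambda>t. a + (z - a) * exp (2 * of_real pi * \<i> * of_real t)) h \<and>
             (\<forall>\<^sub>F w in nhds z. h 0 w = f w) \<and>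
             \<not> (\<forall>\<^sub>F w in nhds z. h 1 w = f w))"

lemma Ln_ratio_small:
  assumes "p \<noteq> (1::complex)" "e > 0"
  shows "\<forall>\<^sub>F z in nhds p. \<bar>Im (Ln ((1 - z) / (1 - p)))\<bar> < e"
proof -
  have "isCont (\<lambda>z. Im (Ln ((1 - z) / (1 - p)))) p"
  proof (rule isCont_Im)
    have "isCont (\<lambda>z. (1 - z) / (1 - p)) p" using assms by (intro continuous_intros) auto
    moreover have "isCont Ln ((1 - p) / (1 - p))" using assms by (intro continuous_at_Ln) auto
    ultimately show "isCont (\<lambda>z. Ln ((1 - z) / (1 - p))) p" by (rule isCont_o2)
  qed
  then have "((\<lambda>z. Im (Ln ((1 - z) / (1 - p)))) \<longlongrightarrow> Im (Ln ((1 - p) / (1 - p)))) (nhds p)"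
    by (simp add: isCont_def tendsto_nhds_iff)
  then have "((\<lambda>z. Im (Ln ((1 - z) / (1 - p)))) \<longlongrightarrow> 0) (nhds p)" using assms by simp
  from tendstoD[OF this assms(2)] show ?thesis by (simp add: dist_real_def)
qed

text \<open>If \<open>f\<close> is a single-valued function of \<open>w = Ln (1 - z)\<close>, then moving \<open>w\<close> along a vertical segment of
length \<open>2 \<pi>\<close> continues \<open>f\<close> along the circle.\<close>

lemma branch_by_logarithm:
  fixes f Q :: "complex \<Rightarrow> complex" and R :: real
  defines "W \<equiv> {w. Re w < R \<and> \<bar>Im w\<bar> < 4 * pi}"
  assumes Q: "Q holomorphic_on W"
    and f: "\<And>z. z \<in> cut_plane \<Longrightarrow> dist z 1 < exp R \<Longrightarrow> f z = Q (Ln (1 - z))"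
    and ne: "\<And>w. Re w < R \<Longrightarrow> \<bar>Im w\<bar> < pi \<Longrightarrow> Q (w + 2 * of_real pi * \<i>) \<noteq> Q w"
    and z: "z \<in> cut_plane" "0 < dist z 1" "dist z 1 < exp R"
  shows "circle_branch f 1 z"
proof -
  define w0 where "w0 = Ln (1 - z)"
  have z1: "1 - z \<noteq> 0" using z by auto
  have e0: "exp w0 = 1 - z" using z1 by (simp add: w0_def)
  have n0: "1 - z \<notin> \<real>\<^sub>\<le>\<^sub>0"
  proof
    assume "1 - z \<in> \<real>\<^sub>\<le>\<^sub>0"
    then have "z = complex_of_real (Re z)" "Re z \<ge> 1" by (auto simp: complex_nonpos_Reals_iff complex_eq_iff)
    then show False using z(1) by (metis ComplD atLeast_iff imageI)
  qed
  have im0: "\<bar>Im w0\<bar> < pi"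
    using Im_Ln_less_pi[OF n0] mpi_less_Im_Ln[OF z1] by (simp add: w0_def)
  have re0: "Re w0 < R"
  proof -
    have "exp (Re w0) = norm (1 - z)" by (metis e0 norm_exp_eq_Re)
    also have "\<dots> < exp R" using z by (simp add: dist_norm norm_minus_commute)
    finally show ?thesis by simp
  qed
  define w where "w t = w0 + 2 * of_real pi * \<i> * of_real t" for t :: real
  define ga where "ga t = 1 + (z - 1) * exp (2 * of_real pi * \<i> * of_real t)" for t :: real
  have wga: "exp (w t) = 1 - ga t" for t by (simp add: w_def ga_def exp_add e0 algebra_simps)
  have ga1: "ga t \<noteq> 1" for t using wga[of t] by auto
  have wW: "w t \<in> W" if "t \<in> {0..1}" for t
  proof -
    define u where "u = pi * t"
    have "u \<le> pi" "0 \<le> u" using that by (auto simp: u_def)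
    then have "\<bar>Im w0 + 2 * u\<bar> < 4 * pi" using im0 pi_gt_zero by linarith
    then show ?thesis using re0 by (simp add: W_def w_def u_def)
  qed
  have opW: "open W"
  proof -
    have "W = (Re -` {..<R}) \<inter> (Im -` {-4 * pi<..<4 * pi})" by (auto simp: W_def)
    then show ?thesis by (auto intro!: open_Int open_vimage continuous_intros)
  qed
  define h where "h t y = Q (w t + Ln ((1 - y) / (1 - ga t)))" for t y
  have an: "h t analytic_on {ga t}" if t: "t \<in> {0..1}" for t
  proof -
    have "(Q \<circ> (\<lambda>y. w t + Ln ((1 - y) / (1 - ga t)))) analytic_on {ga t}"
    proof (rule analytic_on_compose_gen)
      show "(\<lambda>y. w t + Ln ((1 - y) / (1 - ga t))) analytic_on {ga t}"
        using ga1[of t] by (intro analytic_intros) auto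
      show "Q analytic_on W" using Q opW by (simp add: analytic_on_open)
    qed (use wW[OF t] ga1[of t] in auto)
    then show ?thesis by (simp add: h_def[abs_def] o_def)
  qed
  have shift: "Ln ((1 - y) / (1 - ga t)) = Ln ((1 - y) / (1 - ga s)) + 2 * of_real pi * \<i> * of_real (s - t)"
    if "\<bar>s - t\<bar> < 1/4" "\<bar>Im (Ln ((1 - y) / (1 - ga s)))\<bar> < pi / 2" "y \<noteq> 1" for s t y
  proof -
    let ?p = "(1 - y) / (1 - ga s)"
    have p0: "?p \<noteq> 0" using ga1[of s] that by auto
    have "(1 - y) / (1 - ga t) = ?p * (exp (w s) / exp (w t))" using wga[of s] wga[of t] ga1[of s] by simp
    also have "exp (w s) / exp (w t) = exp (2 * of_real pi * \<i> * of_real (s - t))"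
      by (simp add: w_def exp_diff[symmetric] algebra_simps)
    also have "?p * \<dots> = exp (Ln ?p + 2 * of_real pi * \<i> * of_real (s - t))"
      using p0 by (simp add: exp_add)
    finally have eq: "(1 - y) / (1 - ga t) = exp (Ln ?p + 2 * of_real pi * \<i> * of_real (s - t))" .
    define v where "v = 2 * pi * (s - t)"
    have v: "\<bar>v\<bar> < pi / 2" using that(1) by (simp add: v_def abs_mult)
    have im: "Im (Ln ?p + 2 * of_real pi * \<i> * of_real (s - t)) = Im (Ln ?p) + v" by (simp add: v_def)
    show ?thesis unfolding eq
    proof (rule Ln_exp)
      show "- pi < Im (Ln ?p + 2 * of_real pi * \<i> * of_real (s - t))"
        unfolding im using v that(2) by linarith
      show "Im (Ln ?p + 2 * of_real pi * \<i> * of_real (s - t)) \<le> pi"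
        unfolding im using v that(2) by linarith
    qed
  qed
  have germ: "\<forall>\<^sub>F s in at t within {0..1}. \<forall>\<^sub>F y in nhds (ga s). h s y = h t y" for t
  proof -
    have "\<forall>\<^sub>F s in at t within {0..1}. \<bar>s - t\<bar> < 1/4"
      unfolding eventually_at by (intro exI[of _ "1/4"]) (auto simp: dist_real_def)
    then show ?thesis
    proof eventually_elim
      case (elim s)
      have "\<forall>\<^sub>F y in nhds (ga s). y \<noteq> 1" using ga1[of s] by (intro t1_space_nhds) auto
      moreover have "\<forall>\<^sub>F y in nhds (ga s). \<bar>Im (Ln ((1 - y) / (1 - ga s)))\<bar> < pi / 2"
        by (rule Ln_ratio_small[OF ga1[of s]]) simp
      ultimately show ?case
      proof eventually_elim
        case (elim y)
        have "w t + Ln ((1 - y) / (1 - ga t)) = w s + Ln ((1 - y) / (1 - ga s))"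
          using shift[OF \<open>\<bar>s - t\<bar> < 1/4\<close> elim(2,1)] by (simp add: w_def algebra_simps)
        then show ?case by (simp add: h_def)
      qed
    qed
  qed
  have path: "path ga" unfolding path_def ga_def[abs_def] by (intro continuous_intros)
  have cont: "analytic_continuation_along ga h"
    unfolding analytic_continuation_along_def using path an germ by blast
  have ga0: "ga 0 = z" "ga 1 = z" by (simp_all add: ga_def exp_two_pi_i)
  have start: "\<forall>\<^sub>F y in nhds z. h 0 y = f y"
  proof -
    have zne: "z \<noteq> 1" using z1 by auto
    have "\<forall>\<^sub>F y in nhds z. \<bar>Im (Ln ((1 - y) / (1 - z)))\<bar> < pi - \<bar>Im w0\<bar>"
      by (rule Ln_ratio_small[OF zne]) (use im0 in simp)
    moreover have "\<forall>\<^sub>F y in nhds z. y \<in> cut_plane \<inter> ball 1 (exp R) - {1}"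
      using z zne open_cut_plane by (intro eventually_nhds_in_open open_Diff open_Int) (auto simp: dist_commute)
    ultimately show ?thesis
    proof eventually_elim
      case (elim y)
      have "y \<noteq> 1" using elim(2) by blast
      then have q: "(1 - y) / (1 - z) \<noteq> 0" using z1 by simp
      have "1 - y = (1 - z) * ((1 - y) / (1 - z))" using z1 by simp
      also have "\<dots> = exp (w0 + Ln ((1 - y) / (1 - z)))"
        by (simp only: exp_add e0 exp_Ln[OF q])
      finally have "Ln (1 - y) = Ln (exp (w0 + Ln ((1 - y) / (1 - z))))" by simp
      also have "\<dots> = w0 + Ln ((1 - y) / (1 - z))" using elim(1) by (intro Ln_exp) auto
      finally show ?case using f[of y] elim(2) ga0 by (simp add: h_def w_def dist_commute)
    qed
  qed
  have "h 1 z \<noteq> f z"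
  proof -
    have "h 1 z = Q (w0 + 2 * of_real pi * \<i>)" using z1 by (simp add: h_def ga0 w_def)
    moreover have "f z = Q w0" using f[of z] z by (simp add: w0_def)
    ultimately show ?thesis using ne[OF re0 im0] by simp
  qed
  then have "\<not> (\<forall>\<^sub>F y in nhds z. h 1 y = f y)" using eventually_nhds_x_imp_x by blast
  then show ?thesis unfolding circle_branch_def using cont start by (auto simp: ga_def[abs_def])
qed

text \<open>The filter \<open>Re w \<rightarrow> -\<infinity>\<close> in a strip, that is \<open>x \<rightarrow> 1\<close> on finitely many sheets.\<close>

definition left_strip :: "complex filter" where
  "left_strip = filtercomap Re at_bot \<sqinter> principal {w. \<bar>Im w\<bar> \<le> 4 * pi}"

lemma eventually_left_strip:
  "eventually P left_strip \<longleftrightarrow> (\<exists>R. \<forall>w. Re w < R \<and> \<bar>Im w\<bar> \<le> 4 * pi \<longrightarrow> P w)"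
  unfolding left_strip_def eventually_inf_principal eventually_filtercomap_at_bot_dense by blast

lemma one_minus_exp_left_strip: "((\<lambda>w. 1 - exp w) \<longlongrightarrow> 1) left_strip"
proof -
  have "((\<lambda>w. exp w) \<longlongrightarrow> (0::complex)) left_strip"
    unfolding tendsto_iff eventually_left_strip
  proof (intro allI impI)
    fix e :: real assume e: "e > 0"
    have "dist (exp w) 0 < e" if "Re w < ln e" for w :: complex
    proof -
      have "exp (Re w) < exp (ln e)" using that by (subst exp_less_cancel_iff)
      then show ?thesis using e by simp
    qed
    then show "\<exists>R. \<forall>w. Re w < R \<and> \<bar>Im w\<bar> \<le> 4 * pi \<longrightarrow> dist (exp w) (0::complex) < e" by blast
  qed
  from tendsto_diff[OF tendsto_const this, of 1] show ?thesis by simp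
qed

lemma holomorphic_left_strip:
  assumes "f holomorphic_on ball 1 (1/5)"
  shows "((\<lambda>w. f (1 - exp w)) \<longlongrightarrow> f 1) left_strip"
proof -
  have "isCont f 1"
    using assms by (auto intro!: continuous_on_interior[OF holomorphic_on_imp_continuous_on])
  then show ?thesis by (rule isCont_tendsto_compose[OF _ one_minus_exp_left_strip])
qed

text \<open>A zero of \<open>B\<close> at \<open>1\<close> beats the singular function, which grows more slowly than \<open>1 / (1 - x)\<close>.\<close>

lemma log_like_mult_vanishing:
  assumes B: "B holomorphic_on ball 1 (1/5)" and La: "log_like La" and "B 1 = 0"
  shows "((\<lambda>w. B (1 - exp w) * La w) \<longlongrightarrow> 0) left_strip"
proof -
  have expLa: "((\<lambda>w. exp w * La w) \<longlongrightarrow> 0) left_strip"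
    unfolding tendsto_iff eventually_left_strip using La by (auto simp: log_like_def dist_norm)
  have "(B has_field_derivative deriv B 1) (at 1)" by (rule holomorphic_derivI[OF B]) auto
  then have "((\<lambda>x. (B x - B 1) / (x - 1)) \<longlongrightarrow> deriv B 1) (at 1)" by (simp add: has_field_derivative_iff)
  moreover have "filterlim (\<lambda>w::complex. 1 - exp w) (at 1) left_strip"
    using one_minus_exp_left_strip by (auto simp: filterlim_at)
  ultimately have "((\<lambda>w. (B (1 - exp w) - B 1) / (1 - exp w - 1)) \<longlongrightarrow> deriv B 1) left_strip" by (rule filterlim_compose)
  then have "((\<lambda>w. (B (1 - exp w) - B 1) / (1 - exp w - 1) * (exp w * La w)) \<longlongrightarrow> deriv B 1 * 0) left_strip"
    by (intro tendsto_mult expLa)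
  then have "((\<lambda>w. - (B (1 - exp w) * La w)) \<longlongrightarrow> 0) left_strip" using assms by simp
  then show ?thesis using tendsto_minus by fastforce
qed

text \<open>If \<open>B 1 \<noteq> 0\<close>, the denominator tends to infinity on all sheets; otherwise it tends to \<open>A 1\<close>.\<close>

lemma continued_denominator_tendsto:
  fixes A B La :: "complex \<Rightarrow> complex"
  assumes A: "A holomorphic_on ball 1 (1/5)" and B: "B holomorphic_on ball 1 (1/5)" and La: "log_like La"
    and A1: "B 1 = 0 \<Longrightarrow> A 1 \<noteq> 0"
  defines "E \<equiv> \<lambda>w. A (1 - exp w) + B (1 - exp w) * La w"
  shows "\<exists>l. (\<forall>\<^sub>F w in left_strip. E w \<noteq> 0) \<and> ((\<lambda>w. 1 / E w) \<longlongrightarrow> l) left_strip"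
proof (cases "B 1 = 0")
  case False
  have "filterlim La at_infinity left_strip"
    unfolding filterlim_at_infinity[OF order_refl]
  proof (intro allI impI)
    fix r :: real
    obtain R where "\<forall>w. Re w < R \<and> \<bar>Im w\<bar> \<le> 4 * pi \<longrightarrow> norm (La w) > r"
      using La unfolding log_like_def by blast
    then show "\<forall>\<^sub>F x in left_strip. r \<le> norm (La x)" unfolding eventually_left_strip by (meson less_imp_le)
  qed
  then have "filterlim (\<lambda>w. B (1 - exp w) * La w) at_infinity left_strip"
    by (rule tendsto_mult_filterlim_at_infinity[OF holomorphic_left_strip[OF B] False])
  then have inf: "filterlim E at_infinity left_strip"
    unfolding E_def by (rule tendsto_add_filterlim_at_infinity[OF holomorphic_left_strip[OF A]])
  then have "((\<lambda>w. 1 / E w) \<longlongrightarrow> 0) left_strip" by (intro tendsto_divide_0[OF tendsto_const])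
  moreover have "\<forall>\<^sub>F w in left_strip. E w \<noteq> 0"
  proof -
    have "\<forall>\<^sub>F w in left_strip. 1 \<le> norm (E w)"
      using inf unfolding filterlim_at_infinity[OF order_refl] by simp
    then show ?thesis by eventually_elim auto
  qed
  ultimately show ?thesis by blast
next
  case True
  from tendsto_add[OF holomorphic_left_strip[OF A] log_like_mult_vanishing[OF B La True]]
  have E: "(E \<longlongrightarrow> A 1) left_strip" by (simp add: E_def)
  have "((\<lambda>w. 1 / E w) \<longlongrightarrow> 1 / A 1) left_strip" using A1[OF True] by (intro tendsto_divide tendsto_const E)
  moreover have "\<forall>\<^sub>F w in left_strip. E w \<noteq> 0" by (rule tendsto_imp_eventually_ne[OF E A1[OF True]])
  ultimately show ?thesis by blast
qed

text \<open>One turn replaces \<open>E w\<close> by \<open>E (w + 2 \<pi> i)\<close> in the exponent \<open>K / E\<close>.  Both reciprocals are close to the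
same limit, so the exponent moves by at most \<open>1 < 2 \<pi>\<close>; it does move, as \<open>K\<close>, \<open>B\<close> and the increment
of the singular function are not \<open>0\<close>.\<close>

lemma mirror_map_branch:
  assumes H: "has_edge_density M g G" and um: "unit_measure M"
  obtains e where "e > 0" "\<And>z. z \<in> cut_plane \<Longrightarrow> 0 < dist z 1 \<Longrightarrow> dist z 1 < e \<Longrightarrow>
     circle_branch (unit_measure.mirror_map M) 1 z"
proof -
  interpret unit_measure M by (rule um)
  obtain A B La where A: "A holomorphic_on ball 1 (1/5)" and B: "B holomorphic_on ball 1 (1/5)" and La: "log_like La"
    and B0: "\<forall>\<^sub>F x in at 1. B x \<noteq> 0"
    and F: "\<And>x. x \<in> ball 1 (1/5) \<Longrightarrow> x \<in> cut_plane \<Longrightarrow> stieltjes x = A x + B x * La (Ln (1 - x))"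
    using stieltjes_near_1[OF H um] by metis
  let ?E = "\<lambda>w. A (1 - exp w) + B (1 - exp w) * La w"
  have A1: "A 1 \<noteq> 0" if "B 1 = 0"
  proof
    assume "A 1 = 0"
    \<comment> \<open>Then the transform would tend to \<open>0\<close> along the real axis, against its lower bound \<open>1\<close>.\<close>
    have E0: "(?E \<longlongrightarrow> 0) left_strip"
      using tendsto_add[OF holomorphic_left_strip[OF A] log_like_mult_vanishing[OF B La that]] \<open>A 1 = 0\<close> by simp
    have "filterlim complex_of_real left_strip at_bot"
      unfolding filterlim_iff eventually_left_strip
    proof (intro allI impI)
      fix P assume "\<exists>R. \<forall>w. Re w < R \<and> \<bar>Im w\<bar> \<le> 4 * pi \<longrightarrow> P w"
      then obtain R where R: "\<And>w. Re w < R \<Longrightarrow> \<bar>Im w\<bar> \<le> 4 * pi \<Longrightarrow> P w" by blast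
      show "\<forall>\<^sub>F r in at_bot. P (complex_of_real r)"
        using eventually_gt_at_bot[of R] by eventually_elim (intro R; simp)
    qed
    from filterlim_compose[OF E0 this]
    have "((\<lambda>r. ?E (complex_of_real r)) \<longlongrightarrow> 0) at_bot" .
    moreover have "\<forall>\<^sub>F r in at_bot. ?E (complex_of_real r) = stieltjes (1 - of_real (exp r))"
      using eventually_gt_at_bot[of "ln (1/5)"]
    proof eventually_elim
      case (elim r)
      have "exp r < exp (ln (1/5))" using elim by (subst exp_less_cancel_iff)
      then have e: "0 < exp r" "exp r < 1/5" by auto
      then have "1 - complex_of_real (exp r) \<in> ball 1 (1/5)" by (simp add: dist_norm del: of_real_exp)
      moreover have "1 - complex_of_real (exp r) \<in> cut_plane"
      proof
        assume "1 - complex_of_real (exp r) \<in> complex_of_real ` {1..}"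
        then obtain y where "1 - complex_of_real (exp r) = of_real y" "y \<ge> 1" by auto
        then have "1 - exp r = y" by (metis of_real_1 of_real_diff of_real_eq_iff)
        then show False using e \<open>y \<ge> 1\<close> by simp
      qed
      moreover have "Ln (1 - (1 - complex_of_real (exp r))) = of_real r"
        using Ln_of_real[of "exp r"] by (simp del: of_real_exp)
      ultimately show ?case using F[of "1 - complex_of_real (exp r)"] by (simp add: exp_of_real)
    qed
    ultimately have "((\<lambda>r. stieltjes (1 - of_real (exp r))) \<longlongrightarrow> 0) at_bot" by (rule Lim_transform_eventually)
    then have "((\<lambda>r. Re (stieltjes (1 - of_real (exp r)))) \<longlongrightarrow> 0) at_bot" by (auto dest: tendsto_Re)
    moreover have "\<forall>\<^sub>F r in at_bot. Re (stieltjes (1 - of_real (exp r))) \<ge> 1"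
      using eventually_le_at_bot[of "0::real"]
    proof eventually_elim
      case (elim r)
      have "exp r \<le> 1" "exp r > 0" using elim by auto
      then show ?case using Re_stieltjes_real(2)[of "1 - exp r"] by simp
    qed
    ultimately have "(0::real) \<ge> 1" by (intro tendsto_lowerbound[where F=at_bot]) auto
    then show False by simp
  qed
  obtain l where l: "\<forall>\<^sub>F w in left_strip. ?E w \<noteq> 0" "((\<lambda>w. 1 / ?E w) \<longlongrightarrow> l) left_strip"
    using continued_denominator_tendsto[OF A B La A1] by blast
  have cK: "isCont log_transform 1"
    using log_transform_holomorphic
    by (intro continuous_on_interior[OF holomorphic_on_imp_continuous_on]) (auto simp: interior_open open_Compl)
  \<comment> \<open>A bound for the numerator near \<open>1\<close>.\<close>
  define k where "k = norm (log_transform 1) + 1"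
  have k: "k > 0" by (simp add: k_def add_nonneg_pos)
  have "\<forall>\<^sub>F x in nhds 1. norm (log_transform x) < k"
    using cK by (intro order_tendstoD(2)[OF tendsto_norm]) (auto simp: isCont_def tendsto_nhds_iff k_def)
  moreover have "\<forall>\<^sub>F x in nhds 1. log_transform x \<noteq> 0"
    using cK log_transform_1_nonzero by (intro tendsto_imp_eventually_ne[where c="log_transform 1"]) (auto simp: isCont_def tendsto_nhds_iff)
  moreover have "\<forall>\<^sub>F x in nhds 1. x \<noteq> 1 \<longrightarrow> B x \<noteq> 0" using B0 by (simp add: eventually_at_filter)
  ultimately have "\<forall>\<^sub>F x in nhds 1. norm (log_transform x) < k \<and> log_transform x \<noteq> 0 \<and> (x \<noteq> 1 \<longrightarrow> B x \<noteq> 0)"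
    by eventually_elim auto
  then obtain d where d: "d > 0" "\<And>x. dist x 1 < d \<Longrightarrow> norm (log_transform x) < k \<and> log_transform x \<noteq> 0 \<and> (x \<noteq> 1 \<longrightarrow> B x \<noteq> 0)"
    by (auto simp: eventually_nhds_metric)
  obtain R1 where R1: "\<And>w. Re w < R1 \<Longrightarrow> \<bar>Im w\<bar> \<le> 4 * pi \<Longrightarrow> ?E w \<noteq> 0 \<and> norm (1 / ?E w - l) < 1 / (2 * k)"
  proof -
    have "\<forall>\<^sub>F w in left_strip. dist (1 / ?E w) l < 1 / (2 * k)" using k by (intro tendstoD[OF l(2)]) auto
    with l(1) have "\<forall>\<^sub>F w in left_strip. ?E w \<noteq> 0 \<and> norm (1 / ?E w - l) < 1 / (2 * k)"
      by eventually_elim (auto simp: dist_norm)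
    then show ?thesis using that unfolding eventually_left_strip by blast
  qed
  define R where "R = min R1 (min (ln d) (ln (1/5)))"
  have near: "dist (1 - exp w) 1 < d" "1 - exp w \<in> ball 1 (1/5)" "Re w < R1" if "Re w < R" for w
  proof -
    have "exp (Re w) < exp (ln d)" "exp (Re w) < exp (ln (1/5))" using that by (simp_all only: exp_less_cancel_iff R_def min_less_iff_conj)
    then show "dist (1 - exp w) 1 < d" "1 - exp w \<in> ball 1 (1/5)" using d by (auto simp: dist_norm)
    show "Re w < R1" using that by (simp add: R_def)
  qed
  define Q where "Q w = exp (log_transform (1 - exp w) / ?E w)" for w
  let ?W = "{w. Re w < R \<and> \<bar>Im w\<bar> < 4 * pi}"
  show ?thesis
  proof (rule that[of "exp R"])
    fix z assume z: "z \<in> cut_plane" "0 < dist z 1" "dist z 1 < exp R"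
    show "circle_branch mirror_map 1 z"
    proof (rule branch_by_logarithm[OF _ _ _ z])
      show "Q holomorphic_on ?W"
      proof -
        have sub: "(\<lambda>w. 1 - exp w) ` ?W \<subseteq> ball 1 (1/5)" using near(2) by blast
        have sub2: "(\<lambda>w. 1 - exp w) ` ?W \<subseteq> - \<real>\<^sub>\<le>\<^sub>0"
        proof
          fix x assume "x \<in> (\<lambda>w. 1 - exp w) ` ?W"
          then have "Re x > 0" using sub near_1_bounds(3) by blast
          then show "x \<in> - \<real>\<^sub>\<le>\<^sub>0" by (auto simp: complex_nonpos_Reals_iff)
        qed
        have ex: "(\<lambda>w. 1 - exp w) holomorphic_on ?W" by (intro holomorphic_intros)
        note c = holomorphic_on_compose_gen[OF ex _ sub, unfolded o_def] holomorphic_on_compose_gen[OF ex _ sub2, unfolded o_def]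
        have "La holomorphic_on ?W" using La by (auto simp: log_like_def intro: holomorphic_on_subset)
        then show ?thesis unfolding Q_def[abs_def]
          using R1 near(3) by (intro holomorphic_intros c A B log_transform_holomorphic) auto
      qed
      fix y assume y: "y \<in> cut_plane" "dist y 1 < exp R"
      have y1: "1 - y \<noteq> 0" using y(1) by (auto intro: image_eqI[of _ _ 1])
      have ey: "exp (Ln (1 - y)) = 1 - y" using y1 by simp
      have "exp (Re (Ln (1 - y))) = norm (1 - y)" using y1 by simp
      then have "exp (Re (Ln (1 - y))) < exp R" using y by (simp add: dist_norm norm_minus_commute)
      then have "Re (Ln (1 - y)) < R" by simp
      from near(2)[OF this] have yb: "y \<in> ball 1 (1/5)" by (simp add: ey)
      then have "y \<notin> \<real>\<^sub>\<le>\<^sub>0" using near_1_bounds(3)[OF yb] by (auto simp: complex_nonpos_Reals_iff)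
      then show "mirror_map y = Q (Ln (1 - y))"
        using mirror_map_eq_exp[OF y(1)] F[OF yb y(1)] by (simp add: Q_def ey)
    next
      fix w assume w: "Re w < R" "\<bar>Im w\<bar> < pi"
      let ?w' = "w + 2 * of_real pi * \<i>"
      let ?K = "log_transform (1 - exp w)"
      have ee: "exp ?w' = exp w" by (simp add: exp_add exp_two_pi_i)
      note n = near[OF w(1)]
      have Kb: "norm ?K < k" "?K \<noteq> 0" "B (1 - exp w) \<noteq> 0" using d(2)[OF n(1)] by auto
      have E1: "?E w \<noteq> 0" "norm (1 / ?E w - l) < 1 / (2 * k)" using R1[of w] n(3) w pi_gt_zero by auto
      have E2: "?E ?w' \<noteq> 0" "norm (1 / ?E ?w' - l) < 1 / (2 * k)" using R1[of ?w'] n(3) w pi_gt_zero by auto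
      have "norm (1 / ?E ?w' - 1 / ?E w) < 1 / k"
        using norm_triangle_ineq4[of "1 / ?E ?w' - l" "1 / ?E w - l"] E1 E2 by simp
      then have "norm ?K * norm (1 / ?E ?w' - 1 / ?E w) \<le> k * (1 / k)"
        using Kb k by (intro mult_mono) auto
      then have small: "norm (?K / ?E ?w' - ?K / ?E w) \<le> 1"
        using k by (simp add: norm_mult[symmetric] right_diff_distrib)
      have La_ne: "La ?w' \<noteq> La w" using La by (simp add: log_like_def)
      have "?E ?w' \<noteq> ?E w" using La_ne Kb unfolding ee by simp
      then have nz: "?K / ?E ?w' - ?K / ?E w \<noteq> 0" using E1 E2 Kb by (auto simp: divide_simps)
      show "Q ?w' \<noteq> Q w"
      proof
        assume "Q ?w' = Q w"
        then have "exp (?K / ?E ?w') = exp (?K / ?E w)" by (simp only: Q_def ee)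
        then have "exp (?K / ?E ?w' - ?K / ?E w) = 1" by (simp add: exp_diff)
        then obtain m :: int where m: "Re (?K / ?E ?w' - ?K / ?E w) = 0" "Im (?K / ?E ?w' - ?K / ?E w) = of_int (2 * m) * pi"
          unfolding exp_eq_1 by blast
        have "m \<noteq> 0" using m nz by (auto simp: complex_eq_iff)
        then have "\<bar>of_int (2 * m) * pi\<bar> \<ge> 2 * pi" by (simp add: abs_mult)
        moreover have "\<bar>Im (?K / ?E ?w' - ?K / ?E w)\<bar> \<le> 1" using abs_Im_le_cmod small order_trans by blast
        ultimately show False using m(2) pi_gt3 by simp
      qed
    qed
  qed simp
qed

section \<open>The mirror map of the hypergeometric parameters\<close>

text \<open>The upper parameters of the hypergeometric series \<open>F\<close>.\<close>

definition hg_parameters :: "nat list \<Rightarrow> real list" where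
  "hg_parameters Ns = concat (map (\<lambda>N. map (\<lambda>r. real r / real N) (sorted_list_of_set (totatives N))) Ns)"

lemma set_hg_parameters: "set (hg_parameters Ns) = (\<Union>N\<in>set Ns. (\<lambda>r. real r / real N) ` totatives N)"
  by (auto simp: hg_parameters_def)

lemma hg_parameters_Cons: "hg_parameters (N # Ns) = map (\<lambda>r. real r / real N) (sorted_list_of_set (totatives N)) @ hg_parameters Ns"
  by (simp add: hg_parameters_def)

lemma sum_list_totatives: "(\<Sum>r\<leftarrow>sorted_list_of_set (totatives N). f r) = (\<Sum>r\<in>totatives N. f r)"
  by (simp add: sum_list_distinct_conv_sum_set)

lemma prod_list_totatives: "(\<Prod>r\<leftarrow>sorted_list_of_set (totatives N). f r) = (\<Prod>r\<in>totatives N. f r :: real)"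
  using prod.distinct_set_conv_list[of "sorted_list_of_set (totatives N)" f] by simp

lemma B_vec_hg_parameters: "B_vec Ns m = C_vec Ns ^ m * (\<Prod>a\<leftarrow>hg_parameters Ns. pochhammer a m / fact m)"
proof (induction Ns)
  case Nil
  then show ?case by (simp add: B_vec_def C_vec_def hg_parameters_def)
next
  case (Cons N Ns)
  have "B_vec (N # Ns) m = B_one N m * B_vec Ns m" "C_vec (N # Ns) = C_one N * C_vec Ns"
    by (simp_all add: B_vec_def C_vec_def)
  then show ?case using Cons prod_list_totatives[of "\<lambda>r. pochhammer (real r / real N) m / fact m" N]
    by (simp add: hg_parameters_Cons B_one_def o_def power_mult_distrib mult_ac)
qed

lemma H_vec_hg_parameters: "H_vec Ns m = (\<Sum>a\<leftarrow>hg_parameters Ns. H_sum a m - H_sum 1 m)"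
proof (induction Ns)
  case Nil
  then show ?case by (simp add: H_vec_def hg_parameters_def)
next
  case (Cons N Ns)
  have "H_vec (N # Ns) m = H_one N m + H_vec Ns m" by (simp add: H_vec_def)
  then show ?case using Cons
    by (simp add: hg_parameters_Cons o_def sum_list_totatives H_one_def sum_subtractf totient_def)
qed

lemma C_vec_pos: "\<forall>N\<in>set Ns. N \<ge> 2 \<Longrightarrow> C_vec Ns > 0"
  by (induction Ns) (auto simp: C_vec_def ln_C_one(2))

lemma ln_C_vec:
  "\<forall>N\<in>set Ns. N \<ge> 2 \<Longrightarrow> (\<Sum>a\<leftarrow>hg_parameters Ns. Digamma 1 - Digamma a) = ln (C_vec Ns)"
proof (induction Ns)
  case Nil
  then show ?case by (simp add: C_vec_def hg_parameters_def)
next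
  case (Cons N Ns)
  have "C_vec (N # Ns) = C_one N * C_vec Ns" by (simp add: C_vec_def)
  moreover have "C_one N > 0" "C_vec Ns > 0" using Cons.prems C_vec_pos[of Ns] ln_C_one(2)[of N] by auto
  ultimately show ?case using Cons sum_Digamma_totatives[of N]
    by (simp add: hg_parameters_Cons o_def sum_list_totatives ln_mult)
qed

lemma hg_parameters_range:
  assumes "\<forall>N\<in>set Ns. N \<ge> 2" "a \<in> set (hg_parameters Ns)"
  shows "1 / real (Max (set Ns)) \<le> a" "a < 1"
proof -
  obtain N r where N: "N \<in> set Ns" "r \<in> totatives N" "a = real r / real N" using assms by (auto simp: set_hg_parameters)
  have N2: "N \<ge> 2" using N assms by auto
  have r: "r \<ge> 1" "r < N" using N N2 totatives_less[of r N] by (auto simp: totatives_def)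
  show "a < 1" using N r by simp
  have "N \<le> Max (set Ns)" using N by simp
  then have "1 / real (Max (set Ns)) \<le> 1 / real N" using N2 by (intro frac_le) auto
  also have "\<dots> \<le> a" using N r N2 by (simp add: divide_right_mono)
  finally show "1 / real (Max (set Ns)) \<le> a" .
qed

text \<open>The lower half-plane follows by conjugation and the negative axis by continuity; on the cut plane
there are no other points of large modulus.\<close>

lemma (in unit_measure) mirror_map_limit:
  assumes upper: "\<And>e. e > 0 \<Longrightarrow> \<exists>R. \<forall>x. Im x > 0 \<and> norm x \<ge> R \<longrightarrow> norm (log_transform x / stieltjes x - l) \<le> e"
    and l: "exp l \<in> \<real>"
  shows "filterlim mirror_map (nhds (exp l)) (at_infinity \<sqinter> principal cut_plane)"
proof (rule tendstoI)
  fix e :: real assume e: "e > 0"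
  define e' where "e' = e / 2"
  have e': "e' > 0" using e by (simp add: e'_def)
  have "isCont exp l" by simp
  then obtain d where d: "d > 0" "\<And>w. norm (w - l) < d \<Longrightarrow> norm (exp w - exp l) < e'"
    using e' by (metis LIM_eq isCont_def norm_zero right_minus_eq)
  obtain R where R: "\<And>x. Im x > 0 \<Longrightarrow> norm x \<ge> R \<Longrightarrow> norm (log_transform x / stieltjes x - l) \<le> d / 2"
    using upper[of "d / 2"] d by auto
  have up: "norm (mirror_map x - exp l) \<le> e'" if "Im x > 0" "norm x \<ge> R" for x
  proof -
    have x: "x \<in> cut_plane" "x \<notin> \<real>\<^sub>\<le>\<^sub>0" using that by (auto simp: complex_nonpos_Reals_iff)
    have "norm (log_transform x / stieltjes x - l) < d" using R[OF that] d by simp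
    then show ?thesis using d(2) mirror_map_eq_exp[OF x] by fastforce
  qed
  have bound: "norm (mirror_map x - exp l) \<le> e'" if x: "x \<in> cut_plane" "norm x \<ge> max R 1" for x
  proof -
    consider "Im x > 0" | "Im x < 0" | "Im x = 0" by linarith
    then show ?thesis
    proof cases
      case 1
      then show ?thesis using up x by simp
    next
      case 2
      then have "norm (mirror_map (cnj x) - exp l) \<le> e'" using up[of "cnj x"] x by simp
      moreover have "mirror_map (cnj x) - exp l = cnj (mirror_map x - exp l)"
        using l by (simp add: mirror_map_cnj Reals_cnj_iff)
      ultimately show ?thesis by (simp only: complex_mod_cnj)
    next
      case 3
      \<comment> \<open>Approach the real point from above.\<close>
      define y where "y n = x + \<i> * of_real (1 / real (Suc n))" for n
      have "(\<lambda>n. 1 / real (Suc n)) \<longlonglongrightarrow> 0" by (rule LIMSEQ_Suc[OF lim_inverse_n'])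
      then have "(\<lambda>n. x + \<i> * of_real (1 / real (Suc n))) \<longlonglongrightarrow> x + \<i> * of_real 0"
        by (intro tendsto_intros)
      then have ylim: "y \<longlonglongrightarrow> x" by (simp add: y_def[abs_def])
      have "isCont mirror_map x"
        using holomorphic_on_imp_continuous_on[OF mirror_map_holomorphic]
          continuous_on_eq_continuous_at[OF open_cut_plane] x(1) by blast
      from isCont_tendsto_compose[OF this ylim]
      have "(\<lambda>n. norm (mirror_map (y n) - exp l)) \<longlonglongrightarrow> norm (mirror_map x - exp l)"
        by (intro tendsto_intros)
      moreover have "norm (mirror_map (y n) - exp l) \<le> e'" for n
      proof (rule up)
        show "Im (y n) > 0" using 3 by (simp add: y_def)
        have "norm x = \<bar>Re (y n)\<bar>" using 3 by (simp add: y_def cmod_eq_Re)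
        also have "\<dots> \<le> norm (y n)" by (rule abs_Re_le_cmod)
        finally show "norm (y n) \<ge> R" using x by simp
      qed
      ultimately show ?thesis by (intro LIMSEQ_le_const2) auto
    qed
  qed
  have "\<forall>\<^sub>F x in at_infinity. norm (x :: complex) \<ge> max R 1"
    unfolding eventually_at_infinity by (intro exI[of _ "max R 1"]) simp
  then show "\<forall>\<^sub>F x in at_infinity \<sqinter> principal cut_plane. dist (mirror_map x) (exp l) < e"
    unfolding eventually_inf_principal
    by eventually_elim (use bound e in \<open>force simp: dist_norm e'_def\<close>)
qed

text \<open>Continuations are transported by the substitution \<open>x = c z\<close>.\<close>

lemma branch_point_scale:
  fixes f :: "complex \<Rightarrow> complex" and c :: real
  assumes c: "c > 0" and e: "e > 0" and lim: "complex_of_real (1 / c) islimpt D"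
    and D: "\<And>z. z \<in> D \<Longrightarrow> of_real c * z \<in> D'"
    and br: "\<And>z. z \<in> D' \<Longrightarrow> 0 < dist z 1 \<Longrightarrow> dist z 1 < e \<Longrightarrow> circle_branch f 1 z"
  shows "branch_point (\<lambda>z. f (of_real c * z)) D (of_real (1 / c))"
  unfolding branch_point_def
proof (intro conjI lim exI[of _ "e / c"] ballI impI)
  show "0 < e / c" using c e by simp
  fix z assume z: "z \<in> D" and d: "0 < dist z (of_real (1 / c)) \<and> dist z (of_real (1 / c)) < e / c"
  have "of_real c * z - 1 = of_real c * (z - of_real (1 / c))" using c by (simp add: algebra_simps)
  then have dist: "dist (of_real c * z) 1 = c * dist z (of_real (1 / c))"
    using c by (simp add: dist_norm norm_mult)
  obtain H where H: "analytic_continuation_along (\<lambda>t. 1 + (of_real c * z - 1) * exp (2 * of_real pi * \<i> * of_real t)) H"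
    "\<forall>\<^sub>F w in nhds (of_real c * z). H 0 w = f w" "\<not> (\<forall>\<^sub>F w in nhds (of_real c * z). H 1 w = f w)"
    using br[OF D[OF z]] d c unfolding dist circle_branch_def by (auto simp: pos_less_divide_eq mult.commute)
  define ga where "ga t = of_real (1 / c) + (z - of_real (1 / c)) * exp (2 * of_real pi * \<i> * of_real t)" for t :: real
  have ga: "1 + (of_real c * z - 1) * exp (2 * of_real pi * \<i> * of_real t) = of_real c * ga t" for t
    using c by (simp add: ga_def algebra_simps)
  have sc: "filterlim (\<lambda>y. of_real c * y) (nhds (of_real c * y0)) (nhds y0)" for y0 :: complex
    by (intro tendsto_mult tendsto_const) (simp add: filterlim_ident)
  have sc': "filterlim (\<lambda>y. y / of_real c) (nhds y0) (nhds (of_real c * y0))" for y0 :: complex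
  proof -
    have "((\<lambda>y. y / of_real c) \<longlongrightarrow> of_real c * y0 / of_real c) (nhds (of_real c * y0))"
      using c by (intro tendsto_divide tendsto_const) (simp_all add: filterlim_ident)
    then show ?thesis using c by simp
  qed
  define h where "h t y = H t (of_real c * y)" for t y
  have "analytic_continuation_along ga h"
    unfolding analytic_continuation_along_def
  proof (intro conjI ballI)
    show "path ga" unfolding path_def ga_def[abs_def] by (intro continuous_intros)
    fix t :: real assume t: "t \<in> {0..1}"
    have "H t analytic_on {of_real c * ga t}" using H(1) t unfolding analytic_continuation_along_def ga by blast
    then have "(H t \<circ> (\<lambda>y. of_real c * y)) analytic_on {ga t}"
      by (intro analytic_on_compose_gen[of _ _ _ "{of_real c * ga t}"]) (auto intro!: analytic_intros)
    then show "h t analytic_on {ga t}" by (simp add: h_def[abs_def] o_def)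
    have "\<forall>\<^sub>F s in at t within {0..1}. \<forall>\<^sub>F z in nhds (of_real c * ga s). H s z = H t z"
      using H(1) t unfolding analytic_continuation_along_def ga by blast
    then show "\<forall>\<^sub>F s in at t within {0..1}. \<forall>\<^sub>F z in nhds (ga s). h s z = h t z"
      by eventually_elim (unfold h_def, rule eventually_compose_filterlim[OF _ sc])
  qed
  moreover have "\<forall>\<^sub>F w in nhds z. h 0 w = f (of_real c * w)"
    unfolding h_def by (rule eventually_compose_filterlim[OF H(2) sc])
  moreover have "\<not> (\<forall>\<^sub>F w in nhds z. h 1 w = f (of_real c * w))"
  proof
    assume "\<forall>\<^sub>F w in nhds z. h 1 w = f (of_real c * w)"
    from eventually_compose_filterlim[OF this sc']
    have "\<forall>\<^sub>F w in nhds (of_real c * z). H 1 w = f w" using c by (simp add: h_def)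
    then show False using H(3) by blast
  qed
  ultimately show "\<exists>h. analytic_continuation_along
         (\<lambda>t. of_real (1 / c) + (z - of_real (1 / c)) * exp (2 * of_real pi * \<i> * of_real t)) h \<and>
        (\<forall>\<^sub>F w in nhds z. h 0 w = f (of_real c * w)) \<and>
        \<not> (\<forall>\<^sub>F w in nhds z. h 1 w = f (of_real c * w))"
    unfolding ga_def by blast
qed

lemma has_fps_expansion_scale:
  assumes "f has_fps_expansion F"
  shows "(\<lambda>z::complex. f (of_real c * z)) has_fps_expansion Abs_fps (\<lambda>m. of_real c ^ m * fps_nth F m)"
proof -
  have "(f \<circ> (\<lambda>z. of_real c * z)) has_fps_expansion (F oo (fps_const (of_real c) * fps_X))"
    by (rule has_fps_expansion_compose[OF assms]) (auto intro!: fps_expansion_intros)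
  then show ?thesis by (simp add: o_def fps_compose_linear)
qed

theorem theorem1p3:
  fixes Ns :: "nat list"
  assumes "length Ns \<ge> 1"
    and "\<forall>N\<in>set Ns. N \<ge> 2"
  shows "\<exists>q :: complex \<Rightarrow> complex.
           q has_fps_expansion q_series Ns \<and>
           q holomorphic_on slit_plane Ns \<and>
           branch_point q (slit_plane Ns) (complex_of_real (1 / C_vec Ns)) \<and>
           (\<forall>\<gamma> :: real \<Rightarrow> complex.
              continuous_on {0..} \<gamma> \<and> \<gamma> ` {0..} \<subseteq> slit_plane Ns \<and>
              filterlim \<gamma> at_infinity at_top \<longrightarrow>
              ((\<lambda>t. q (\<gamma> t)) \<longlongrightarrow>
                 complex_of_real (- exp (- pi * cot (pi / real (Max (set Ns)))))) at_top)"
proof -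
  define c where "c = C_vec Ns"
  have c: "c > 0" unfolding c_def using assms(2) by (rule C_vec_pos)
  have ne: "set Ns \<noteq> {}" using assms(1) by auto
  define M where "M = Max (set Ns)"
  have M: "M \<in> set Ns" "M \<ge> 2" using ne assms(2) by (auto simp: M_def)
  define al where "al = 1 / real M"
  have al: "0 < al" "al \<le> 1/2" using M by (auto simp: al_def field_simps)
  have al_in: "al \<in> set (hg_parameters Ns)"
    using M unfolding set_hg_parameters al_def by (intro UN_I[OF M(1)] image_eqI[of _ _ 1]) (auto simp: totatives_def)
  define as where "as = remove1 al (hg_parameters Ns)"
  have ms: "mset (al # as) = mset (hg_parameters Ns)" using al_in by (simp add: as_def)
  have sets: "set (al # as) = set (hg_parameters Ns)" using ms by (rule mset_eq_setD)
  have rng: "al \<le> a \<and> a < 1" if "a \<in> set as" for a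
    using hg_parameters_range[OF assms(2), of a] that sets by (auto simp: al_def M_def)
  have rng': "0 < a \<and> a < 1" if "a \<in> set (al # as)" for a using rng[of a] that al by auto
  have prod_eq: "(\<Prod>a\<leftarrow>al # as. f a) = (\<Prod>a\<leftarrow>hg_parameters Ns. f a)" for f :: "real \<Rightarrow> real"
    using ms by (metis mset_map prod_mset_prod_list)
  have sum_eq: "(\<Sum>a\<leftarrow>al # as. f a) = (\<Sum>a\<leftarrow>hg_parameters Ns. f a)" for f :: "real \<Rightarrow> real"
    using ms by (metis mset_map sum_mset_sum_list)
  define P where "P = prod_measure (al # as)"
  interpret unit_measure P unfolding P_def by (rule unit_measure_prod_measure[OF rng'])
  define q where "q z = mirror_map (of_real c * z)" for z
  have slit: "of_real c * z \<in> cut_plane" if "z \<in> slit_plane Ns" for z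
  proof
    assume "of_real c * z \<in> complex_of_real ` {1..}"
    then obtain y where y: "of_real c * z = of_real y" "y \<ge> 1" by auto
    then have "z = of_real (y / c)" using c by (simp add: field_simps)
    moreover have "y / c \<in> {1 / C_vec Ns..}" using y c by (simp add: c_def divide_right_mono)
    ultimately show False using that unfolding slit_plane_def by blast
  qed
  define mom where "mom m = (LINT t|P. t ^ m)" for m
  define lmom where "lmom m = (LINT t|P. ln t * t ^ m)" for m
  have mom: "mom m = (\<Prod>a\<leftarrow>hg_parameters Ns. pochhammer a m / fact m)" for m
    by (simp only: mom_def P_def prod_measure_moment[of "al # as", OF rng'] prod_eq)
  have lmom: "lmom m = mom m * (H_vec Ns m - ln c)" for m
  proof -
    have "(\<Sum>a\<leftarrow>hg_parameters Ns. Digamma a - Digamma 1 + H_sum a m - H_sum 1 m) =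
        (\<Sum>a\<leftarrow>hg_parameters Ns. (H_sum a m - H_sum 1 m) - (Digamma 1 - Digamma a))"
      by (simp add: algebra_simps)
    also have "\<dots> = H_vec Ns m - ln c"
      by (simp only: sum_list_subtractf[of "\<lambda>a. H_sum a m - H_sum 1 m" "\<lambda>a. Digamma 1 - Digamma a"]
          ln_C_vec[OF assms(2)] H_vec_hg_parameters c_def)
    finally show ?thesis
      by (simp only: lmom_def mom P_def prod_measure_log_moment[of "al # as", OF rng'] prod_eq sum_eq)
  qed
  have F: "(\<lambda>z. stieltjes (of_real c * z)) has_fps_expansion F_series Ns"
  proof -
    have "F_series Ns = Abs_fps (\<lambda>m. of_real c ^ m * fps_nth (Abs_fps (\<lambda>m. complex_of_real (mom m))) m)"
      by (rule fps_ext) (simp add: F_series_def B_vec_hg_parameters mom c_def)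
    then show ?thesis using has_fps_expansion_scale[OF stieltjes_fps, of c] by (simp add: mom_def)
  qed
  let ?N = "\<lambda>z. log_stieltjes (of_real c * z) + of_real (ln c) * stieltjes (of_real c * z)"
  let ?S = "Abs_fps (\<lambda>m. of_real c ^ m * fps_nth (Abs_fps (\<lambda>m. complex_of_real (lmom m))) m)"
  have L: "(\<lambda>z. ?N z) has_fps_expansion G_series Ns"
  proof -
    have "(\<lambda>z. ?N z) has_fps_expansion
      ?S + fps_const (of_real (ln c)) * F_series Ns"
      unfolding lmom_def by (intro fps_expansion_intros has_fps_expansion_scale[OF log_stieltjes_fps] F)
    moreover have "?S + fps_const (of_real (ln c)) * F_series Ns = G_series Ns"
    proof (rule fps_ext)
      fix m
      have H0: "H_vec Ns 0 = 0" by (simp add: H_vec_hg_parameters H_sum_def)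
      have "c ^ m * lmom m + ln c * B_vec Ns m = H_vec Ns m * B_vec Ns m"
        by (simp add: lmom B_vec_hg_parameters mom c_def algebra_simps)
      also have "\<dots> = (if m \<ge> 1 then H_vec Ns m * B_vec Ns m else 0)" using H0 by (cases m) auto
      finally have "complex_of_real (c ^ m * lmom m + ln c * B_vec Ns m) = complex_of_real (if m \<ge> 1 then H_vec Ns m * B_vec Ns m else 0)"
        by (rule arg_cong)
      then show "fps_nth (?S + fps_const (of_real (ln c)) * F_series Ns) m
         = fps_nth (G_series Ns) m"
        by (simp add: F_series_def G_series_def)
    qed
    ultimately show ?thesis by simp
  qed
  have F0: "fps_nth (F_series Ns) 0 = 1"
    using mom[of 0] by (simp add: F_series_def B_vec_hg_parameters mom_def prob_space)
  have G0: "fps_nth (G_series Ns) 0 = 0" by (simp add: G_series_def)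
  have fps: "q has_fps_expansion q_series Ns"
  proof -
    have quot: "(\<lambda>z. ?N z / stieltjes (of_real c * z))
        has_fps_expansion G_series Ns / F_series Ns"
      by (rule has_fps_expansion_divide'[OF L F]) (simp add: F0)
    have "fps_nth (G_series Ns / F_series Ns) 0 = 0"
      using F0 G0 by (simp add: fps_divide_nth_0)
    from has_fps_expansion_compose[OF has_fps_expansion_exp1 quot this]
    have "(\<lambda>z. exp (?N z / stieltjes (of_real c * z)))
        has_fps_expansion (fps_exp 1 oo (G_series Ns / F_series Ns))"
      by (simp add: o_def)
    then have E: "(\<lambda>z. z * exp (?N z / stieltjes (of_real c * z)))
        has_fps_expansion q_series Ns"
      unfolding q_series_def by (intro has_fps_expansion_mult has_fps_expansion_fps_X)
    have "open (slit_plane Ns)"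
    proof -
      have "closed (complex_of_real ` {1 / C_vec Ns..})"
        by (intro closed_injective_linear_image) (auto intro: bounded_linear.linear bounded_linear_of_real simp: inj_on_def)
      then show ?thesis unfolding slit_plane_def by blast
    qed
    moreover have "0 \<in> slit_plane Ns" using c by (auto simp: slit_plane_def c_def divide_le_0_iff)
    ultimately have "\<forall>\<^sub>F z in nhds 0. z \<in> slit_plane Ns" by (intro eventually_nhds_in_open)
    then have "\<forall>\<^sub>F z in nhds 0. z * exp (?N z / stieltjes (of_real c * z)) = q z"
    proof eventually_elim
      case (elim z)
      have nz: "stieltjes (of_real c * z) \<noteq> 0" by (rule stieltjes_nonzero[OF slit[OF elim]])
      have "?N z / stieltjes (of_real c * z) =
          log_stieltjes (of_real c * z) / stieltjes (of_real c * z) + of_real (ln c)"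
        using nz by (simp add: add_divide_distrib)
      moreover have "exp (complex_of_real (ln c)) = of_real c" using c by (simp add: exp_of_real)
      ultimately show ?case by (simp add: q_def mirror_map_def exp_add mult_ac)
    qed
    from has_fps_expansion_cong[OF this refl] E show ?thesis by (rule iffD1)
  qed
  have holo: "q holomorphic_on slit_plane Ns"
  proof -
    have "(mirror_map \<circ> (\<lambda>z. of_real c * z)) holomorphic_on slit_plane Ns"
      by (rule holomorphic_on_compose_gen[OF _ mirror_map_holomorphic]) (use slit in \<open>auto intro!: holomorphic_intros\<close>)
    then show ?thesis by (simp add: o_def q_def[abs_def])
  qed
  have branch: "branch_point q (slit_plane Ns) (complex_of_real (1 / C_vec Ns))"
  proof -
    obtain g G where G: "has_edge_density P g G"
      using prod_measure_edge_density[of "al # as"] rng' by (auto simp: P_def)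
    obtain e where e: "e > 0" "\<And>z. z \<in> cut_plane \<Longrightarrow> 0 < dist z 1 \<Longrightarrow> dist z 1 < e \<Longrightarrow> circle_branch mirror_map 1 z"
      using mirror_map_branch[OF G unit_measure_axioms] by metis
    have "complex_of_real (1 / c) islimpt slit_plane Ns"
      unfolding islimpt_approachable
    proof (intro allI impI)
      fix r :: real assume r: "r > 0"
      let ?x = "complex_of_real (1 / c) + \<i> * of_real (r / 2)"
      have "Im ?x \<noteq> 0" using r by simp
      then have "?x \<in> slit_plane Ns" unfolding slit_plane_def by (metis ComplI Im_complex_of_real imageE)
      moreover have "?x \<noteq> of_real (1 / c)" using r by simp
      moreover have "dist ?x (of_real (1 / c)) < r" using r by (simp add: dist_norm norm_mult)
      ultimately show "\<exists>x'\<in>slit_plane Ns. x' \<noteq> complex_of_real (1 / c) \<and> dist x' (complex_of_real (1 / c)) < r" by blast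
    qed
    from branch_point_scale[OF c e(1) this slit e(2)] show ?thesis
      unfolding q_def[abs_def] c_def[symmetric] .
  qed
  define k where "k = complex_of_real (pi / sin (pi * al)) * exp (- \<i> * pi * al)"
  have k: "exp (- k) = complex_of_real (- exp (- pi * cot (pi / real (Max (set Ns)))))"
  proof -
    have "pi * al \<le> pi * (1/2)" using al by (intro mult_left_mono) auto
    then have s: "sin (pi * al) > 0" using al pi_gt_zero by (intro sin_gt_zero) (auto intro: le_less_trans)
    have "exp (- \<i> * pi * al) = cnj (cis (pi * al))" by (simp add: cis_conv_exp exp_cnj mult_ac)
    then have "k = Complex (pi * cot (pi * al)) (- pi)"
      using s by (simp add: k_def complex_eq_iff cot_def)
    then have "- k = complex_of_real (- pi * cot (pi * al)) + \<i> * of_real pi"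
      by (simp add: complex_eq_iff)
    then have "exp (- k) = exp (complex_of_real (- pi * cot (pi * al))) * exp (\<i> * of_real pi)"
      by (simp only: exp_add)
    also have "exp (\<i> * of_real pi) = (- 1 :: complex)" by simp
    also have "exp (complex_of_real (- pi * cot (pi * al))) = of_real (exp (- pi * cot (pi * al)))"
      by (rule exp_of_real)
    finally show ?thesis by (simp add: al_def M_def)
  qed
  have lim: "filterlim mirror_map (nhds (exp (- k))) (at_infinity \<sqinter> principal cut_plane)"
  proof (rule mirror_map_limit)
    show "exp (- k) \<in> \<real>" unfolding k by (rule Reals_of_real)
    fix e :: real assume e: "e > 0"
    obtain R where R: "\<And>x. Im x > 0 \<Longrightarrow> norm x \<ge> R \<Longrightarrow>
        norm (unit_measure.log_transform (prod_measure (al # as)) x / unit_measure.stieltjes (prod_measure (al # as)) x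
          + of_real (pi / sin (pi * al)) * exp (- \<i> * pi * al)) \<le> e"
    proof (rule log_transform_div_stieltjes_tendsto[where as=as and al=al and e=e])
      show "0 < al" "al \<le> 1/2" "0 < e" using al e by auto
      show "al \<le> a \<and> a < 1" if "a \<in> set as" for a using rng that by blast
    qed (rule that)
    show "\<exists>R. \<forall>x. Im x > 0 \<and> norm x \<ge> R \<longrightarrow> norm (log_transform x / stieltjes x - - k) \<le> e"
    proof (intro exI[of _ R] allI impI)
      fix x :: complex assume "Im x > 0 \<and> norm x \<ge> R"
      then show "norm (log_transform x / stieltjes x - - k) \<le> e"
        using R[of x] by (simp only: P_def k_def diff_minus_eq_add)
    qed
  qed
  have "((\<lambda>t. q (\<gamma> t)) \<longlongrightarrow> complex_of_real (- exp (- pi * cot (pi / real (Max (set Ns)))))) at_top"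
    if "continuous_on {0..} \<gamma> \<and> \<gamma> ` {0..} \<subseteq> slit_plane Ns \<and> filterlim \<gamma> at_infinity at_top" for \<gamma> :: "real \<Rightarrow> complex"
  proof -
    have "filterlim (\<lambda>t. of_real c * \<gamma> t) at_infinity at_top"
      using that c by (intro tendsto_mult_filterlim_at_infinity[OF tendsto_const]) auto
    moreover have "\<forall>\<^sub>F t in at_top. of_real c * \<gamma> t \<in> cut_plane"
      using eventually_ge_at_top[of 0] by eventually_elim (use that slit in blast)
    ultimately have "filterlim (\<lambda>t. of_real c * \<gamma> t) (at_infinity \<sqinter> principal cut_plane) at_top"
      by (simp add: filterlim_inf filterlim_principal)
    from filterlim_compose[OF lim this] show ?thesis unfolding q_def k .
  qed
  with fps holo branch show ?thesis by blast
qed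

end
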